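(* Let $p$ be a prime, $n\ge 1$, let $\overline{G}=\mathrm{PSp}_{2n}(\overline{\mathbb F}_p)$, let $\sigma$ be a Steinberg endomorphism of $\overline{G}$, let $\overline{T}$ be a maximal $\sigma$-invariant torus of $\overline{G}$, and let $\overline{N}=N_{\overline{G}}(\overline{T})$. Then $\overline{T}$ has a complement in $\overline{N}$ if and only if one of the following conditions holds: (1) $p=2$; (2) $n\le 2$.
   Context: $\overline{\mathbb F}_p$ is the algebraic closure of the field $\mathbb F_p$. $\mathrm{Sp}_{2n}(\overline{\mathbb F}_p)$ is the symplectic group regarded as a linear algebraic group, and $\mathrm{PSp}_{2n}(\overline{\mathbb F}_p)$ is its quotient by its center (the simple algebraic group of type $C_n$ of adjoint type). A Steinberg endomorphism of a connected linear algebraic group $\overline{G}$ is a surjective endomorphism $\sigma$ of the algebraic group $\overline{G}$ whose set of fixed points $\overline{G}_\sigma$ is finite. For subgroups $T\trianglelefteq N$ of a group, "$T$ has a complement in $N$" means that there is a subgroup $H$ with $N=T\rtimes H$, i.e. $N=TH$ and $T\cap H=1$; here $H$ is an abstract subgroup. *)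

theory Defs
  imports
    "HOL-Algebra.Group_Action"
    "HOL-Algebra.Algebraic_Closure_Type"
    "Jordan_Normal_Form.Matrix"
    "Berlekamp_Zassenhaus.Finite_Field"
begin

section \<open>Linear algebraic groups over an algebraically closed field\<close>

text \<open>
  Varieties are taken in the classical sense: a linear algebraic group is a group of points
  together with its coordinate ring, a \<open>'k\<close>-algebra of functions on the points.
  Regular functions are normalised to be \<open>undefined\<close> outside the carrier.
\<close>

record ('a, 'k) alg_group = "'a monoid" +
  regular :: "('a \<Rightarrow> 'k) set"

inductive_set generated_algebra :: "'a set \<Rightarrow> ('a \<Rightarrow> 'k::comm_ring_1) set \<Rightarrow> ('a \<Rightarrow> 'k) set"
  for Y :: "'a set" and S :: "('a \<Rightarrow> 'k) set"
where
  const: "(\<lambda>x\<in>Y. c) \<in> generated_algebra Y S"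
| gen: "f \<in> S \<Longrightarrow> restrict f Y \<in> generated_algebra Y S"
| add: "f \<in> generated_algebra Y S \<Longrightarrow> g \<in> generated_algebra Y S \<Longrightarrow>
    (\<lambda>x\<in>Y. f x + g x) \<in> generated_algebra Y S"
| mult: "f \<in> generated_algebra Y S \<Longrightarrow> g \<in> generated_algebra Y S \<Longrightarrow>
    (\<lambda>x\<in>Y. f x * g x) \<in> generated_algebra Y S"

definition zariski_closed :: "('a, 'k::field) alg_group \<Rightarrow> 'a set \<Rightarrow> bool" where
  "zariski_closed G Y \<longleftrightarrow> (\<exists>S \<subseteq> regular G. Y = {x \<in> carrier G. \<forall>f\<in>S. f x = 0})"

definition alg_hom :: "('a, 'k) alg_group \<Rightarrow> ('b, 'k) alg_group \<Rightarrow> ('a \<Rightarrow> 'b) set" where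
  "alg_hom G H = {\<phi> \<in> hom G H. \<forall>f \<in> regular H. restrict (f \<circ> \<phi>) (carrier G) \<in> regular G}"

definition alg_iso :: "('a, 'k) alg_group \<Rightarrow> ('b, 'k) alg_group \<Rightarrow> ('a \<Rightarrow> 'b) set" where
  "alg_iso G H = {\<phi> \<in> alg_hom G H. bij_betw \<phi> (carrier G) (carrier H) \<and>
                    inv_into (carrier G) \<phi> \<in> alg_hom H G}"

text \<open>Meaningful for a closed subgroup \<open>Y\<close> of \<open>G\<close>.\<close>

definition alg_subgroup :: "('a, 'k) alg_group \<Rightarrow> 'a set \<Rightarrow> ('a, 'k) alg_group" where
  "alg_subgroup G Y = G\<lparr>carrier := Y, regular := (\<lambda>f. restrict f Y) ` regular G\<rparr>"

text \<open>The product of \<open>r\<close> copies of the multiplicative group.\<close>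

definition Gm_power :: "nat \<Rightarrow> (nat \<Rightarrow> 'k::field, 'k) alg_group" where
  "Gm_power r =
    \<lparr>carrier = {..<r} \<rightarrow>\<^sub>E (UNIV - {0}),
     monoid.mult = (\<lambda>s t. \<lambda>i\<in>{..<r}. s i * t i),
     one = (\<lambda>i\<in>{..<r}. 1),
     regular = generated_algebra ({..<r} \<rightarrow>\<^sub>E (UNIV - {0}))
       ((\<lambda>i t. t i) ` {..<r} \<union> (\<lambda>i t. inverse (t i)) ` {..<r})\<rparr>"

definition torus :: "('a, 'k::field) alg_group \<Rightarrow> 'a set \<Rightarrow> bool" where
  "torus G T \<longleftrightarrow> subgroup T G \<and> zariski_closed G T \<and>
     (\<exists>r \<phi>. \<phi> \<in> alg_iso (Gm_power r) (alg_subgroup G T))"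

definition maximal_torus :: "('a, 'k::field) alg_group \<Rightarrow> 'a set \<Rightarrow> bool" where
  "maximal_torus G T \<longleftrightarrow> torus G T \<and> (\<forall>T'. torus G T' \<and> T \<subseteq> T' \<longrightarrow> T' = T)"

definition steinberg_endomorphism :: "('a, 'k) alg_group \<Rightarrow> ('a \<Rightarrow> 'a) \<Rightarrow> bool" where
  "steinberg_endomorphism G \<sigma> \<longleftrightarrow>
     \<sigma> \<in> alg_hom G G \<and> \<sigma> ` carrier G = carrier G \<and> finite {x \<in> carrier G. \<sigma> x = x}"

section \<open>Complements\<close>

definition has_complement :: "('a, 'm) monoid_scheme \<Rightarrow> 'a set \<Rightarrow> 'a set \<Rightarrow> bool" where
  "has_complement G T N \<longleftrightarrow>
     (\<exists>H. subgroup H G \<and> H \<subseteq> N \<and> N = T <#>\<^bsub>G\<^esub> H \<and> T \<inter> H = {\<one>\<^bsub>G\<^esub>})"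

section \<open>The projective symplectic group\<close>

definition group_center :: "('a, 'm) monoid_scheme \<Rightarrow> 'a set" where
  "group_center G = {z \<in> carrier G. \<forall>g \<in> carrier G. z \<otimes>\<^bsub>G\<^esub> g = g \<otimes>\<^bsub>G\<^esub> z}"

definition symplectic_form :: "nat \<Rightarrow> 'k::comm_ring_1 mat" where
  "symplectic_form n = four_block_mat (0\<^sub>m n n) (1\<^sub>m n) (- 1\<^sub>m n) (0\<^sub>m n n)"

text \<open>\<open>Sp n\<close> and \<open>PSp n\<close> are the groups of rank \<open>n\<close>, that is, of matrices of size \<open>2 * n\<close>.\<close>

definition Sp :: "nat \<Rightarrow> 'k::comm_ring_1 mat monoid" where
  "Sp n =
    \<lparr>carrier = {A \<in> carrier_mat (2 * n) (2 * n).
                  transpose_mat A * symplectic_form n * A = symplectic_form n},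
     monoid.mult = (*),
     one = 1\<^sub>m (2 * n)\<rparr>"

text \<open>
  The coordinate ring of \<open>PSp n\<close>, pulled back to \<open>Sp n\<close>, consists of the polynomial functions
  all of whose monomials in the matrix entries have even degree, i.e. of the invariants of the
  scheme-theoretic centre \<open>\<mu>\<^sub>2\<close>. In characteristic other than 2 these are exactly the regular
  functions on \<open>Sp n\<close> that are invariant under the centre \<open>{1, -1}\<close>. In characteristic 2, where
  the centre has only one point, they form a proper subring; it is the coordinate ring
  of the adjoint group, whereas all regular functions on \<open>Sp n\<close> would give the simply
  connected group.
\<close>

definition PSp :: "nat \<Rightarrow> ('k::field mat set, 'k) alg_group" where
  "PSp n =
    (let S = Sp n; Z = group_center S; Q = S Mod Z in
      \<lparr>carrier = carrier Q,
       monoid.mult = monoid.mult Q,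
       one = one Q,
       regular = {f \<in> extensional (carrier Q).
         (\<lambda>A\<in>carrier S. f (Z #>\<^bsub>S\<^esub> A)) \<in>
           generated_algebra (carrier S)
             {\<lambda>A. A $$ (i, j) * A $$ (k, l) | i j k l.
                i < 2 * n \<and> j < 2 * n \<and> k < 2 * n \<and> l < 2 * n}}\<rparr>)"

end

theory Submission
  imports Defs "Jordan_Normal_Form.Determinant"
begin

text \<open>
  Let \<open>K\<close> be the algebraic closure of \<open>\<bbbF>\<^sub>p\<close>, let \<open>D\<close> be the group of diagonal matrices in
  \<open>Sp\<^sub>2\<^sub>n(K)\<close> and \<open>T\<^sub>0\<close> its image in \<open>PSp\<^sub>2\<^sub>n(K)\<close>.

  \<^bold>\<open>Every maximal torus is conjugate to \<open>T\<^sub>0\<close>\<close> (\<open>maximal_torus_conjugate\<close>). Over \<open>K\<close> this has an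
  elementary proof. Let \<open>T\<close> be a torus and \<open>S\<close> its preimage in \<open>Sp\<^sub>2\<^sub>n(K)\<close>. Since \<open>T\<close> is
  2-divisible, an element of \<open>S\<close> is \<open>\<plusminus>C\<^sup>2\<close> with \<open>C\<close> in \<open>S\<close>; as \<open>C\<close> commutes with the
  elements of \<open>S\<close> up to sign, \<open>C\<^sup>2\<close> commutes with them, so \<open>S\<close> is commutative. Every element of
  \<open>K\<^sup>\<times>\<close> is a root of unity of order prime to \<open>p\<close>, so every matrix in \<open>S\<close> has finite order prime
  to \<open>p\<close> and is diagonalisable. Two common eigenvectors that are not orthogonal have inverse
  weights, so a symplectic basis of common eigenvectors can be built one hyperbolic pair at a
  time. Hence \<open>T\<close> lies in a conjugate of \<open>T\<^sub>0\<close>. That conjugate is itself a torus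
  (\<open>conj_torus_torus\<close>), so a maximal \<open>T\<close> is equal to it, and it is enough to treat \<open>T\<^sub>0\<close>.

  \<^bold>\<open>The normaliser of \<open>T\<^sub>0\<close>\<close> consists of the classes of monomial matrices
  (\<open>normalizer_diag_torus_iff\<close>), because a matrix that normalises \<open>D\<close> permutes the eigenlines
  of an element of \<open>D\<close> with distinct eigenvalues. Products of monomial matrices are
  computed from the underlying permutation and the weights.

  \<^bold>\<open>No complement for odd \<open>p\<close> and \<open>n \<ge> 3\<close>\<close> (\<open>diag_torus_no_complement\<close>). A complement contains
  lifts of the sign changes at the first two coordinates. The square of the second one
  lies in \<open>T\<^sub>0\<close> and in the complement, so it is a scalar, and the symplectic form forces
  this scalar to be \<open>-1\<close>; so the weight \<open>b\<^sub>0\<close> of the second lift at the first coordinate has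
  square \<open>-1\<close>. The two lifts also commute up to a scalar \<open>s\<close>. The third coordinate, which both
  fix, gives \<open>s = 1\<close>; the first one then gives \<open>b\<^sub>0 = b\<^sub>n = 1 / b\<^sub>0\<close>, that is \<open>b\<^sub>0\<^sup>2 = 1\<close>, a
  contradiction.

  \<^bold>\<open>Complements in the other cases.\<close> For \<open>p = 2\<close> the permutation matrices in \<open>Sp\<^sub>2\<^sub>n\<close> form one.
  For \<open>n = 1\<close> the matrix of the form generates one. For \<open>n = 2\<close> the Weyl group is dihedral of order
  8, and a semidihedral group of order 16 that contains \<open>-1\<close> maps onto a complement.
\<close>

section \<open>The algebraic closure of a finite prime field\<close>

interpretation to_ac_hom: comm_ring_hom "to_ac :: 'a::field \<Rightarrow> 'a alg_closure"
  by unfold_locales auto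

interpretation to_ac_poly_hom: map_poly_comm_ring_hom "to_ac :: 'a::field \<Rightarrow> 'a alg_closure" ..

text \<open>
  The powers of \<open>x\<close> lie in the span of finitely many of them over the finite base field.
\<close>

lemma alg_closure_finite_powers:
  fixes x :: "'a::{field, finite} alg_closure"
  shows "finite (range (\<lambda>k::nat. x ^ k))"
proof -
  obtain f :: "'a poly" where f: "f \<noteq> 0" "poly (map_poly to_ac f) x = 0"
    by (rule alg_closure_algebraic)
  let ?d = "degree f"
  let ?val = "\<lambda>c. \<Sum>i\<le>?d. to_ac (c i) * x ^ i"
  have "x ^ k \<in> ?val ` ({..?d} \<rightarrow>\<^sub>E UNIV)" for k
  proof -
    define r where "r = monom 1 k mod f"
    have "degree r \<le> ?d"
      unfolding r_def using degree_mod_less[OF f(1), of "monom 1 k"] by auto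
    have "monom 1 k = f * (monom 1 k div f) + r"
      by (simp add: r_def)
    then have "map_poly to_ac (monom 1 k)
        = map_poly to_ac f * map_poly to_ac (monom 1 k div f) + map_poly to_ac r"
      by (metis to_ac_poly_hom.hom_add to_ac_poly_hom.hom_mult)
    then have "poly (map_poly to_ac (monom 1 k)) x = poly (map_poly to_ac r) x"
      using f(2) by simp
    then have "x ^ k = poly (map_poly to_ac r) x"
      by (simp add: map_poly_monom poly_monom)
    also have "\<dots> = (\<Sum>i\<le>?d. coeff (map_poly to_ac r) i * x ^ i)"
      unfolding poly_altdef using \<open>degree r \<le> ?d\<close>
      by (intro sum.mono_neutral_left) (auto simp: degree_map_poly coeff_eq_0)
    also have "\<dots> = ?val (restrict (coeff r) {..?d})"
      by (intro sum.cong) (auto simp: coeff_map_poly)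
    finally show ?thesis by (rule image_eqI[where x = "restrict (coeff r) {..?d}"]) auto
  qed
  then have "range (\<lambda>k::nat. x ^ k) \<subseteq> ?val ` ({..?d} \<rightarrow>\<^sub>E UNIV)" by blast
  moreover have "finite ({..?d} \<rightarrow>\<^sub>E (UNIV :: 'a set))"
    by (intro finite_PiE) auto
  ultimately show ?thesis using finite_surj by blast
qed

text \<open>
  The prime-to-\<open>p\<close> part of the order suffices because the Frobenius map \<open>y \<mapsto> y ^ p\<close> is
  injective: \<open>y ^ p = 1\<close> means \<open>(y - 1) ^ p = 0\<close>.
\<close>

lemma alg_closure_torsion:
  fixes x :: "'q::prime_card mod_ring alg_closure"
  assumes "x \<noteq> 0"
  shows "\<exists>m. x ^ m = 1 \<and> (of_nat m :: 'q mod_ring alg_closure) \<noteq> 0"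
proof -
  let ?p = "CARD('q)"
  have char: "CHAR('q mod_ring alg_closure) = ?p" by simp
  have p: "prime ?p" by (rule prime_card)
  have "\<not> inj (\<lambda>k::nat. x ^ k)"
    using alg_closure_finite_powers[of x] finite_imageD infinite_UNIV_nat by blast
  then obtain a b :: nat where ab: "a < b" "x ^ a = x ^ b"
    by (metis (full_types) injI linorder_neqE_nat)
  then have "x ^ a * x ^ (b - a) = x ^ a * 1"
    by (metis le_add_diff_inverse less_imp_le mult.right_neutral power_add)
  with assms have "x ^ (b - a) = 1" by simp
  then have "\<exists>m>0. x ^ m = 1" using ab by (intro exI[of _ "b - a"]) auto
  then obtain m where m: "m > 0" "x ^ m = 1" and least: "\<And>k. k > 0 \<Longrightarrow> x ^ k = 1 \<Longrightarrow> m \<le> k"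
    using exists_least_iff[of "\<lambda>m. m > 0 \<and> x ^ m = 1"] by (metis leI)
  have "\<not> ?p dvd m"
  proof
    assume "?p dvd m"
    then obtain k where k: "m = ?p * k" by blast
    have "(x ^ k - 1 + 1) ^ ?p = (x ^ k - 1) ^ ?p + 1 ^ ?p"
      by (rule freshmans_dream) (simp_all add: p)
    then have "(x ^ k - 1) ^ ?p = 0"
      using m k by (simp flip: power_mult add: mult.commute)
    then have "x ^ k = 1" by simp
    moreover have "k > 0" using m(1) unfolding k by (cases k) auto
    ultimately have "m \<le> k" by (intro least)
    moreover have "k < m" using \<open>k > 0\<close> prime_gt_1_nat[OF p] unfolding k by simp
    ultimately show False by linarith
  qed
  then have "(of_nat m :: 'q mod_ring alg_closure) \<noteq> 0"
    unfolding of_nat_eq_0_iff_char_dvd char .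
  with m show ?thesis by blast
qed

text \<open>
  Over a finite field, \<open>\<Prod>(x - a) + 1\<close> has no root.
\<close>

lemma infinite_alg_closed:
  "infinite (UNIV :: 'k::alg_closed_field set)"
proof
  assume fin: "finite (UNIV :: 'k set)"
  define f :: "'k poly" where "f = (\<Prod>a\<in>UNIV. [:-a, 1:]) + 1"
  have "degree (\<Prod>a\<in>UNIV. [:-a, 1 :: 'k:]) = card (UNIV :: 'k set)"
    by (subst degree_prod_sum_eq) auto
  moreover have "card (UNIV :: 'k set) > 0" using fin by (simp add: card_gt_0_iff)
  ultimately have "degree f > 0"
    unfolding f_def by (subst degree_add_eq_left) auto
  then obtain x where "poly f x = 0" using alg_closed_imp_poly_has_root by blast
  moreover have "poly f x = 1" using fin by (simp add: f_def poly_prod)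
  ultimately show False by simp
qed

text \<open>
  The derivative \<open>m x\<^sup>m\<^sup>-\<^sup>1\<close> has no root in common with \<open>x\<^sup>m - 1\<close>.
\<close>

lemma roots_of_unity_split:
  fixes m :: nat
  assumes "(of_nat m :: 'k::alg_closed_field) \<noteq> 0"
  shows "\<exists>zs :: 'k list. distinct zs \<and> (\<Prod>z\<leftarrow>zs. [:-z, 1:]) = monom 1 m - 1"
proof -
  have m: "m > 0" using assms by (cases m) auto
  define f :: "'k poly" where "f = monom 1 m - 1"
  have "degree (monom 1 m + (- 1) :: 'k poly) = degree (monom (1 :: 'k) m)"
    using m by (intro degree_add_eq_left) (simp add: degree_monom_eq)
  then have deg: "degree f = m" by (simp add: f_def degree_monom_eq)
  then have lc: "lead_coeff f = 1" using m by (simp add: f_def)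
  then have "f \<noteq> 0" using m by auto
  from alg_closed_imp_factorization[OF this] lc
  obtain A where A: "f = (\<Prod>x\<in>#A. [:-x, 1:])" by auto
  obtain zs where zs: "mset zs = A" using ex_mset by blast
  have prod: "(\<Prod>z\<leftarrow>zs. [:-z, 1:]) = f"
    unfolding A zs[symmetric] by (metis mset_map prod_mset_prod_list)
  have "distinct zs"
  proof (rule ccontr)
    assume "\<not> distinct zs"
    then obtain as bs cs z where zs_eq: "zs = as @ [z] @ bs @ [z] @ cs"
      using not_distinct_decomp by blast
    define g :: "'k \<Rightarrow> 'k poly" where "g = (\<lambda>z. [:-z, 1:])"
    define h where "h = prod_list (map g as) * (prod_list (map g bs) * prod_list (map g cs))"
    have "f = g z * (g z * h)"
      unfolding prod[symmetric] g_def[symmetric] h_def zs_eq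
      by (simp only: map_append prod_list.append list.map prod_list.Cons prod_list.Nil
          mult_1_right mult_1_left ac_simps)
    then have h: "f = [:-z, 1:] * ([:-z, 1:] * h)" by (simp only: g_def)
    have "poly f z = 0" unfolding h by simp
    then have "z ^ m = 1" by (simp add: f_def poly_monom)
    have "poly (pderiv f) z = 0" unfolding h by (simp only: pderiv_mult poly_add poly_mult) simp
    then have "of_nat m * z ^ (m - 1) = 0"
      by (simp add: f_def pderiv_diff pderiv_monom poly_monom)
    with assms have "z = 0" using m by auto
    with \<open>z ^ m = 1\<close> m show False by (simp add: power_0_left)
  qed
  with prod show ?thesis unfolding f_def by blast
qed

section \<open>The symplectic group in coordinates\<close>

text \<open>
  Coordinates \<open>i\<close> and \<open>bar n i\<close> are paired by the form, and \<open>eps n i\<close> is the non-zero entry in row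
  \<open>i\<close> of its matrix.
\<close>

definition bar :: "nat \<Rightarrow> nat \<Rightarrow> nat" where
  "bar n i = (if i < n then i + n else i - n)"

definition eps :: "nat \<Rightarrow> nat \<Rightarrow> 'k::comm_ring_1" where
  "eps n i = (if i < n then 1 else - 1)"

lemma bar_less [simp]: "i < 2 * n \<Longrightarrow> bar n i < 2 * n"
  by (auto simp: bar_def)

lemma bar_bar [simp]: "i < 2 * n \<Longrightarrow> bar n (bar n i) = i"
  by (auto simp: bar_def)

lemma bar_eq_iff: "i < 2 * n \<Longrightarrow> j < 2 * n \<Longrightarrow> bar n i = j \<longleftrightarrow> i = bar n j"
  by (auto simp: bar_def)

lemma eps_bar [simp]: "i < 2 * n \<Longrightarrow> eps n (bar n i) = - eps n i"
  by (auto simp: bar_def eps_def)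

lemma eps_square [simp]: "eps n i * eps n i = 1" "eps n i * (eps n i * x) = x"
  by (auto simp: eps_def)

lemma symplectic_form_carrier [simp]: "symplectic_form n \<in> carrier_mat (2 * n) (2 * n)"
  by (simp add: symplectic_form_def mult_2)

lemma symplectic_form_dim [simp]:
  "dim_row (symplectic_form n) = 2 * n" "dim_col (symplectic_form n) = 2 * n"
  by (simp_all add: symplectic_form_def)

lemma symplectic_form_index [simp]:
  "i < 2 * n \<Longrightarrow> j < 2 * n \<Longrightarrow>
    symplectic_form n $$ (i, j) = (if j = bar n i then eps n i else 0)"
  by (auto simp: symplectic_form_def bar_def eps_def)

lemma mult_index:
  "A \<in> carrier_mat r m \<Longrightarrow> B \<in> carrier_mat m c \<Longrightarrow> i < r \<Longrightarrow> j < c \<Longrightarrow>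
    (A * B) $$ (i, j) = (\<Sum>k<m. A $$ (i, k) * B $$ (k, j))"
  by (auto simp: scalar_prod_def atLeast0LessThan intro!: sum.cong)

lemma symplectic_form_mult_index:
  assumes A: "A \<in> carrier_mat (2 * n) c" and i: "i < 2 * n" and j: "j < c"
  shows "(symplectic_form n * A) $$ (i, j) = eps n i * A $$ (bar n i, j)"
proof -
  have "(symplectic_form n * A) $$ (i, j)
      = (\<Sum>k<2 * n. if k = bar n i then eps n i * A $$ (k, j) else 0)"
    unfolding mult_index[OF symplectic_form_carrier A i j]
    by (intro sum.cong) (use i in auto)
  then show ?thesis using i by simp
qed

lemma symplectic_form_square: "symplectic_form n * symplectic_form n = - (1\<^sub>m (2 * n) :: 'k::comm_ring_1 mat)"
  by (rule eq_matI) (auto simp: symplectic_form_mult_index[OF symplectic_form_carrier] simp del: index_mult_mat(1))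

lemma congruence_index:
  assumes A: "A \<in> carrier_mat (2 * n) (2 * n)" and j: "j < 2 * n" and l: "l < 2 * n"
  shows "(transpose_mat A * symplectic_form n * A) $$ (j, l)
    = (\<Sum>i<2 * n. eps n i * A $$ (i, j) * A $$ (bar n i, l))"
proof -
  have "transpose_mat A * symplectic_form n * A = transpose_mat A * (symplectic_form n * A)"
    using A by (intro assoc_mult_mat) auto
  then have "(transpose_mat A * symplectic_form n * A) $$ (j, l)
      = (\<Sum>i<2 * n. transpose_mat A $$ (j, i) * (symplectic_form n * A) $$ (i, l))"
    using A j l by (simp only:) (intro mult_index, auto)
  also have "\<dots> = (\<Sum>i<2 * n. eps n i * A $$ (i, j) * A $$ (bar n i, l))"
    using A j l by (intro sum.cong) (auto simp: symplectic_form_mult_index[OF A] mult_ac simp del: index_mult_mat(1))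
  finally show ?thesis .
qed

lemma Sp_iff:
  "A \<in> carrier (Sp n) \<longleftrightarrow> A \<in> carrier_mat (2 * n) (2 * n) \<and>
    (\<forall>j<2 * n. \<forall>l<2 * n. (\<Sum>i<2 * n. eps n i * A $$ (i, j) * A $$ (bar n i, l))
       = (if l = bar n j then eps n j else 0))"
proof (cases "A \<in> carrier_mat (2 * n) (2 * n)")
  case True
  then have "transpose_mat A * symplectic_form n * A = symplectic_form n \<longleftrightarrow>
    (\<forall>j<2 * n. \<forall>l<2 * n. (transpose_mat A * symplectic_form n * A) $$ (j, l)
        = symplectic_form n $$ (j, l))"
    by (auto intro!: eq_matI simp del: index_mult_mat(1))
  also have "\<dots> \<longleftrightarrow> (\<forall>j<2 * n. \<forall>l<2 * n.
      (\<Sum>i<2 * n. eps n i * A $$ (i, j) * A $$ (bar n i, l)) = (if l = bar n j then eps n j else 0))"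
    using True by (simp only: congruence_index symplectic_form_index cong: all_cong)
  finally show ?thesis using True by (simp add: Sp_def)
qed (auto simp: Sp_def)

lemma Sp_simps [simp]:
  "\<one>\<^bsub>Sp n\<^esub> = 1\<^sub>m (2 * n)" "A \<otimes>\<^bsub>Sp n\<^esub> B = A * B"
  by (simp_all add: Sp_def)

lemma Sp_carrier: "A \<in> carrier (Sp n) \<Longrightarrow> A \<in> carrier_mat (2 * n) (2 * n)"
  by (simp add: Sp_def)

lemma Sp_inverse:
  fixes A :: "'k::field mat"
  assumes "A \<in> carrier (Sp n)"
  obtains B where "B \<in> carrier (Sp n)" "A * B = 1\<^sub>m (2 * n)" "B * A = 1\<^sub>m (2 * n)"
proof -
  let ?J = "symplectic_form n :: 'k mat"
  have A [simp]: "A \<in> carrier_mat (2 * n) (2 * n)"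
    and AJA: "transpose_mat A * ?J * A = ?J" using assms by (auto simp: Sp_def)
  define B where "B = - (?J * (transpose_mat A * ?J))"
  have B [simp]: "B \<in> carrier_mat (2 * n) (2 * n)" using A by (auto simp: B_def)
  have "B * A = - (?J * (transpose_mat A * ?J) * A)"
    unfolding B_def by (rule uminus_mult_left_mat) (use carrier_matD[OF A] in simp)
  also have "?J * (transpose_mat A * ?J) * A = ?J * (transpose_mat A * ?J * A)"
    by (rule assoc_mult_mat[of _ "2 * n" "2 * n" _ "2 * n" _ "2 * n"])
      (simp_all add: mult_carrier_mat[of _ "2*n" "2*n" _ "2*n"])
  also have "- \<dots> = 1\<^sub>m (2 * n)" unfolding AJA symplectic_form_square by simp
  finally have BA: "B * A = 1\<^sub>m (2 * n)" .
  then have AB: "A * B = 1\<^sub>m (2 * n)"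
    using A B mat_mult_left_right_inverse by blast
  have "transpose_mat B * ?J * B = transpose_mat B * (transpose_mat A * ?J * A) * B"
    by (simp add: AJA)
  also have "\<dots> = transpose_mat B * transpose_mat A * ?J * (A * B)"
    using A B by (simp add: assoc_mult_mat[of _ "2*n" "2*n" _ "2*n" _ "2*n"] mult_carrier_mat[of _ "2*n" "2*n" _ "2*n"])
  also have "transpose_mat B * transpose_mat A = transpose_mat (A * B)"
    using A B by (simp add: transpose_mult[of _ "2*n" "2*n" _ "2*n"])
  also have "transpose_mat (A * B) * ?J * (A * B) = ?J" unfolding AB by simp
  finally have "B \<in> carrier (Sp n)" by (simp add: Sp_def)
  with AB BA show ?thesis using that by blast
qed

lemma Sp_mult:
  assumes "A \<in> carrier (Sp n)" "B \<in> carrier (Sp n)"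
  shows "A * B \<in> carrier (Sp n)"
proof -
  let ?J = "symplectic_form n :: 'a mat"
  have A: "A \<in> carrier_mat (2 * n) (2 * n)" "transpose_mat A * ?J * A = ?J"
    and B: "B \<in> carrier_mat (2 * n) (2 * n)" "transpose_mat B * ?J * B = ?J"
    using assms by (auto simp: Sp_def)
  have "transpose_mat (A * B) * ?J * (A * B) = transpose_mat B * transpose_mat A * ?J * (A * B)"
    using A B by (simp add: transpose_mult[of _ "2*n" "2*n" _ "2*n"])
  also have "\<dots> = transpose_mat B * (transpose_mat A * ?J * A) * B"
    using A(1) B(1) by (simp add: assoc_mult_mat[of _ "2*n" "2*n" _ "2*n" _ "2*n"] mult_carrier_mat[of _ "2*n" "2*n" _ "2*n"])
  also have "\<dots> = ?J" using A B by simp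
  finally show ?thesis using A B by (simp add: Sp_def)
qed

lemma group_Sp: "group (Sp n :: 'k::field mat monoid)"
proof (rule groupI)
  show "\<one>\<^bsub>Sp n\<^esub> \<in> carrier (Sp n :: 'k mat monoid)" by (simp add: Sp_def)
  fix A B C :: "'k mat" assume A: "A \<in> carrier (Sp n)" 
  show "\<exists>B\<in>carrier (Sp n). B \<otimes>\<^bsub>Sp n\<^esub> A = \<one>\<^bsub>Sp n\<^esub>"
    using Sp_inverse[OF A] by (metis Sp_simps)
  show "\<one>\<^bsub>Sp n\<^esub> \<otimes>\<^bsub>Sp n\<^esub> A = A" using Sp_carrier[OF A] by simp
  assume B: "B \<in> carrier (Sp n)"
  show "A \<otimes>\<^bsub>Sp n\<^esub> B \<in> carrier (Sp n)" using Sp_mult[OF A B] by simp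
  assume C: "C \<in> carrier (Sp n)"
  show "A \<otimes>\<^bsub>Sp n\<^esub> B \<otimes>\<^bsub>Sp n\<^esub> C = A \<otimes>\<^bsub>Sp n\<^esub> (B \<otimes>\<^bsub>Sp n\<^esub> C)"
    using Sp_carrier[OF A] Sp_carrier[OF B] Sp_carrier[OF C] by simp
qed

lemma one_Sp: "1\<^sub>m (2 * n) \<in> carrier (Sp n :: 'k::field mat monoid)"
  using monoid.one_closed[OF group.is_monoid[OF group_Sp[of n, where 'k = 'k]]] by simp

lemma Sp_uminus: "(A :: 'k::field mat) \<in> carrier (Sp n) \<Longrightarrow> - A \<in> carrier (Sp n)"
  unfolding Sp_iff
proof (elim conjE, intro conjI allI impI)
  fix j l assume A: "A \<in> carrier_mat (2 * n) (2 * n)" and jl: "j < 2 * n" "l < 2 * n"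
    and *: "\<forall>j<2 * n. \<forall>l<2 * n. (\<Sum>i<2 * n. eps n i * A $$ (i, j) * A $$ (bar n i, l))
       = (if l = bar n j then eps n j else 0)"
  have "(\<Sum>i<2 * n. eps n i * (- A) $$ (i, j) * (- A) $$ (bar n i, l))
      = (\<Sum>i<2 * n. eps n i * A $$ (i, j) * A $$ (bar n i, l))"
    by (intro sum.cong) (use A jl in auto)
  then show "(\<Sum>i<2 * n. eps n i * (- A) $$ (i, j) * (- A) $$ (bar n i, l))
       = (if l = bar n j then eps n j else 0)" using * jl by simp
qed simp

section \<open>Weighted permutation matrices\<close>

text \<open>
  The non-zero entry of row \<open>i\<close> stands in column \<open>f i\<close>; matrix multiplication thus composes the
  permutations in the reverse order.
\<close>

definition wperm :: "nat \<Rightarrow> (nat \<Rightarrow> nat) \<Rightarrow> (nat \<Rightarrow> 'k) \<Rightarrow> 'k::comm_ring_1 mat" where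
  "wperm n f c = mat (2 * n) (2 * n) (\<lambda>(i, j). if j = f i then c i else 0)"

text \<open>
  The Weyl group of type \<open>C\<^sub>n\<close>, as the permutations of the coordinates that respect the pairing.
\<close>

definition weyl :: "nat \<Rightarrow> (nat \<Rightarrow> nat) set" where
  "weyl n = {f. f permutes {..<2 * n} \<and> (\<forall>i<2 * n. f (bar n i) = bar n (f i))}"

lemma wperm_carrier [simp]: "wperm n f c \<in> carrier_mat (2 * n) (2 * n)"
  by (simp add: wperm_def)

lemma wperm_dim [simp]: "dim_row (wperm n f c) = 2 * n" "dim_col (wperm n f c) = 2 * n"
  by (simp_all add: wperm_def)

lemma wperm_index [simp]:
  "i < 2 * n \<Longrightarrow> j < 2 * n \<Longrightarrow> wperm n f c $$ (i, j) = (if j = f i then c i else 0)"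
  by (simp add: wperm_def)

lemma weyl_less [simp]: "f \<in> weyl n \<Longrightarrow> f i < 2 * n \<longleftrightarrow> i < 2 * n"
  unfolding weyl_def using permutes_in_image[of f "{..<2 * n}" i] by auto

lemma weyl_bar: "f \<in> weyl n \<Longrightarrow> i < 2 * n \<Longrightarrow> f (bar n i) = bar n (f i)"
  by (simp add: weyl_def)

lemma weyl_id [simp]: "id \<in> weyl n"
  by (auto simp: weyl_def permutes_def)

lemma weyl_comp: "f \<in> weyl n \<Longrightarrow> g \<in> weyl n \<Longrightarrow> g \<circ> f \<in> weyl n"
  by (auto simp: weyl_def permutes_compose permutes_in_image[of _ "{..<2 * n}", simplified])

lemma weyl_inj: "f \<in> weyl n \<Longrightarrow> f i = f j \<longleftrightarrow> i = j"
  by (auto simp: weyl_def dest: permutes_inj injD)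

lemma weyl_inv: "f \<in> weyl n \<Longrightarrow> inv_into UNIV f \<in> weyl n"
proof -
  assume f: "f \<in> weyl n"
  then have p: "f permutes {..<2 * n}" by (simp add: weyl_def)
  have "inv_into UNIV f (bar n i) = bar n (inv_into UNIV f i)" if i: "i < 2 * n" for i
  proof -
    define k where "k = inv_into UNIV f i"
    have "f k = i" using p by (simp add: k_def permutes_inverses)
    moreover have "k < 2 * n" using \<open>f k = i\<close> i f by (metis weyl_less)
    ultimately have "bar n i = f (bar n k)" using f by (simp add: weyl_bar)
    then show ?thesis using p by (simp add: permutes_inverses k_def)
  qed
  then show ?thesis using p by (simp add: weyl_def permutes_inv)
qed

lemma mult_wperm_index:
  assumes A: "A \<in> carrier_mat (2 * n) r" and f: "f \<in> weyl n" and i: "i < 2 * n" and j: "j < r"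
  shows "(wperm n f c * A) $$ (i, j) = c i * A $$ (f i, j)"
proof -
  have "(wperm n f c * A) $$ (i, j) = (\<Sum>k<2 * n. if k = f i then c i * A $$ (k, j) else 0)"
    unfolding mult_index[OF wperm_carrier A i j] by (intro sum.cong) (use i in auto)
  then show ?thesis using i f by simp
qed

lemma wperm_mult:
  assumes "f \<in> weyl n" "g \<in> weyl n"
  shows "wperm n f c * wperm n g d = wperm n (g \<circ> f) (\<lambda>i. c i * d (f i))"
  by (rule eq_matI) (use assms in \<open>auto simp: mult_wperm_index[OF wperm_carrier] simp del: index_mult_mat(1)\<close>)

lemma wperm_cong: "(\<And>i. i < 2 * n \<Longrightarrow> f i = g i) \<Longrightarrow> (\<And>i. i < 2 * n \<Longrightarrow> c i = d i) \<Longrightarrow>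
    wperm n f c = wperm n g d"
  by (rule eq_matI) auto

lemma wperm_one: "1\<^sub>m (2 * n) = wperm n id (\<lambda>i. 1)"
  by (rule eq_matI) auto

lemma wperm_uminus: "- wperm n f c = wperm n f (\<lambda>i. - c i)"
  by (rule eq_matI) auto

lemma wperm_coeff_eq:
  assumes "wperm n f c = wperm n f d" "f \<in> weyl n" "i < 2 * n"
  shows "c i = d i"
proof -
  have "wperm n f c $$ (i, f i) = wperm n f d $$ (i, f i)" by (simp add: assms)
  with assms(2,3) show ?thesis by simp
qed

lemma wperm_Sp_iff:
  assumes f: "f \<in> weyl n"
  shows "wperm n f c \<in> carrier (Sp n) \<longleftrightarrow>
    (\<forall>i<2 * n. eps n i * c i * c (bar n i) = (eps n (f i) :: 'k::field))"
proof -
  have p: "f permutes {..<2 * n}" using f by (simp add: weyl_def)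
  have eq: "(\<Sum>i<2 * n. eps n i * wperm n f c $$ (i, f k) * wperm n f c $$ (bar n i, l))
      = (if l = bar n (f k) then eps n k * c k * c (bar n k) else 0)"
    if k: "k < 2 * n" and l: "l < 2 * n" for k l
  proof -
    have "(\<Sum>i<2 * n. eps n i * wperm n f c $$ (i, f k) * wperm n f c $$ (bar n i, l))
        = (\<Sum>i<2 * n. if i = k then (if l = bar n (f k) then eps n k * c k * c (bar n k) else 0) else 0)"
      by (intro sum.cong) (use k l f in \<open>auto simp: weyl_inj weyl_bar\<close>)
    then show ?thesis using k by simp
  qed
  have "wperm n f c \<in> carrier (Sp n) \<longleftrightarrow>
    (\<forall>k<2 * n. \<forall>l<2 * n. (\<Sum>i<2 * n. eps n i * wperm n f c $$ (i, f k) * wperm n f c $$ (bar n i, l))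
       = (if l = bar n (f k) then eps n (f k) else 0))" (is "_ \<longleftrightarrow> ?R")
  proof -
    have "(\<forall>j<2 * n. P j) \<longleftrightarrow> (\<forall>k<2 * n. P (f k))" for P :: "nat \<Rightarrow> bool"
    proof -
      have "(\<forall>j\<in>f ` {..<2 * n}. P j) \<longleftrightarrow> (\<forall>k\<in>{..<2 * n}. P (f k))" by blast
      then show ?thesis unfolding permutes_image[OF p] by (simp only: Ball_def lessThan_iff)
    qed
    from this[of "\<lambda>j. \<forall>l<2 * n. (\<Sum>i<2 * n. eps n i * wperm n f c $$ (i, j) * wperm n f c $$ (bar n i, l))
       = (if l = bar n j then eps n j else 0)"]
    show ?thesis unfolding Sp_iff by simp
  qed
  also have "\<dots> \<longleftrightarrow> (\<forall>k<2 * n. eps n k * c k * c (bar n k) = eps n (f k))"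
    (is "?L \<longleftrightarrow> _")
  proof (intro iffI allI impI)
    fix k assume L: ?L and k: "k < 2 * n"
    show "eps n k * c k * c (bar n k) = eps n (f k)"
      using L[rule_format, of k "bar n (f k)"] k f by (simp del: wperm_index add: eq)
  next
    fix k l assume "\<forall>k<2 * n. eps n k * c k * c (bar n k) = eps n (f k)" "k < 2 * n" "l < 2 * n"
    then show "(\<Sum>i<2 * n. eps n i * wperm n f c $$ (i, f k) * wperm n f c $$ (bar n i, l))
       = (if l = bar n (f k) then eps n (f k) else 0)" using eq by simp
  qed
  finally show ?thesis .
qed

lemma wperm_Sp_nonzero:
  fixes c :: "nat \<Rightarrow> 'k::field"
  assumes "f \<in> weyl n" "wperm n f c \<in> carrier (Sp n)" "i < 2 * n"
  shows "c i \<noteq> 0"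
proof
  assume "c i = 0"
  then have "eps n (f i) = (0 :: 'k)" using assms wperm_Sp_iff[OF assms(1), of c] by auto
  then show False by (simp add: eps_def split: if_splits)
qed

section \<open>The diagonal torus, its normaliser and the centre\<close>

definition diag_Sp :: "nat \<Rightarrow> 'k::field mat set" where
  "diag_Sp n = {A \<in> carrier (Sp n). diagonal_mat A}"

lemma diag_Sp_wperm:
  assumes "A \<in> diag_Sp n"
  shows "A = wperm n id (\<lambda>i. A $$ (i, i))"
proof -
  have "A \<in> carrier_mat (2 * n) (2 * n)" "diagonal_mat A"
    using assms by (auto simp: diag_Sp_def Sp_carrier)
  then show ?thesis by (intro eq_matI) (auto simp: diagonal_mat_def)
qed

lemma wperm_diag_iff:
  assumes "f \<in> weyl n" "wperm n f c \<in> carrier (Sp n)"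
  shows "wperm n f c \<in> diag_Sp n \<longleftrightarrow> (\<forall>i<2 * n. f i = i)"
proof
  assume "wperm n f c \<in> diag_Sp n"
  then have off: "wperm n f c $$ (i, f i) = 0" if "i < 2 * n" "f i \<noteq> i" for i
    using that assms(1) by (simp add: diag_Sp_def diagonal_mat_def del: wperm_index)
  show "\<forall>i<2 * n. f i = i"
  proof (intro allI impI, rule ccontr)
    fix i assume i: "i < 2 * n" "f i \<noteq> i"
    then show False using off[OF i] wperm_Sp_nonzero[OF assms i(1)] assms(1) by simp
  qed
next
  assume "\<forall>i<2 * n. f i = i"
  then show "wperm n f c \<in> diag_Sp n"
    using assms(2) by (auto simp: diag_Sp_def diagonal_mat_def)
qed

lemma diag_Sp_mult:
  assumes "A \<in> diag_Sp n" "B \<in> diag_Sp n"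
  shows "A * B \<in> diag_Sp n"
proof -
  have "A * B = wperm n id (\<lambda>i. A $$ (i, i) * B $$ (i, i))"
    by (subst diag_Sp_wperm[OF assms(1)], subst diag_Sp_wperm[OF assms(2)], subst wperm_mult) auto
  moreover have "A * B \<in> carrier (Sp n)" using assms by (auto simp: diag_Sp_def Sp_mult)
  ultimately show ?thesis using wperm_diag_iff[of id n] by simp
qed

lemma diag_Sp_uminus: "A \<in> diag_Sp n \<Longrightarrow> - A \<in> diag_Sp n"
  by (auto simp: diag_Sp_def diagonal_mat_def Sp_uminus)

lemma wperm_id_Sp_iff:
  "wperm n id c \<in> carrier (Sp n) \<longleftrightarrow> (\<forall>i<2 * n. c i * c (bar n i) = (1 :: 'k::field))"
proof -
  have "eps n i * c i * c (bar n i) = eps n i \<longleftrightarrow> c i * c (bar n i) = 1" for i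
    by (cases "i < n") (auto simp: eps_def minus_equation_iff[of 1])
  then show ?thesis by (simp add: wperm_Sp_iff)
qed

lemma diag_Sp_entries:
  assumes "A \<in> diag_Sp n" "i < 2 * n"
  shows "A $$ (i, i) * A $$ (bar n i, bar n i) = 1"
proof -
  have "wperm n id (\<lambda>i. A $$ (i, i)) \<in> carrier (Sp n)"
    using assms diag_Sp_wperm[OF assms(1)] by (auto simp: diag_Sp_def)
  then show ?thesis using assms(2) by (simp add: wperm_id_Sp_iff)
qed

lemma wperm_id_diag_Sp:
  "wperm n id c \<in> carrier (Sp n) \<Longrightarrow> wperm n id c \<in> diag_Sp n"
  by (subst wperm_diag_iff) auto

lemma exists_generic_parameters:
  assumes "infinite (UNIV :: 'k::field set)"
  shows "\<exists>t :: nat \<Rightarrow> 'k. (\<forall>i<n. t i \<noteq> 0 \<and> t i * t i \<noteq> 1) \<and>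
    (\<forall>i<n. \<forall>j<i. t i \<noteq> t j \<and> t i * t j \<noteq> 1)"
proof (induction n)
  case (Suc n)
  then obtain t :: "nat \<Rightarrow> 'k" where t: "\<forall>i<n. t i \<noteq> 0 \<and> t i * t i \<noteq> 1"
    "\<forall>i<n. \<forall>j<i. t i \<noteq> t j \<and> t i * t j \<noteq> 1" by blast
  have "finite ({0, 1, -1} \<union> t ` {..<n} \<union> (\<lambda>i. inverse (t i)) ` {..<n})" by simp
  from ex_new_if_finite[OF assms this]
  obtain x where x: "x \<notin> {0, 1, -1} \<union> t ` {..<n} \<union> (\<lambda>i. inverse (t i)) ` {..<n}"
    by (elim exE)
  have "x \<noteq> 1" "x \<noteq> - 1" using x by simp_all
  then have "x * x \<noteq> 1" by (simp add: square_eq_1_iff)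
  moreover have "x \<noteq> t j \<and> x * t j \<noteq> 1" if "j < n" for j
  proof
    show "x \<noteq> t j" using x that by auto
    show "x * t j \<noteq> 1"
    proof
      assume "x * t j = 1"
      then have "x = inverse (t j)"
        using inverse_unique[of "t j" x] by (simp add: mult.commute)
      then show False using x that by auto
    qed
  qed
  moreover have "x \<noteq> 0" using x by simp
  ultimately have "(\<forall>i<Suc n. (t(n := x)) i \<noteq> 0 \<and> (t(n := x)) i * (t(n := x)) i \<noteq> 1) \<and>
    (\<forall>i<Suc n. \<forall>j<i. (t(n := x)) i \<noteq> (t(n := x)) j \<and> (t(n := x)) i * (t(n := x)) j \<noteq> 1)"
    using t unfolding less_Suc_eq by simp
  then show ?case by (rule exI[of _ "t(n := x)"])
qed simp

text \<open>
  In the weights \<open>t\<^sub>i\<close>, \<open>1 / t\<^sub>i\<close> of a diagonal symplectic matrix only finitely many values have to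
  be avoided to make them distinct.
\<close>

lemma exists_generic_diagonal:
  assumes "infinite (UNIV :: 'k::field set)"
  shows "\<exists>c :: nat \<Rightarrow> 'k. wperm n id c \<in> carrier (Sp n) \<and> inj_on c {..<2 * n}"
proof -
  from exists_generic_parameters[OF assms, of n]
  obtain t :: "nat \<Rightarrow> 'k" where t: "(\<forall>i<n. t i \<noteq> 0 \<and> t i * t i \<noteq> 1) \<and>
    (\<forall>i<n. \<forall>j<i. t i \<noteq> t j \<and> t i * t j \<noteq> 1)" by (rule exE)
  have t0: "t i \<noteq> 0" "t i * t i \<noteq> 1" if "i < n" for i
    using t that by simp_all
  have t_less: "t i \<noteq> t j" "t i * t j \<noteq> 1" if "i < n" "j < i" for i j
    using t that by simp_all
  have t': "t i \<noteq> t j" if "i < n" "j < n" "i \<noteq> j" for i j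
    using t_less(1)[of i j] t_less(1)[of j i] that by (cases "i < j") auto
  have t'': "t i * t j \<noteq> 1" if "i < n" "j < n" for i j
    using t_less(2)[of i j] t_less(2)[of j i] t0(2)[of i] that
    by (cases i j rule: linorder_cases) (auto simp: mult.commute)
  define c where "c i = (if i < n then t i else inverse (t (i - n)))" for i
  have "wperm n id c \<in> carrier (Sp n)"
    unfolding wperm_id_Sp_iff using t0 by (auto simp: c_def bar_def)
  moreover have "inj_on c {..<2 * n}"
  proof (rule inj_onI)
    fix i j assume ij: "i \<in> {..<2 * n}" "j \<in> {..<2 * n}" and eq: "c i = c j"
    have inv: "t a \<noteq> inverse (t b)" if "a < n" "b < n" for a b
      using t''[OF that] t0(1)[OF that(2)] by auto
    consider "i < n" "j < n" | "i < n" "\<not> j < n" | "\<not> i < n" "j < n" | "\<not> i < n" "\<not> j < n"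
      by blast
    then show "i = j"
    proof cases
      case 1 then show ?thesis using eq t' by (auto simp: c_def)
    next
      case 2
      then have "j - n < n" using ij by auto
      then show ?thesis using eq inv[of i "j - n"] 2 by (auto simp: c_def)
    next
      case 3
      then have "i - n < n" using ij by auto
      then show ?thesis using eq inv[of j "i - n"] 3 by (simp add: c_def)
    next
      case 4
      then have "j - n < n" "i - n < n" using ij by auto
      then have "i - n = j - n" using eq t'[of "i - n" "j - n"] 4 by (auto simp: c_def)
      then show ?thesis using 4 by linarith
    qed
  qed
  ultimately show ?thesis by blast
qed

lemma mult_wperm_id_index:
  assumes "A \<in> carrier_mat r (2 * n)" "i < r" "j < 2 * n"
  shows "(A * wperm n id c) $$ (i, j) = A $$ (i, j) * c j"
proof -
  have "(A * wperm n id c) $$ (i, j) = (\<Sum>k<2 * n. if k = j then A $$ (i, j) * c j else 0)"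
    unfolding mult_index[OF assms(1) wperm_carrier assms(2,3)]
    by (intro sum.cong) (use assms in auto)
  then show ?thesis using assms by simp
qed

text \<open>
  Conjugating a diagonal matrix with distinct entries to a diagonal matrix permutes its eigenlines;
  the symplectic form makes the permutation respect the pairing of the coordinates.
\<close>

lemma monomial_if_intertwines:
  fixes A :: "'k::field mat"
  assumes A: "A \<in> carrier (Sp n)" and c: "inj_on c {..<2 * n}"
    and eq: "A * wperm n id c = wperm n id d * A"
  shows "\<exists>f\<in>weyl n. \<exists>a. A = wperm n f a"
proof -
  note AC = Sp_carrier[OF A]
  obtain B where B: "B \<in> carrier (Sp n)" "A * B = 1\<^sub>m (2 * n)" "B * A = 1\<^sub>m (2 * n)"
    using Sp_inverse[OF A] .
  note BC = Sp_carrier[OF B(1)]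
  have weight: "c j = d i" if "i < 2 * n" "j < 2 * n" "A $$ (i, j) \<noteq> 0" for i j
  proof -
    have "A $$ (i, j) * c j = d i * A $$ (i, j)"
      using arg_cong[OF eq, of "\<lambda>M. M $$ (i, j)"] that
      by (simp add: mult_wperm_id_index[OF AC] mult_wperm_index[OF AC] del: index_mult_mat(1))
    then show ?thesis using that by simp
  qed
  have row: "\<exists>j<2 * n. A $$ (i, j) \<noteq> 0" if i: "i < 2 * n" for i
  proof (rule ccontr)
    assume "\<not> ?thesis"
    then have "(A * B) $$ (i, i) = 0" unfolding mult_index[OF AC BC i i] by auto
    then show False unfolding B(2) using i by simp
  qed
  have col: "\<exists>i<2 * n. A $$ (i, j) \<noteq> 0" if j: "j < 2 * n" for j
  proof (rule ccontr)
    assume "\<not> ?thesis"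
    then have "(B * A) $$ (j, j) = 0" unfolding mult_index[OF BC AC j j] by auto
    then show False unfolding B(3) using j by simp
  qed
  define f where "f i = (if i < 2 * n then SOME j. j < 2 * n \<and> A $$ (i, j) \<noteq> 0 else i)" for i
  have f: "f i < 2 * n \<and> A $$ (i, f i) \<noteq> 0" if "i < 2 * n" for i
    using someI_ex[OF row[OF that]] that by (simp add: f_def)
  have zero: "A $$ (i, j) = 0" if "i < 2 * n" "j < 2 * n" "j \<noteq> f i" for i j
  proof (rule ccontr)
    assume "A $$ (i, j) \<noteq> 0"
    then have "c j = c (f i)"
      using weight[OF that(1,2)] weight[OF that(1), of "f i"] f[OF that(1)] by simp
    then show False using c that f[OF that(1)] by (auto dest: inj_onD)
  qed
  have "{..<2 * n} \<subseteq> f ` {..<2 * n}"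
  proof
    fix j assume j: "j \<in> {..<2 * n}"
    then obtain i where "i < 2 * n" "A $$ (i, j) \<noteq> 0" using col by auto
    then show "j \<in> f ` {..<2 * n}" using zero[of i j] j by auto
  qed
  then have img: "f ` {..<2 * n} = {..<2 * n}" using f by auto
  then have "inj_on f {..<2 * n}" by (simp add: eq_card_imp_inj_on)
  then have perm: "f permutes {..<2 * n}"
    using img by (intro bij_imp_permutes) (auto simp: bij_betw_def f_def)
  have "f (bar n i) = bar n (f i)" if i: "i < 2 * n" for i
  proof (rule ccontr)
    assume ne: "f (bar n i) \<noteq> bar n (f i)"
    have "(\<Sum>k<2 * n. eps n k * A $$ (k, f i) * A $$ (bar n k, f (bar n i)))
        = (\<Sum>k<2 * n. if k = i then eps n i * A $$ (i, f i) * A $$ (bar n i, f (bar n i)) else 0)"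
    proof (intro sum.cong refl)
      fix k assume "k \<in> {..<2 * n}"
      then show "eps n k * A $$ (k, f i) * A $$ (bar n k, f (bar n i))
          = (if k = i then eps n i * A $$ (i, f i) * A $$ (bar n i, f (bar n i)) else 0)"
        using zero[of k "f i"] f[OF i] i permutes_inj[OF perm] by (auto dest: injD)
    qed
    also have "\<dots> \<noteq> 0" using f[OF i] f[of "bar n i"] i by (auto simp: eps_def)
    finally show False using A ne f i unfolding Sp_iff by auto
  qed
  with perm have "f \<in> weyl n" by (simp add: weyl_def)
  moreover have "A = wperm n f (\<lambda>i. A $$ (i, f i))"
    by (rule eq_matI) (use AC zero in auto)
  ultimately show ?thesis by blast
qed

lemma weyl_involI:
  assumes "\<And>k. k < 2 * n \<Longrightarrow> f (f k) = k" "\<And>k. \<not> k < 2 * n \<Longrightarrow> f k = k"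
    and "\<And>k. k < 2 * n \<Longrightarrow> f (bar n k) = bar n (f k)"
  shows "f \<in> weyl n"
proof -
  have "f (f k) = k" for k using assms(1,2)[of k] by (cases "k < 2 * n") simp_all
  then have "f permutes {..<2 * n}"
    unfolding permutes_def
  proof (intro conjI allI impI ex1I)
    fix x y assume inv: "\<And>k. f (f k) = k"
    show "f (f y) = y" by (rule inv)
    show "x = f y" if "f x = y" using inv[of x] that by simp
  qed (use assms(2) in auto)
  then show ?thesis using assms(3) by (simp add: weyl_def)
qed

text \<open>
  A central matrix commutes with a generic diagonal matrix, hence is diagonal, and its weights are
  invariant under enough permutations to be equal.
\<close>

lemma group_center_Sp:
  assumes n: "n \<ge> 1"
  shows "group_center (Sp n :: 'k::alg_closed_field mat monoid) = {1\<^sub>m (2 * n), - (1\<^sub>m (2 * n))}"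
proof (intro equalityI subsetI)
  fix z :: "'k mat" assume "z \<in> {1\<^sub>m (2 * n), - (1\<^sub>m (2 * n))}"
  moreover have "1\<^sub>m (2 * n) \<in> carrier (Sp n :: 'k mat monoid)" by (rule one_Sp)
  ultimately have "z \<in> carrier (Sp n)" by (auto simp: Sp_uminus)
  moreover have "z * g = g * z" if "g \<in> carrier (Sp n)" for g
    using \<open>z \<in> {1\<^sub>m (2 * n), - (1\<^sub>m (2 * n))}\<close> Sp_carrier[OF that] by auto
  ultimately show "z \<in> group_center (Sp n)" by (simp add: group_center_def)
next
  fix z :: "'k mat" assume "z \<in> group_center (Sp n)"
  then have z: "z \<in> carrier (Sp n)" and comm: "\<And>g. g \<in> carrier (Sp n) \<Longrightarrow> z * g = g * z"
    by (auto simp: group_center_def)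
  note zC = Sp_carrier[OF z]
  obtain t :: "nat \<Rightarrow> 'k" where t: "wperm n id t \<in> carrier (Sp n)" "inj_on t {..<2 * n}"
    using exists_generic_diagonal[OF infinite_alg_closed] by blast
  have "z $$ (i, j) = 0" if "i < 2 * n" "j < 2 * n" "i \<noteq> j" for i j
  proof -
    have "z $$ (i, j) * t j = t i * z $$ (i, j)"
      using arg_cong[OF comm[OF t(1)], of "\<lambda>M. M $$ (i, j)"] that
      by (simp add: mult_wperm_id_index[OF zC] mult_wperm_index[OF zC] del: index_mult_mat(1))
    moreover have "t i \<noteq> t j" using t(2) that by (auto dest: inj_onD)
    ultimately show ?thesis by (simp add: mult.commute)
  qed
  then have "z \<in> diag_Sp n" using z zC by (auto simp: diag_Sp_def diagonal_mat_def)
  define c where "c = (\<lambda>i. z $$ (i, i))"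
  have zc: "z = wperm n id c" using diag_Sp_wperm[OF \<open>z \<in> diag_Sp n\<close>] by (simp add: c_def)
  have invariant: "c i = c (f i)" if f: "f \<in> weyl n" "wperm n f a \<in> carrier (Sp n)" "i < 2 * n"
    for f i and a :: "nat \<Rightarrow> 'k"
  proof -
    have "z * wperm n f a = wperm n f (\<lambda>i. c i * a i)"
      unfolding zc by (subst wperm_mult) (use f in auto)
    moreover have "wperm n f a * z = wperm n f (\<lambda>i. a i * c (f i))"
      unfolding zc by (subst wperm_mult) (use f in auto)
    ultimately have "wperm n f (\<lambda>i. c i * a i) = wperm n f (\<lambda>i. a i * c (f i))"
      using comm[OF f(2)] by simp
    from wperm_coeff_eq[OF this f(1,3)] show ?thesis
      using wperm_Sp_nonzero[OF f] by simp
  qed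
  have cbar: "c i = c (bar n i)" if i: "i < 2 * n" for i
  proof -
    define f where "f k = (if k < 2 * n then bar n k else k)" for k
    have fw: "f \<in> weyl n" by (rule weyl_involI) (auto simp: f_def)
    have "wperm n f (eps n) \<in> carrier (Sp n :: 'k mat monoid)"
      unfolding wperm_Sp_iff[OF fw] by (auto simp: f_def)
    from invariant[OF fw this i] show ?thesis using i by (simp add: f_def)
  qed
  have c0: "c i = c 0" if i: "i < n" for i
  proof -
    define f where "f k = (if k = 0 then i else if k = i then 0 else
      if k = n then i + n else if k = i + n then n else k)" for k
    have f: "f 0 = i" "f i = 0" "f n = i + n" "f (i + n) = n"
      using i by (auto simp: f_def)
    have f': "f k = k" if "k \<notin> {0, i, n, i + n}" for k using that by (simp add: f_def)
    have b: "bar n 0 = n" "bar n i = i + n" "bar n n = 0" "bar n (i + n) = i"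
      using i by (auto simp: bar_def)
    have b': "bar n k \<notin> {0, i, n, i + n}" if "k < 2 * n" "k \<notin> {0, i, n, i + n}" for k
      using bar_bar[OF that(1)] that b by (metis insert_iff empty_iff)
    have e: "eps n 0 = (1 :: 'k)" "eps n i = (1 :: 'k)" "eps n n = (-1 :: 'k)" "eps n (i + n) = (-1 :: 'k)"
      using i by (auto simp: eps_def)
    have fw: "f \<in> weyl n"
    proof (rule weyl_involI)
      fix k
      show "f (f k) = k" by (cases "k \<in> {0, i, n, i + n}") (auto simp: f f')
      show "f k = k" if "\<not> k < 2 * n" using that i by (intro f') auto
      show "f (bar n k) = bar n (f k)" if "k < 2 * n"
        using f'[OF b'[OF that]] by (cases "k \<in> {0, i, n, i + n}") (auto simp: f f' b)
    qed
    have "eps n (f k) = (eps n k :: 'k)" for k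
      by (cases "k \<in> {0, i, n, i + n}") (auto simp: f f' e)
    then have "wperm n f (\<lambda>i. 1) \<in> carrier (Sp n :: 'k mat monoid)"
      unfolding wperm_Sp_iff[OF fw] by simp
    from invariant[OF fw this, of i] show ?thesis using i by (simp add: f)
  qed
  have call: "c i = c 0" if i: "i < 2 * n" for i
  proof (cases "i < n")
    case False
    then have "bar n i < n" using i by (simp add: bar_def)
    then show ?thesis using cbar[OF i] c0[of "bar n i"] by simp
  qed (rule c0)
  have "c 0 * c (bar n 0) = 1" using z n unfolding zc wperm_id_Sp_iff by auto
  then have "c 0 * c 0 = 1" using cbar[of 0] n by simp
  then consider "c 0 = 1" | "c 0 = -1" by (auto simp: square_eq_1_iff)
  then show "z \<in> {1\<^sub>m (2 * n), - (1\<^sub>m (2 * n))}"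
  proof cases
    case 1
    then have "c i = 1" if "i < 2 * n" for i using call[OF that] by simp
    then have "z = 1\<^sub>m (2 * n)" unfolding zc wperm_one by (intro wperm_cong) auto
    then show ?thesis by simp
  next
    case 2
    then have "c i = - 1" if "i < 2 * n" for i using call[OF that] by simp
    then have "z = - (1\<^sub>m (2 * n))" unfolding zc wperm_one wperm_uminus
      by (intro wperm_cong) auto
    then show ?thesis by simp
  qed
qed

section \<open>Complements under automorphisms\<close>

lemma normalizer_iff:
  fixes G (structure)
  assumes "T \<subseteq> carrier G"
  shows "g \<in> normalizer G T \<longleftrightarrow>
    g \<in> carrier G \<and> (\<lambda>t. g \<otimes>\<^bsub>G\<^esub> t \<otimes>\<^bsub>G\<^esub> inv\<^bsub>G\<^esub> g) ` T = T"
proof -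
  have "g <#\<^bsub>G\<^esub> T #>\<^bsub>G\<^esub> inv\<^bsub>G\<^esub> g = (\<lambda>t. g \<otimes>\<^bsub>G\<^esub> t \<otimes>\<^bsub>G\<^esub> inv\<^bsub>G\<^esub> g) ` T"
    by (auto simp: l_coset_def r_coset_def)
  then show ?thesis using assms by (simp add: normalizer_def stabilizer_def)
qed

lemma normalizer_iso_image:
  fixes G (structure)
  assumes G: "group G" and h: "h \<in> iso G G" and T: "T \<subseteq> carrier G"
  shows "normalizer G (h ` T) = h ` normalizer G T"
proof -
  interpret group G by (rule G)
  have hom: "h \<in> hom G G" and bij: "bij_betw h (carrier G) (carrier G)"
    using h by (auto simp: iso_def)
  interpret h: group_hom G G h by unfold_locales (rule hom)
  have inj: "inj_on h (carrier G)" and surj: "h ` carrier G = carrier G"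
    using bij by (auto simp: bij_betw_def)
  have hT: "h ` T \<subseteq> carrier G" using T by auto
  have key: "h y \<in> normalizer G (h ` T) \<longleftrightarrow> y \<in> normalizer G T" if y: "y \<in> carrier G" for y
  proof -
    let ?c = "\<lambda>t. y \<otimes> t \<otimes> inv y"
    have "(\<lambda>t. h y \<otimes> t \<otimes> inv (h y)) ` h ` T = h ` ?c ` T"
      unfolding image_image by (intro image_cong) (use y T in auto)
    moreover have "?c ` T \<subseteq> carrier G" using y T by auto
    then have "h ` ?c ` T = h ` T \<longleftrightarrow> ?c ` T = T"
      using inj_on_image_eq_iff[OF inj _ T] by simp
    ultimately show ?thesis using y T hT by (simp add: normalizer_iff)
  qed
  show ?thesis
  proof (intro equalityI subsetI)
    fix x assume x: "x \<in> normalizer G (h ` T)"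
    then have "x \<in> carrier G" using hT by (simp add: normalizer_iff)
    then obtain y where "y \<in> carrier G" "x = h y" using surj by auto
    with x key show "x \<in> h ` normalizer G T" by auto
  next
    fix x assume "x \<in> h ` normalizer G T"
    then obtain y where y: "y \<in> normalizer G T" "x = h y" by auto
    moreover have "y \<in> carrier G" using y T by (simp add: normalizer_iff)
    ultimately show "x \<in> normalizer G (h ` T)" using key by auto
  qed
qed

lemma has_complement_iso_image:
  fixes G (structure)
  assumes G: "group G" and h: "h \<in> iso G G" and T: "T \<subseteq> carrier G"
    and compl: "has_complement G T (normalizer G T)"
  shows "has_complement G (h ` T) (normalizer G (h ` T))"
proof -
  interpret group G by (rule G)
  have hom: "h \<in> hom G G" and bij: "bij_betw h (carrier G) (carrier G)"
    using h by (auto simp: iso_def)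
  interpret h: group_hom G G h by unfold_locales (rule hom)
  obtain H where H: "subgroup H G" "H \<subseteq> normalizer G T" "normalizer G T = T <#> H" "T \<inter> H = {\<one>}"
    using compl by (auto simp: has_complement_def)
  note HC = subgroup.subset[OF H(1)]
  have "normalizer G (h ` T) = h ` T <#> h ` H"
  proof -
    have "h ` (T <#> H) = h ` T <#> h ` H"
      unfolding set_mult_def using T HC by (force simp: h.hom_mult)
    then show ?thesis using H(3) normalizer_iso_image[OF G h T] by simp
  qed
  moreover have "h ` T \<inter> h ` H = {\<one>}"
    using inj_on_image_Int[OF bij_betw_imp_inj_on[OF bij] T HC] H(4) by simp
  moreover have "h ` H \<subseteq> normalizer G (h ` T)"
    using normalizer_iso_image[OF G h T] H(2) by auto
  ultimately show ?thesis
    using h.subgroup_img_is_subgroup[OF H(1)] by (auto simp: has_complement_def)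
qed

lemma has_complement_iso_iff:
  fixes G (structure)
  assumes G: "group G" and h: "h \<in> iso G G" and T: "T \<subseteq> carrier G"
  shows "has_complement G (h ` T) (normalizer G (h ` T)) \<longleftrightarrow> has_complement G T (normalizer G T)"
proof
  interpret group G by (rule G)
  let ?k = "inv_into (carrier G) h"
  assume *: "has_complement G (h ` T) (normalizer G (h ` T))"
  have bij: "bij_betw h (carrier G) (carrier G)" using h by (auto simp: iso_def)
  have "?k ` h ` T = T"
    using T bij_betw_imp_inj_on[OF bij] by (simp add: inv_into_image_cancel)
  moreover have "h ` T \<subseteq> carrier G" using T bij by (auto simp: bij_betw_def)
  ultimately show "has_complement G T (normalizer G T)"
    using has_complement_iso_image[OF G iso_set_sym[OF h] _ *] by simp
qed (rule has_complement_iso_image[OF G h T])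

lemma has_complementI:
  fixes G (structure)
  assumes G: "group G" and T: "subgroup T G" and H: "subgroup H G" "H \<subseteq> normalizer G T"
    and cover: "\<And>x. x \<in> normalizer G T \<Longrightarrow> \<exists>t\<in>T. \<exists>h\<in>H. x = t \<otimes>\<^bsub>G\<^esub> h"
    and triv: "\<And>x. x \<in> T \<Longrightarrow> x \<in> H \<Longrightarrow> x = \<one>\<^bsub>G\<^esub>"
  shows "has_complement G T (normalizer G T)"
proof -
  interpret group G by (rule G)
  note TC = subgroup.subset[OF T]
  have "t \<otimes> h \<in> normalizer G T" if th: "t \<in> T" "h \<in> H" for t h
  proof (rule subgroup.m_closed[OF normalizer_imp_subgroup[OF TC]])
    have "(\<lambda>s. t \<otimes> s \<otimes> inv t) ` T = T"
    proof (intro equalityI subsetI)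
      fix s assume s: "s \<in> T"
      have "s = t \<otimes> (inv t \<otimes> s \<otimes> t) \<otimes> inv t"
      proof -
        have C: "s \<in> carrier G" "t \<in> carrier G" using s th(1) TC by auto
        then have "t \<otimes> (inv t \<otimes> s) = s" by (simp flip: m_assoc)
        with C show ?thesis by (simp add: m_assoc)
      qed
      moreover have "inv t \<otimes> s \<otimes> t \<in> T"
        using s th(1) T by (simp add: subgroup.m_closed subgroup.m_inv_closed)
      ultimately show "s \<in> (\<lambda>s. t \<otimes> s \<otimes> inv t) ` T" by blast
    qed (use th(1) T in \<open>auto simp: subgroup.m_closed subgroup.m_inv_closed\<close>)
    then show "t \<in> normalizer G T" using th(1) TC by (auto simp: normalizer_iff)
  qed (use th H in auto)
  then have "normalizer G T = T <#> H"
    using cover by (auto simp: set_mult_def)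
  moreover have "T \<inter> H = {\<one>}"
    using triv subgroup.one_closed[OF T] subgroup.one_closed[OF H(1)] by blast
  ultimately show ?thesis using H by (auto simp: has_complement_def)
qed

lemma conjugation_iso:
  fixes G (structure)
  assumes G: "group G" and c: "c \<in> carrier G"
  shows "(\<lambda>x. c \<otimes>\<^bsub>G\<^esub> x \<otimes>\<^bsub>G\<^esub> inv\<^bsub>G\<^esub> c) \<in> iso G G"
proof -
  interpret group G by (rule G)
  let ?h = "\<lambda>x. c \<otimes> x \<otimes> inv c"
  have cancel: "inv c \<otimes> (c \<otimes> y) = y" "c \<otimes> (inv c \<otimes> y) = y" if "y \<in> carrier G" for y
    using c that by (simp_all add: m_assoc[symmetric])
  have "?h \<in> hom G G" by (rule homI) (use c in \<open>auto simp: m_assoc cancel\<close>)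
  moreover have "bij_betw ?h (carrier G) (carrier G)"
    by (rule bij_betw_byWitness[where f' = "\<lambda>x. inv c \<otimes> x \<otimes> c"])
      (use c in \<open>auto simp: m_assoc cancel\<close>)
  ultimately show ?thesis by (simp add: iso_def)
qed

section \<open>The projection from \<open>Sp\<close> to \<open>PSp\<close>\<close>

definition proj :: "nat \<Rightarrow> 'k::field mat \<Rightarrow> 'k mat set" where
  "proj n A = group_center (Sp n) #>\<^bsub>Sp n\<^esub> A"

definition diag_torus :: "nat \<Rightarrow> 'k::field mat set set" where
  "diag_torus n = proj n ` diag_Sp n"

lemma center_normal:
  assumes "n \<ge> 1"
  shows "group_center (Sp n :: 'k::alg_closed_field mat monoid) \<lhd> Sp n"
proof -
  interpret S: group "Sp n :: 'k mat monoid" by (rule group_Sp)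
  have one: "1\<^sub>m (2 * n) \<in> carrier (Sp n :: 'k mat monoid)" using S.one_closed by simp
  have "subgroup (group_center (Sp n :: 'k mat monoid)) (Sp n)"
  proof (rule S.subgroupI)
    fix a :: "'k mat" assume a: "a \<in> group_center (Sp n)"
    then have "a * a = 1\<^sub>m (2 * n)" unfolding group_center_Sp[OF assms] by auto
    moreover have "a \<in> carrier (Sp n)" using a by (simp add: group_center_def)
    ultimately have "inv\<^bsub>Sp n\<^esub> a = a" by (intro S.inv_equality) simp_all
    with a show "inv\<^bsub>Sp n\<^esub> a \<in> group_center (Sp n)" by simp
  qed (auto simp: group_center_Sp[OF assms] one Sp_uminus)
  then show ?thesis
  proof (rule S.normal_invI)
    fix x h :: "'k mat" assume x: "x \<in> carrier (Sp n)" and h: "h \<in> group_center (Sp n)"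
    then have hC: "h \<in> carrier (Sp n)" and comm: "h \<otimes>\<^bsub>Sp n\<^esub> x = x \<otimes>\<^bsub>Sp n\<^esub> h"
      by (simp_all add: group_center_def)
    have "x \<otimes>\<^bsub>Sp n\<^esub> h \<otimes>\<^bsub>Sp n\<^esub> inv\<^bsub>Sp n\<^esub> x = h"
      unfolding comm[symmetric] S.m_assoc[OF hC x S.inv_closed[OF x]] S.r_inv[OF x]
      by (rule S.r_one[OF hC])
    with h show "x \<otimes>\<^bsub>Sp n\<^esub> h \<otimes>\<^bsub>Sp n\<^esub> inv\<^bsub>Sp n\<^esub> x \<in> group_center (Sp n)" by simp
  qed
qed

lemma PSp_simps:
  "carrier (PSp n :: ('k::field mat set, 'k) alg_group) = proj n ` carrier (Sp n)"
  "U \<otimes>\<^bsub>PSp n\<^esub> Y = U <#>\<^bsub>Sp n\<^esub> (Y :: 'k mat set)"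
  "\<one>\<^bsub>PSp n\<^esub> = group_center (Sp n :: 'k mat monoid)"
  by (auto simp: PSp_def Let_def FactGroup_def RCOSETS_def proj_def)

context
  fixes n :: nat
  assumes n: "n \<ge> 1"
begin

lemma proj_eq:
  fixes A :: "'k::alg_closed_field mat"
  assumes "A \<in> carrier (Sp n)"
  shows "proj n A = {A, - A}"
  using Sp_carrier[OF assms] by (auto simp: proj_def r_coset_def group_center_Sp[OF n])

lemma proj_eq_iff:
  fixes A :: "'k::alg_closed_field mat"
  assumes "A \<in> carrier (Sp n)" "B \<in> carrier (Sp n)"
  shows "proj n A = proj n B \<longleftrightarrow> A = B \<or> A = - B"
  unfolding proj_eq[OF assms(1)] proj_eq[OF assms(2)] by (auto simp: doubleton_eq_iff)

lemma proj_uminus: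
  fixes A :: "'k::alg_closed_field mat"
  assumes "A \<in> carrier (Sp n)"
  shows "proj n (- A) = proj n A"
  using proj_eq_iff[OF Sp_uminus[OF assms] assms] by simp

lemma PSp_mult:
  fixes A :: "'k::alg_closed_field mat"
  assumes "A \<in> carrier (Sp n)" "B \<in> carrier (Sp n)"
  shows "proj n A \<otimes>\<^bsub>PSp n\<^esub> proj n B = proj n (A * B)"
  using normal.rcos_sum[OF center_normal[OF n] assms] by (simp add: PSp_simps proj_def)

lemma PSp_one: "\<one>\<^bsub>PSp n\<^esub> = proj n (1\<^sub>m (2 * n) :: 'k::alg_closed_field mat)"
proof -
  have "1\<^sub>m (2 * n) \<in> carrier (Sp n :: 'k mat monoid)" by (rule one_Sp)
  then show ?thesis by (simp add: PSp_simps proj_eq group_center_Sp[OF n])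
qed

lemma group_PSp: "group (PSp n :: ('k::alg_closed_field mat set, 'k) alg_group)"
proof -
  interpret Q: group "Sp n Mod group_center (Sp n :: 'k mat monoid)"
    by (rule normal.factorgroup_is_group[OF center_normal[OF n]])
  have eq: "carrier (PSp n :: ('k mat set, 'k) alg_group) = carrier (Sp n Mod group_center (Sp n))"
    "\<And>U Y :: 'k mat set. U \<otimes>\<^bsub>PSp n\<^esub> Y = U \<otimes>\<^bsub>Sp n Mod group_center (Sp n)\<^esub> Y"
    "\<one>\<^bsub>PSp n\<^esub> = \<one>\<^bsub>Sp n Mod group_center (Sp n :: 'k mat monoid)\<^esub>"
    by (simp_all add: PSp_def Let_def)
  show ?thesis
    by (rule groupI; unfold eq)
      (rule Q.m_closed Q.one_closed Q.m_assoc Q.l_one Q.l_inv_ex; assumption)+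
qed

lemma PSp_inv:
  fixes A :: "'k::alg_closed_field mat"
  assumes "A \<in> carrier (Sp n)" "B \<in> carrier (Sp n)" "B * A = 1\<^sub>m (2 * n)"
  shows "inv\<^bsub>PSp n\<^esub> proj n A = proj n B"
  by (rule group.inv_equality[OF group_PSp]) (use assms in \<open>auto simp: PSp_mult PSp_one PSp_simps(1)\<close>)

lemma proj_in_diag_torus_iff:
  fixes A :: "'k::alg_closed_field mat"
  assumes A: "A \<in> carrier (Sp n)"
  shows "proj n A \<in> diag_torus n \<longleftrightarrow> A \<in> diag_Sp n"
proof
  assume "proj n A \<in> diag_torus n"
  then obtain D where "D \<in> diag_Sp n" "proj n A = proj n D" by (auto simp: diag_torus_def)
  then show "A \<in> diag_Sp n"
    using proj_eq_iff[OF A, of D] diag_Sp_uminus[of D n] by (auto simp: diag_Sp_def)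
qed (auto simp: diag_torus_def)

lemma diag_torus_subgroup:
  "subgroup (diag_torus n) (PSp n :: ('k::alg_closed_field mat set, 'k) alg_group)"
proof -
  interpret group "PSp n :: ('k mat set, 'k) alg_group" by (rule group_PSp)
  have one: "1\<^sub>m (2 * n) \<in> diag_Sp n"
    using wperm_id_Sp_iff[of n "\<lambda>i. 1"] wperm_id_diag_Sp[of n "\<lambda>i. 1"] by (simp add: wperm_one)
  show ?thesis
  proof (rule subgroupI)
    show "diag_torus n \<subseteq> carrier (PSp n :: ('k mat set, 'k) alg_group)"
      by (auto simp: diag_torus_def PSp_simps diag_Sp_def)
    show "diag_torus n \<noteq> {}" using one by (auto simp: diag_torus_def)
    fix U :: "'k mat set" assume "U \<in> diag_torus n"
    then obtain A where A: "A \<in> diag_Sp n" "U = proj n A" by (auto simp: diag_torus_def)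
    let ?B = "wperm n id (\<lambda>i. A $$ (bar n i, bar n i))"
    have B: "?B \<in> diag_Sp n"
      using diag_Sp_entries[OF A(1)] by (intro wperm_id_diag_Sp) (simp add: wperm_id_Sp_iff mult.commute)
    have "?B * A = 1\<^sub>m (2 * n)"
      unfolding wperm_one
      by (subst diag_Sp_wperm[OF A(1)], subst wperm_mult)
        (use diag_Sp_entries[OF A(1)] in \<open>auto intro!: wperm_cong simp: mult.commute\<close>)
    then have "inv\<^bsub>PSp n\<^esub> U = proj n ?B"
      using A B by (simp add: PSp_inv diag_Sp_def)
    then show "inv\<^bsub>PSp n\<^esub> U \<in> diag_torus n" using B by (auto simp: diag_torus_def)
    fix Y :: "'k mat set" assume "Y \<in> diag_torus n"
    then obtain C where C: "C \<in> diag_Sp n" "Y = proj n C" by (auto simp: diag_torus_def)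
    have "U \<otimes>\<^bsub>PSp n\<^esub> Y = proj n (A * C)"
      using A C by (auto simp: PSp_mult diag_Sp_def)
    then show "U \<otimes>\<^bsub>PSp n\<^esub> Y \<in> diag_torus n"
      using diag_Sp_mult[OF A(1) C(1)] by (auto simp: diag_torus_def)
  qed
qed

lemma wperm_conjugates_diagonal:
  fixes a :: "nat \<Rightarrow> 'k::alg_closed_field"
  assumes f: "f \<in> weyl n" and A: "wperm n f a \<in> carrier (Sp n)" and B: "B \<in> carrier (Sp n)"
    "wperm n f a * B = 1\<^sub>m (2 * n)" "B * wperm n f a = 1\<^sub>m (2 * n)"
    and d: "wperm n id d \<in> carrier (Sp n)"
  shows "wperm n f a * wperm n id d * B = wperm n id (\<lambda>i. d (f i))"
proof -
  have "wperm n f a * wperm n id d = wperm n id (\<lambda>i. d (f i)) * wperm n f a"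
    using f by (simp add: wperm_mult mult.commute)
  then have "wperm n f a * wperm n id d * B = wperm n id (\<lambda>i. d (f i)) * wperm n f a * B" by simp
  also have "\<dots> = wperm n id (\<lambda>i. d (f i)) * (wperm n f a * B)"
    by (rule assoc_mult_mat) (use Sp_carrier[OF B(1)] in auto)
  finally show ?thesis by (simp add: B)
qed

text \<open>
  The image of \<open>D\<close> in \<open>PSp\<close> has preimage \<open>D\<close>, so its normaliser is computed in \<open>Sp\<close>.
\<close>

lemma normalizer_diag_torus_iff:
  fixes A :: "'k::alg_closed_field mat"
  assumes A: "A \<in> carrier (Sp n)"
  shows "proj n A \<in> normalizer (PSp n) (diag_torus n) \<longleftrightarrow> (\<exists>f\<in>weyl n. \<exists>a. A = wperm n f a)"
proof -
  interpret group "PSp n :: ('k mat set, 'k) alg_group" by (rule group_PSp)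
  have sub: "diag_torus n \<subseteq> carrier (PSp n :: ('k mat set, 'k) alg_group)"
    using diag_torus_subgroup by (rule subgroup.subset)
  obtain B where B: "B \<in> carrier (Sp n)" "A * B = 1\<^sub>m (2 * n)" "B * A = 1\<^sub>m (2 * n)"
    using Sp_inverse[OF A] .
  have AC: "proj n A \<in> carrier (PSp n)" using A by (auto simp: PSp_simps)
  have conj: "proj n A \<otimes>\<^bsub>PSp n\<^esub> proj n D \<otimes>\<^bsub>PSp n\<^esub> inv\<^bsub>PSp n\<^esub> proj n A = proj n (A * D * B)"
    if "D \<in> carrier (Sp n)" for D
    using A B that by (simp add: PSp_inv PSp_mult Sp_mult)
  show ?thesis
  proof
    assume "proj n A \<in> normalizer (PSp n) (diag_torus n)"
    then have img: "(\<lambda>t. proj n A \<otimes>\<^bsub>PSp n\<^esub> t \<otimes>\<^bsub>PSp n\<^esub> inv\<^bsub>PSp n\<^esub> proj n A) ` diag_torus n = diag_torus n"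
      using normalizer_iff[OF sub] by blast
    obtain t :: "nat \<Rightarrow> 'k" where t: "wperm n id t \<in> carrier (Sp n)" "inj_on t {..<2 * n}"
      using exists_generic_diagonal[OF infinite_alg_closed] by blast
    let ?D = "wperm n id t"
    have "proj n (A * ?D * B) \<in> diag_torus n"
      unfolding conj[OF t(1), symmetric]
      by (subst img[symmetric], rule imageI) (simp add: diag_torus_def wperm_id_diag_Sp[OF t(1)])
    then have "A * ?D * B \<in> diag_Sp n"
      using A B t by (simp add: proj_in_diag_torus_iff Sp_mult)
    then obtain d where d: "A * ?D * B = wperm n id d" using diag_Sp_wperm by blast
    have "A * ?D = A * ?D * (B * A)"
      using Sp_carrier[OF A] by (simp add: B)
    also have "\<dots> = A * ?D * B * A"
      by (rule assoc_mult_mat[symmetric, of _ "2 * n" "2 * n" _ "2 * n" _ "2 * n"])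
        (use Sp_carrier[OF A] Sp_carrier[OF B(1)] in auto)
    finally have "A * ?D = wperm n id d * A" unfolding d .
    then show "\<exists>f\<in>weyl n. \<exists>a. A = wperm n f a"
      by (rule monomial_if_intertwines[OF A t(2)])
  next
    assume "\<exists>f\<in>weyl n. \<exists>a. A = wperm n f a"
    then obtain f a where f: "f \<in> weyl n" and Af: "A = wperm n f a" by blast
    have conjd: "A * wperm n id d * B = wperm n id (\<lambda>i. d (f i))"
      if "wperm n id d \<in> carrier (Sp n)" for d :: "nat \<Rightarrow> 'k"
      using wperm_conjugates_diagonal[OF f _ B(1) _ _ that, of a] A B unfolding Af by blast
    have "(\<lambda>t. proj n A \<otimes>\<^bsub>PSp n\<^esub> t \<otimes>\<^bsub>PSp n\<^esub> inv\<^bsub>PSp n\<^esub> proj n A) ` diag_torus n = diag_torus n"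
    proof (intro equalityI subsetI)
      fix U assume "U \<in> (\<lambda>t. proj n A \<otimes>\<^bsub>PSp n\<^esub> t \<otimes>\<^bsub>PSp n\<^esub> inv\<^bsub>PSp n\<^esub> proj n A) ` diag_torus n"
      then obtain D where D: "D \<in> diag_Sp n" "U = proj n (A * D * B)"
        using conj by (auto simp: diag_torus_def diag_Sp_def)
      obtain d where d: "D = wperm n id d" using diag_Sp_wperm[OF D(1)] by blast
      have dS: "wperm n id d \<in> carrier (Sp n)" using D d by (simp add: diag_Sp_def)
      have "A * D * B \<in> carrier (Sp n)" using A B D by (simp add: Sp_mult diag_Sp_def)
      then have "A * D * B \<in> diag_Sp n"
        using conjd[OF dS] wperm_id_diag_Sp unfolding d by metis
      then show "U \<in> diag_torus n" using D by (auto simp: diag_torus_def)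
    next
      fix U :: "'k mat set" assume "U \<in> diag_torus n"
      then obtain D where D: "D \<in> diag_Sp n" "U = proj n D" by (auto simp: diag_torus_def)
      obtain d where d: "D = wperm n id d" using diag_Sp_wperm[OF D(1)] by blast
      have dS: "wperm n id d \<in> carrier (Sp n)" using D d by (simp add: diag_Sp_def)
      let ?g = "inv_into UNIV f"
      have g: "?g \<in> weyl n" using f by (rule weyl_inv)
      have gf: "?g (f i) = i" "f (?g i) = i" for i
        using f by (auto simp: weyl_def permutes_inverses)
      let ?E = "wperm n id (\<lambda>i. d (?g i))"
      have E: "?E \<in> carrier (Sp n)"
        using dS g unfolding wperm_id_Sp_iff by (simp add: weyl_bar)
      have "A * ?E * B = D" unfolding conjd[OF E] d by (simp add: gf)
      then have "U = proj n A \<otimes>\<^bsub>PSp n\<^esub> proj n ?E \<otimes>\<^bsub>PSp n\<^esub> inv\<^bsub>PSp n\<^esub> proj n A"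
        using conj[OF E] D by simp
      moreover have "proj n ?E \<in> diag_torus n"
        using wperm_id_diag_Sp[OF E] by (simp add: diag_torus_def)
      ultimately show "U \<in> (\<lambda>t. proj n A \<otimes>\<^bsub>PSp n\<^esub> t \<otimes>\<^bsub>PSp n\<^esub> inv\<^bsub>PSp n\<^esub> proj n A) ` diag_torus n"
        by blast
    qed
    then show "proj n A \<in> normalizer (PSp n) (diag_torus n)"
      using normalizer_iff[OF sub] AC by blast
  qed
qed

end

section \<open>Complements of the diagonal torus\<close>

text \<open>
  A complement can be described by a set \<open>M\<close> of symplectic matrices that is closed under products only
  up to sign; inverses come for free, since a product with a lift of the inverse permutation is
  diagonal.
\<close>

lemma diag_torus_complementI:
  fixes M :: "'k::alg_closed_field mat set"
  assumes n: "n \<ge> 1"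
    and Sp: "M \<subseteq> carrier (Sp n)"
    and monomial: "\<And>A. A \<in> M \<Longrightarrow> \<exists>f\<in>weyl n. \<exists>a. A = wperm n f a"
    and cover: "\<And>f. f \<in> weyl n \<Longrightarrow> \<exists>a. wperm n f a \<in> M"
    and mult: "\<And>A B. A \<in> M \<Longrightarrow> B \<in> M \<Longrightarrow> A * B \<in> M \<or> - (A * B) \<in> M"
    and triv: "\<And>A. A \<in> M \<Longrightarrow> A \<in> diag_Sp n \<Longrightarrow> A = 1\<^sub>m (2 * n) \<or> A = - 1\<^sub>m (2 * n)"
  shows "has_complement (PSp n) (diag_torus n :: 'k mat set set) (normalizer (PSp n) (diag_torus n))"
proof -
  let ?G = "PSp n :: ('k mat set, 'k) alg_group"
  interpret group ?G by (rule group_PSp[OF n])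
  have MC: "A \<in> carrier (Sp n)" if "A \<in> M" for A using that Sp by auto
  have pm: "proj n A \<in> proj n ` M" if "A \<in> M \<or> - A \<in> M" "A \<in> carrier (Sp n)" for A
    using that proj_uminus[OF n that(2)] by (metis imageI)
  have one: "proj n A = \<one>\<^bsub>?G\<^esub>" if "A \<in> M" "A \<in> diag_Sp n" for A
  proof -
    have A: "A = 1\<^sub>m (2 * n) \<or> A = - 1\<^sub>m (2 * n)" by (rule triv[OF that])
    have "1\<^sub>m (2 * n) \<in> carrier (Sp n :: 'k mat monoid)" by (rule one_Sp)
    with A show ?thesis by (auto simp: PSp_one[OF n] proj_uminus[OF n])
  qed
  have sub: "subgroup (proj n ` M) ?G"
  proof (rule subgroupI)
    show "proj n ` M \<subseteq> carrier ?G" using Sp by (auto simp: PSp_simps(1))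
    show "proj n ` M \<noteq> {}" using cover[of id] by auto
    fix u assume "u \<in> proj n ` M"
    then obtain A where A: "A \<in> M" "u = proj n A" by auto
    obtain f a where f: "f \<in> weyl n" and Af: "A = wperm n f a" using monomial[OF A(1)] by blast
    obtain b where b: "wperm n (inv_into UNIV f) b \<in> M" (is "?B \<in> M")
      using cover[OF weyl_inv[OF f]] by blast
    have "A * ?B = wperm n id (\<lambda>i. a i * b (f i))"
      unfolding Af wperm_mult[OF f weyl_inv[OF f]]
      using f by (intro wperm_cong) (auto simp: weyl_def permutes_inverses)
    then have D: "A * ?B \<in> diag_Sp n"
      using wperm_id_diag_Sp Sp_mult[OF MC[OF A(1)] MC[OF b]] by metis
    have "proj n (A * ?B) = \<one>\<^bsub>?G\<^esub>"
      using mult[OF A(1) b]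
    proof
      assume "- (A * ?B) \<in> M"
      from one[OF this diag_Sp_uminus[OF D]] show ?thesis
        using proj_uminus[OF n, of "A * ?B"] D by (simp add: diag_Sp_def)
    qed (use one D in blast)
    then have eq: "u \<otimes>\<^bsub>?G\<^esub> proj n ?B = \<one>\<^bsub>?G\<^esub>"
      using A MC[OF A(1)] MC[OF b] by (simp add: PSp_mult[OF n])
    have BC: "proj n ?B \<in> carrier ?G" "u \<in> carrier ?G"
      using MC[OF A(1)] MC[OF b] A by (auto simp: PSp_simps(1))
    have "inv\<^bsub>?G\<^esub> u = proj n ?B"
      using inv_equality[OF eq BC(1,2)] BC by (metis inv_inv)
    with b show "inv\<^bsub>?G\<^esub> u \<in> proj n ` M" by simp
    fix v assume "v \<in> proj n ` M"
    then obtain C where C: "C \<in> M" "v = proj n C" by auto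
    have "u \<otimes>\<^bsub>?G\<^esub> v = proj n (A * C)"
      using A C MC by (simp add: PSp_mult[OF n])
    then show "u \<otimes>\<^bsub>?G\<^esub> v \<in> proj n ` M"
      using pm[OF mult[OF A(1) C(1)] Sp_mult[OF MC[OF A(1)] MC[OF C(1)]]] by simp
  qed
  show ?thesis
  proof (rule has_complementI[OF group_PSp[OF n] diag_torus_subgroup[OF n] sub])
    show "proj n ` M \<subseteq> normalizer ?G (diag_torus n)"
      using normalizer_diag_torus_iff[OF n] MC monomial by blast
    show "x = \<one>\<^bsub>?G\<^esub>" if "x \<in> diag_torus n" "x \<in> proj n ` M" for x
      using that one MC proj_in_diag_torus_iff[OF n] by blast
    fix x assume x: "x \<in> normalizer ?G (diag_torus n)"
    then have "x \<in> carrier ?G"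
      using normalizer_iff[OF subgroup.subset[OF diag_torus_subgroup[OF n]]] by blast
    then obtain A where A: "A \<in> carrier (Sp n)" "x = proj n A" by (auto simp: PSp_simps(1))
    obtain f a where f: "f \<in> weyl n" and Af: "A = wperm n f a"
      using x A normalizer_diag_torus_iff[OF n A(1)] by blast
    obtain b where b: "wperm n f b \<in> M" using cover[OF f] by blast
    have nz: "b i \<noteq> 0" if "i < 2 * n" for i using wperm_Sp_nonzero[OF f MC[OF b] that] .
    let ?t = "wperm n id (\<lambda>i. a i / b i)"
    have "a i / b i * (a (bar n i) / b (bar n i)) = 1" if i: "i < 2 * n" for i
    proof -
      have "eps n i * a i * a (bar n i) = eps n i * b i * b (bar n i)"
        using A(1) MC[OF b] i unfolding Af wperm_Sp_iff[OF f] by simp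
      then have "eps n i * (eps n i * a i * a (bar n i)) = eps n i * (eps n i * b i * b (bar n i))"
        by (rule arg_cong)
      then show ?thesis using nz[OF i] nz[of "bar n i"] i by (simp add: mult.assoc)
    qed
    then have t: "?t \<in> carrier (Sp n)" by (simp add: wperm_id_Sp_iff)
    have "?t * wperm n f b = A"
      unfolding Af by (subst wperm_mult) (use f nz in \<open>auto intro!: wperm_cong\<close>)
    then have "x = proj n ?t \<otimes>\<^bsub>?G\<^esub> proj n (wperm n f b)"
      using A t MC[OF b] by (simp add: PSp_mult[OF n])
    moreover have "proj n ?t \<in> diag_torus n"
      using wperm_id_diag_Sp[OF t] by (simp add: diag_torus_def)
    ultimately show "\<exists>t\<in>diag_torus n. \<exists>h\<in>proj n ` M. x = t \<otimes>\<^bsub>?G\<^esub> h"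
      using b by blast
  qed
qed

lemma diag_torus_complement_char_two:
  assumes n: "n \<ge> 1" and two: "(2 :: 'k::alg_closed_field) = 0"
  shows "has_complement (PSp n) (diag_torus n :: 'k mat set set) (normalizer (PSp n) (diag_torus n))"
proof (rule diag_torus_complementI[OF n])
  let ?M = "(\<lambda>f. wperm n f (\<lambda>i. 1) :: 'k mat) ` weyl n"
  have "1 + 1 = (0 :: 'k)" using two by simp
  then have "- 1 = (1 :: 'k)" using minus_unique by blast
  then have "eps n i = (1 :: 'k)" for i by (simp add: eps_def)
  then show sp: "?M \<subseteq> carrier (Sp n)" by (auto simp: wperm_Sp_iff)
  show "\<And>A. A \<in> ?M \<Longrightarrow> \<exists>f\<in>weyl n. \<exists>a. A = wperm n f a" by blast
  show "\<And>f. f \<in> weyl n \<Longrightarrow> \<exists>a. wperm n f a \<in> ?M" by blast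
  show "A * B \<in> ?M \<or> - (A * B) \<in> ?M" if AB: "A \<in> ?M" "B \<in> ?M" for A B :: "'k mat"
  proof -
    obtain f g where "f \<in> weyl n" "g \<in> weyl n"
      and "A = wperm n f (\<lambda>i. 1)" "B = wperm n g (\<lambda>i. 1)" using AB by auto
    then have "A * B = wperm n (g \<circ> f) (\<lambda>i. 1)" "g \<circ> f \<in> weyl n"
      by (simp_all add: wperm_mult weyl_comp)
    then show ?thesis by blast
  qed
  show "A = 1\<^sub>m (2 * n) \<or> A = - 1\<^sub>m (2 * n)" if A: "A \<in> ?M" "A \<in> diag_Sp n" for A :: "'k mat"
  proof -
    obtain f where f: "f \<in> weyl n" "A = wperm n f (\<lambda>i. 1)" using A by auto
    have "\<forall>i<2 * n. f i = i"
      using wperm_diag_iff[OF f(1), of "\<lambda>i. 1 :: 'k"] A sp unfolding f(2) by blast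
    then have "A = 1\<^sub>m (2 * n)" unfolding f(2) wperm_one by (intro wperm_cong) auto
    then show ?thesis by blast
  qed
qed

text \<open>
  The sign change at coordinate \<open>i\<close>, and the weights of a symplectic lift: the entry \<open>-1\<close> makes up for
  the opposite signs of the two halves of the form.
\<close>

definition flip :: "nat \<Rightarrow> nat \<Rightarrow> nat \<Rightarrow> nat" where
  "flip n i k = (if k = i \<or> k = bar n i then bar n k else k)"

lemma flip_weyl: "i < n \<Longrightarrow> flip n i \<in> weyl n"
  by (rule weyl_involI) (auto simp: flip_def bar_eq_iff)

definition flip_coeff :: "nat \<Rightarrow> nat \<Rightarrow> 'k::comm_ring_1" where
  "flip_coeff i k = (if k = i then - 1 else 1)"

lemma flip_Sp:
  assumes "i < n"
  shows "wperm n (flip n i) (flip_coeff i) \<in> carrier (Sp n :: 'k::field mat monoid)"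
  unfolding wperm_Sp_iff[OF flip_weyl[OF assms]]
  using assms by (auto simp: flip_def flip_coeff_def eps_def bar_def)

lemma diag_torus_complement_rank_one:
  "has_complement (PSp 1) (diag_torus 1 :: 'k::alg_closed_field mat set set)
    (normalizer (PSp 1) (diag_torus 1))"
proof (rule diag_torus_complementI)
  let ?w = "wperm 1 (flip 1 0) (flip_coeff 0) :: 'k mat"
  let ?M = "{1\<^sub>m (2 * 1), ?w}"
  have w: "?w \<in> carrier (Sp 1)" by (rule flip_Sp) simp
  have fw: "flip 1 0 \<in> weyl 1" by (rule flip_weyl) simp
  have one: "1\<^sub>m (2 * 1) \<in> carrier (Sp 1 :: 'k mat monoid)" by (rule one_Sp)
  show "?M \<subseteq> carrier (Sp 1)" using w one by blast
  show "\<exists>f\<in>weyl 1. \<exists>a. A = wperm 1 f a" if "A \<in> ?M" for A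
    using that fw weyl_id[of 1] unfolding wperm_one by blast
  show "\<exists>a. wperm 1 f a \<in> ?M" if f: "f \<in> weyl 1" for f
  proof -
    have less: "f 0 < 2" "f 1 < 2" using weyl_less[OF f, of 0] weyl_less[OF f, of 1] by auto
    have ne: "f 1 \<noteq> f 0" using weyl_inj[OF f, of 1 0] by simp
    consider "f 0 = 0" "f 1 = 1" | "f 0 = 1" "f 1 = 0" using less ne by linarith
    then show ?thesis
    proof cases
      case 1
      have "f i = id i" if "i < 2 * 1" for i
        using that 1 by (cases "i = 0") (auto dest: less_2_cases)
      then have "wperm 1 f (\<lambda>i. 1 :: 'k) = 1\<^sub>m (2 * 1)"
        unfolding wperm_one by (rule wperm_cong) simp_all
      then show ?thesis by blast
    next
      case 2
      have "f i = flip 1 0 i" if "i < 2 * 1" for i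
      proof -
        have "i = 0 \<or> i = 1" using that by linarith
        then show ?thesis using 2 by (elim disjE) (simp_all add: flip_def bar_def)
      qed
      then have "wperm 1 f (flip_coeff 0) = ?w" by (rule wperm_cong) simp_all
      then show ?thesis by blast
    qed
  qed
  have "?w * ?w = - 1\<^sub>m (2 * 1)"
    unfolding wperm_mult[OF fw fw] wperm_one wperm_uminus
    by (rule wperm_cong) (auto simp: flip_def flip_coeff_def bar_def)
  then show "A * B \<in> ?M \<or> - (A * B) \<in> ?M" if "A \<in> ?M" "B \<in> ?M" for A B
    using that by (auto simp: uminus_uminus_mat)
  show "A = 1\<^sub>m (2 * 1) \<or> A = - 1\<^sub>m (2 * 1)" if "A \<in> ?M" "A \<in> diag_Sp 1" for A
  proof -
    have "?w \<notin> diag_Sp 1"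
      unfolding wperm_diag_iff[OF fw w] by (auto simp: flip_def bar_def)
    then show ?thesis using that by blast
  qed
qed simp

text \<open>
  For \<open>n = 2\<close> the coordinates form \<open>\<int>/4\<close> and \<open>bar\<close> is \<open>i \<mapsto> i + 2\<close>, so that the Weyl group consists
  of the maps \<open>i \<mapsto> s + u i\<close> with \<open>u = \<plusminus>1\<close>. Put \<open>e\<^sub>i\<^sub>+\<^sub>4 = - e\<^sub>i\<close>, which extends the index set to \<open>\<int>/8\<close>; the
  map \<open>i \<mapsto> s + u i\<close> of \<open>\<int>/8\<close> with \<open>u\<close> equal to 1 or 3 then is a signed permutation. As \<open>3\<^sup>2 = 1\<close> in
  \<open>\<int>/8\<close>, these maps form a group, and modulo \<open>-1\<close>, which is \<open>s = 4\<close>, it is the Weyl group. For \<open>u = 3\<close> they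
  change the sign of the form, which the scalar \<open>\<iota>\<close> with \<open>\<iota>\<^sup>2 = -1\<close> corrects.
\<close>

definition dihedral_perm :: "nat \<Rightarrow> nat \<Rightarrow> nat \<Rightarrow> nat" where
  "dihedral_perm s u i = (if i < 4 then (s + u * i) mod 4 else i)"

definition octant_sign :: "nat \<Rightarrow> 'k::comm_ring_1" where
  "octant_sign k = (if k mod 8 < 4 then 1 else - 1)"

definition dihedral_lift :: "'k \<Rightarrow> nat \<Rightarrow> nat \<Rightarrow> 'k::comm_ring_1 mat" where
  "dihedral_lift \<iota> s u =
    wperm 2 (dihedral_perm s u) (\<lambda>i. (if u = 3 then \<iota> else 1) * octant_sign (s + u * i))"

lemma octant_sign_cong: "k mod 8 = l mod 8 \<Longrightarrow> octant_sign k = octant_sign l"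
  by (simp add: octant_sign_def)

lemma octant_sign_add_4: "octant_sign (k + 4) = - octant_sign k"
proof -
  have "(k + 4) mod 8 < 4 \<longleftrightarrow> \<not> k mod 8 < 4" by presburger
  then show ?thesis by (simp add: octant_sign_def)
qed

lemma add_4_mult_mod_8:
  assumes "u = 1 \<or> u = 3"
  shows "(x + 4 * u) mod 8 = (x + 4) mod (8 :: nat)"
  using assms
proof
  assume "u = 3"
  then have "x + 4 * u = (x + 4) + 8" by simp
  then show ?thesis by (simp only: mod_add_self2)
qed simp

lemma add_2_mult_mod_4:
  assumes "u = 1 \<or> u = 3"
  shows "(x + 2 * u) mod 4 = (x + 2) mod (4 :: nat)"
  using assms
proof
  assume "u = 3"
  then have "x + 2 * u = (x + 2) + 4" by simp
  then show ?thesis by (simp only: mod_add_self2)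
qed simp

lemma octant_sign_affine:
  assumes "u = 1 \<or> u = 3"
  shows "octant_sign (s + u * m) = octant_sign m * octant_sign (s + u * (m mod 4))"
proof (cases "m mod 8 < 4")
  case True
  then have "m mod 8 = m mod 4" using mod_mod_cancel[of 4 8 m] by simp
  then have "(s + u * m) mod 8 = (s + u * (m mod 4)) mod 8" by (metis mod_add_right_eq mod_mult_right_eq)
  then show ?thesis using True octant_sign_cong by (metis octant_sign_def mult_1)
next
  case False
  moreover have "m mod 8 < 8" by simp
  ultimately have "m mod 8 mod 4 = m mod 8 - 4" by (simp add: le_mod_geq)
  then have m: "m mod 8 = m mod 4 + 4" using False mod_mod_cancel[of 4 8 m] by simp
  have "(s + u * m) mod 8 = (s + u * (m mod 8)) mod 8"
    by (metis mod_add_right_eq mod_mult_right_eq)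
  also have "\<dots> = (s + u * (m mod 4) + 4 * u) mod 8"
    unfolding m by (simp add: algebra_simps)
  also have "\<dots> = (s + u * (m mod 4) + 4) mod 8" by (rule add_4_mult_mod_8[OF assms])
  finally have "octant_sign (s + u * m) = - octant_sign (s + u * (m mod 4))"
    unfolding octant_sign_add_4[symmetric] by (rule octant_sign_cong)
  then show ?thesis using False by (simp add: octant_sign_def[of m])
qed

lemma dihedral_perm_weyl:
  assumes "u = 1 \<or> u = 3"
  shows "dihedral_perm s u \<in> weyl 2"
proof -
  have "inj_on (dihedral_perm s u) {..<4}"
  proof (rule inj_onI)
    fix x y assume xy: "x \<in> {..<4}" "y \<in> {..<4}" "dihedral_perm s u x = dihedral_perm s u y"
    then have "[s + u * x = s + u * y] (mod 4)" by (simp add: dihedral_perm_def cong_def)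
    then have "[u * x = u * y] (mod 4)" by (simp add: cong_add_lcancel_nat)
    moreover have "coprime u 4" using assms coprime_diff_one_left_nat[of 4] by auto
    ultimately have "[x = y] (mod 4)" using cong_mult_lcancel_nat by blast
    then show "x = y" using xy by (simp add: cong_def)
  qed
  moreover from this have "dihedral_perm s u ` {..<4} = {..<4}"
    by (intro endo_inj_surj) (auto simp: dihedral_perm_def)
  ultimately have "dihedral_perm s u permutes {..<4}"
    by (intro bij_imp_permutes) (simp_all add: bij_betw_def dihedral_perm_def)
  moreover have "dihedral_perm s u (bar 2 i) = bar 2 (dihedral_perm s u i)" if "i < 4" for i
  proof -
    have "bar 2 k = (k + 2) mod 4" if "k < 4" for k using that by (simp add: bar_def) presburger
    then have "dihedral_perm s u (bar 2 i) = (s + u * ((i + 2) mod 4)) mod 4"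
      "bar 2 (dihedral_perm s u i) = ((s + u * i) mod 4 + 2) mod 4"
      using that by (simp_all add: dihedral_perm_def)
    moreover have "(s + u * ((i + 2) mod 4)) mod 4 = ((s + u * i) mod 4 + 2) mod 4"
    proof -
      have "(s + u * ((i + 2) mod 4)) mod 4 = (s + u * (i + 2)) mod 4"
        by (metis mod_add_right_eq mod_mult_right_eq)
      also have "\<dots> = (s + u * i + 2) mod 4"
        using assms
      proof
        assume "u = 3"
        then have "s + u * (i + 2) = (s + u * i + 2) + 4" by simp
        then show ?thesis by (simp only: mod_add_self2)
      qed simp
      also have "\<dots> = ((s + u * i) mod 4 + 2) mod 4" by (rule mod_add_left_eq[symmetric])
      finally show ?thesis .
    qed
    ultimately show ?thesis by simp
  qed
  ultimately show ?thesis by (simp add: weyl_def)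
qed

lemma dihedral_lift_Sp:
  assumes i: "\<iota> * \<iota> = (- 1 :: 'k::field)" and u: "u = 1 \<or> u = 3"
  shows "dihedral_lift \<iota> s u \<in> carrier (Sp 2)"
  unfolding dihedral_lift_def wperm_Sp_iff[OF dihedral_perm_weyl[OF u]]
proof (intro allI impI)
  fix k :: nat assume k: "k < 2 * 2"
  define e :: 'k where "e = (if u = 3 then \<iota> else 1)"
  have ee: "e * e = (if u = 3 then - 1 else 1)" using i by (simp add: e_def)
  have eps: "eps 2 j = (octant_sign (2 * j) :: 'k)" if "j < 4" for j
    using that by (auto simp: eps_def octant_sign_def)
  have bar: "octant_sign (s + u * bar 2 k) = (if k < 2 then 1 else - 1) * (octant_sign (s + u * k + 2 * u) :: 'k)"
  proof (cases "k < 2")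
    case False
    then have "k = bar 2 k + 2" using k by (simp add: bar_def)
    then have "u * k = u * bar 2 k + 2 * u" by (metis distrib_left mult.commute)
    then have eq: "s + u * k + 2 * u = s + u * bar 2 k + 4 * u" by simp
    have "(s + u * bar 2 k + 4 * u) mod 8 = (s + u * bar 2 k + 4) mod 8"
      by (rule add_4_mult_mod_8[OF u])
    then have "octant_sign (s + u * bar 2 k + 4 * u) = (octant_sign (s + u * bar 2 k + 4) :: 'k)"
      by (rule octant_sign_cong)
    then show ?thesis using False unfolding eq by (simp only: octant_sign_add_4) simp
  next
    case True
    have "s + u * (k + 2) = s + u * k + 2 * u"
      by (simp only: distrib_left mult.commute[of u 2] add.assoc)
    moreover have "bar 2 k = k + 2" using True by (simp add: bar_def)
    ultimately show ?thesis using True by (simp only: if_True mult_1)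
  qed
  have prod: "octant_sign x * octant_sign (x + 2 * u) = (if u = 3 then - 1 else 1) * (eps 2 (x mod 4) :: 'k)" for x
  proof -
    have "x mod 8 \<in> {0, 1, 2, 3, 4, 5, 6, 7}" by (simp, presburger)
    moreover have "x mod 4 = x mod 8 mod 4" by (simp add: mod_mod_cancel)
    moreover have "(x + 2 * u) mod 8 = (x mod 8 + 2 * u) mod 8" by (rule mod_add_left_eq[symmetric])
    ultimately show ?thesis using u unfolding octant_sign_def eps_def
      by (elim insertE emptyE disjE) simp_all
  qed
  have "eps 2 k * (e * octant_sign (s + u * k)) * (e * octant_sign (s + u * bar 2 k))
      = (e * e) * (eps 2 k * (if k < 2 then 1 else - 1)) * (octant_sign (s + u * k) * octant_sign (s + u * k + 2 * u))"
    unfolding bar by (simp only: mult_ac)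
  also have "\<dots> = (e * e) * (if u = 3 then - 1 else 1) * eps 2 ((s + u * k) mod 4)"
    unfolding prod by (simp add: eps_def)
  also have "\<dots> = eps 2 (dihedral_perm s u k)"
    unfolding ee using k by (simp add: dihedral_perm_def)
  finally show "eps 2 k * ((if u = 3 then \<iota> else 1) * octant_sign (s + u * k)) *
      ((if u = 3 then \<iota> else 1) * octant_sign (s + u * bar 2 k)) = eps 2 (dihedral_perm s u k)"
    unfolding e_def .
qed

lemma diag_torus_complement_rank_two:
  "has_complement (PSp 2) (diag_torus 2 :: 'k::alg_closed_field mat set set)
    (normalizer (PSp 2) (diag_torus 2))"
proof -
  obtain \<iota> :: 'k where i: "\<iota> * \<iota> = - 1"
    using nth_root_exists[of 2 "- 1 :: 'k"] by (auto simp: power2_eq_square)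
  let ?M = "{dihedral_lift \<iota> s u | s u. u = 1 \<or> u = 3}"
  show ?thesis
  proof (rule diag_torus_complementI)
    show "?M \<subseteq> carrier (Sp 2)" using dihedral_lift_Sp[OF i] by blast
    show "\<exists>f\<in>weyl 2. \<exists>a. A = wperm 2 f a" if "A \<in> ?M" for A
      using that dihedral_perm_weyl unfolding dihedral_lift_def by blast
    show "\<exists>a. wperm 2 f a \<in> ?M" if f: "f \<in> weyl 2" for f
    proof -
      have less: "f 0 < 4" "f 1 < 4" using weyl_less[OF f, of 0] weyl_less[OF f, of 1] by auto
      have f2: "f 2 = bar 2 (f 0)" and f3: "f 3 = bar 2 (f 1)"
        using weyl_bar[OF f, of 0] weyl_bar[OF f, of 1] by (simp_all add: bar_def eval_nat_numeral)
      have "f 1 \<noteq> f 0" "f 1 \<noteq> f 2" using weyl_inj[OF f] by simp_all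
      moreover have "f 0 = 0 \<or> f 0 = 1 \<or> f 0 = 2 \<or> f 0 = 3" "f 1 = 0 \<or> f 1 = 1 \<or> f 1 = 2 \<or> f 1 = 3"
        using less by linarith+
      ultimately have "f 1 = (f 0 + 1) mod 4 \<or> f 1 = (f 0 + 3) mod 4"
        unfolding f2 bar_def by (elim disjE) simp_all
      then obtain u where u: "u = 1 \<or> u = 3" "f 1 = (f 0 + u) mod 4" by blast
      have "f k = dihedral_perm (f 0) u k" if "k < 2 * 2" for k
      proof -
        have "bar 2 l = (l + 2) mod 4" if "l < 4" for l using that by (simp add: bar_def) presburger
        then have f23: "f 2 = (f 0 + 2) mod 4" "f 3 = (f 1 + 2) mod 4" using less f2 f3 by simp_all
        have "k = 0 \<or> k = 1 \<or> k = 2 \<or> k = 3" using that by linarith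
        then consider "k = 0" | "k = 1" | "k = 2" | "k = 3" by blast
        then show ?thesis
        proof cases
          case 3
          have "(f 0 + u * 2) mod 4 = (f 0 + 2) mod 4"
            using add_2_mult_mod_4[OF u(1), of "f 0"] by (simp only: mult.commute)
          then show ?thesis using 3 f23 by (simp add: dihedral_perm_def)
        next
          case 4
          have "f 0 + u * 3 = f 0 + u + 2 * u" by simp
          then have "(f 0 + u * 3) mod 4 = ((f 0 + u) mod 4 + 2) mod 4"
            by (simp only: add_2_mult_mod_4[OF u(1)] mod_add_left_eq)
          then show ?thesis using 4 f23 u(2) by (simp add: dihedral_perm_def)
        qed (use less u(2) in \<open>simp_all add: dihedral_perm_def\<close>)
      qed
      then have "wperm 2 f a = wperm 2 (dihedral_perm (f 0) u) a" for a :: "nat \<Rightarrow> 'k"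
        by (rule wperm_cong) simp_all
      then show ?thesis using u(1) unfolding dihedral_lift_def by blast
    qed
    show "A * B \<in> ?M \<or> - (A * B) \<in> ?M" if AB: "A \<in> ?M" "B \<in> ?M" for A B
    proof -
      obtain s u where A: "A = dihedral_lift \<iota> s u" and u: "u = 1 \<or> u = 3" using AB by blast
      obtain s' u' where B: "B = dihedral_lift \<iota> s' u'" and u': "u' = 1 \<or> u' = 3" using AB by blast
      define v where "v = (u * u') mod 8"
      define t where "t = s' + u' * s"
      define e :: 'k where "e = (if u = 3 \<and> u' = 3 then - 1 else 1)"
      have v: "v = 1 \<or> v = 3" using u u' by (auto simp: v_def)
      have scal: "(if u = 3 then \<iota> else 1) * (if u' = 3 then \<iota> else 1) = e * (if v = 3 then \<iota> else 1)"
        using u u' i by (auto simp: v_def e_def)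
      have perm: "(dihedral_perm s' u' \<circ> dihedral_perm s u) k = dihedral_perm t v k" if "k < 2 * 2" for k
      proof -
        have "v mod 4 = (u * u') mod 4" using u u' by (auto simp: v_def)
        then have "(t + v * k) mod 4 = (t + (u * u') * k) mod 4" by (metis mod_add_right_eq mod_mult_left_eq)
        moreover have "(s' + u' * ((s + u * k) mod 4)) mod 4 = (s' + u' * (s + u * k)) mod 4"
          by (metis mod_add_right_eq mod_mult_right_eq)
        moreover have "t + (u * u') * k = s' + u' * (s + u * k)"
          by (simp add: t_def algebra_simps)
        ultimately show ?thesis using that by (simp add: dihedral_perm_def)
      qed
      have sign: "octant_sign (s + u * k) * octant_sign (s' + u' * dihedral_perm s u k)
          = (octant_sign (t + v * k) :: 'k)" if "k < 2 * 2" for k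
      proof -
        have "(t + v * k) mod 8 = (s' + u' * (s + u * k)) mod 8"
        proof -
          have "t + (u * u') * k = s' + u' * (s + u * k)" by (simp add: t_def algebra_simps)
          then show ?thesis unfolding v_def by (metis mod_add_right_eq mod_mult_left_eq)
        qed
        then have "octant_sign (t + v * k) = (octant_sign (s' + u' * (s + u * k)) :: 'k)"
          by (rule octant_sign_cong)
        then show ?thesis using that octant_sign_affine[OF u', of s' "s + u * k", where 'a = 'k]
          by (simp add: dihedral_perm_def)
      qed
      have "A * B = wperm 2 (dihedral_perm t v)
          (\<lambda>k. e * ((if v = 3 then \<iota> else 1) * octant_sign (t + v * k)))"
        unfolding A B dihedral_lift_def wperm_mult[OF dihedral_perm_weyl[OF u] dihedral_perm_weyl[OF u']]
      proof (rule wperm_cong)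
        fix k :: nat assume k: "k < 2 * 2"
        show "(dihedral_perm s' u' \<circ> dihedral_perm s u) k = dihedral_perm t v k" by (rule perm[OF k])
        have "(if u = 3 then \<iota> else 1) * octant_sign (s + u * k) *
            ((if u' = 3 then \<iota> else 1) * octant_sign (s' + u' * dihedral_perm s u k))
          = ((if u = 3 then \<iota> else 1) * (if u' = 3 then \<iota> else 1)) *
            (octant_sign (s + u * k) * octant_sign (s' + u' * dihedral_perm s u k))"
          by (simp only: mult_ac)
        then show "(if u = 3 then \<iota> else 1) * octant_sign (s + u * k) *
            ((if u' = 3 then \<iota> else 1) * octant_sign (s' + u' * dihedral_perm s u k))
          = e * ((if v = 3 then \<iota> else 1) * octant_sign (t + v * k))"
          unfolding sign[OF k] scal by (simp only: mult_ac)
      qed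
      moreover have "e = 1 \<or> e = - 1" by (auto simp: e_def)
      ultimately have "A * B = dihedral_lift \<iota> t v \<or> - (A * B) = dihedral_lift \<iota> t v"
        unfolding dihedral_lift_def by (elim disjE) (simp_all add: wperm_uminus)
      then show ?thesis using v by blast
    qed
    show "A = 1\<^sub>m (2 * 2) \<or> A = - 1\<^sub>m (2 * 2)" if A: "A \<in> ?M" "A \<in> diag_Sp 2" for A
    proof -
      obtain s u where As: "A = dihedral_lift \<iota> s u" and u: "u = 1 \<or> u = 3" using A by blast
      have id: "\<forall>k<2 * 2. dihedral_perm s u k = k"
        using A(2) wperm_diag_iff[OF dihedral_perm_weyl[OF u]] dihedral_lift_Sp[OF i u]
        unfolding As dihedral_lift_def by blast
      have s: "s mod 4 = 0" using id[rule_format, of 0] by (simp add: dihedral_perm_def)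
      have "(s + u) mod 4 = 1" using id[rule_format, of 1] by (simp add: dihedral_perm_def)
      then have u1: "u = 1" using s u mod_add_left_eq[of s 4 u] by auto
      have "octant_sign (s + k) = (octant_sign s :: 'k)" if "k < 4" for k
      proof -
        have "s mod 8 = 0 \<or> s mod 8 = 4" using s by presburger
        then have "(s + k) mod 8 < 4 \<longleftrightarrow> s mod 8 < 4"
          using that mod_add_left_eq[of s 8 k] by auto
        then show ?thesis by (simp add: octant_sign_def)
      qed
      then have "A = wperm 2 id (\<lambda>k. octant_sign s)"
        unfolding As dihedral_lift_def using id u1 by (intro wperm_cong) auto
      moreover have "octant_sign s = (1 :: 'k) \<or> octant_sign s = (- 1 :: 'k)"
        by (simp add: octant_sign_def)
      ultimately show ?thesis unfolding wperm_one wperm_uminus by (elim disjE) simp_all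
    qed
  qed simp
qed

lemma diag_torus_no_complement:
  assumes n: "n \<ge> 3" and two: "(2 :: 'k::alg_closed_field) \<noteq> 0"
  shows "\<not> has_complement (PSp n) (diag_torus n :: 'k mat set set) (normalizer (PSp n) (diag_torus n))"
proof
  let ?G = "PSp n :: ('k mat set, 'k) alg_group"
  have n1: "n \<ge> 1" using n by simp
  interpret group ?G by (rule group_PSp[OF n1])
  assume "has_complement ?G (diag_torus n) (normalizer ?G (diag_torus n))"
  then obtain H where H: "subgroup H ?G"
    and N: "normalizer ?G (diag_torus n) = diag_torus n <#>\<^bsub>?G\<^esub> H"
    and triv: "diag_torus n \<inter> H = {\<one>\<^bsub>?G\<^esub>}" by (auto simp: has_complement_def)
  have one_ne: "(1 :: 'k) \<noteq> - 1"
  proof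
    assume "(1 :: 'k) = - 1"
    then have "(1 :: 'k) + 1 = 0" by (metis add.right_inverse)
    with two show False by simp
  qed
  have lift: "\<exists>a. wperm n (flip n i) a \<in> carrier (Sp n) \<and> proj n (wperm n (flip n i) a) \<in> H"
    if i: "i < n" for i
  proof -
    let ?A = "wperm n (flip n i) (flip_coeff i) :: 'k mat"
    note fw = flip_weyl[OF i]
    have A: "?A \<in> carrier (Sp n)" by (rule flip_Sp[OF i])
    have "proj n ?A \<in> diag_torus n <#>\<^bsub>?G\<^esub> H"
      using normalizer_diag_torus_iff[OF n1 A] fw N by blast
    then obtain t h where th: "t \<in> diag_torus n" "h \<in> H" "proj n ?A = t \<otimes>\<^bsub>?G\<^esub> h"
      by (auto simp: set_mult_def)
    have tC: "t \<in> carrier ?G" "h \<in> carrier ?G"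
      using th subgroup.subset[OF H] subgroup.subset[OF diag_torus_subgroup[OF n1]] by auto
    have "inv\<^bsub>?G\<^esub> t \<in> diag_torus n"
      by (rule subgroup.m_inv_closed[OF diag_torus_subgroup[OF n1] th(1)])
    then obtain D where D: "D \<in> diag_Sp n" "inv\<^bsub>?G\<^esub> t = proj n D" by (auto simp: diag_torus_def)
    have DS: "D \<in> carrier (Sp n)" using D by (simp add: diag_Sp_def)
    have "h = inv\<^bsub>?G\<^esub> t \<otimes>\<^bsub>?G\<^esub> proj n ?A"
      unfolding th(3) using tC by (simp flip: m_assoc)
    then have "h = proj n (D * ?A)" using DS A D by (simp add: PSp_mult[OF n1])
    moreover have "D * ?A = wperm n (flip n i) (\<lambda>k. D $$ (k, k) * flip_coeff i k)"
      by (subst diag_Sp_wperm[OF D(1)], subst wperm_mult) (use fw in auto)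
    ultimately show ?thesis using th(2) Sp_mult[OF DS A] by metis
  qed
  have scalar: "\<exists>s. \<forall>k<2 * n. c k = s"
    if S: "wperm n id c \<in> carrier (Sp n)" and HT: "proj n (wperm n id c) \<in> H"
      "proj n (wperm n id c) \<in> diag_torus n" for c :: "nat \<Rightarrow> 'k"
  proof -
    have "proj n (wperm n id c) = proj n (1\<^sub>m (2 * n))"
      using triv HT by (auto simp: PSp_one[OF n1])
    moreover have "1\<^sub>m (2 * n) \<in> carrier (Sp n :: 'k mat monoid)" by (rule one_Sp)
    ultimately have "wperm n id c = 1\<^sub>m (2 * n) \<or> wperm n id c = - 1\<^sub>m (2 * n)"
      using proj_eq_iff[OF n1 S] by blast
    then obtain s :: 'k where "wperm n id c = wperm n id (\<lambda>k. s)"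
      unfolding wperm_one wperm_uminus by blast
    then show ?thesis using wperm_coeff_eq[of n id c "\<lambda>k. s"] by auto
  qed
  obtain a where a: "wperm n (flip n 0) a \<in> carrier (Sp n)" "proj n (wperm n (flip n 0) a) \<in> H"
    using lift[of 0] n by auto
  obtain b where b: "wperm n (flip n 1) b \<in> carrier (Sp n)" "proj n (wperm n (flip n 1) b) \<in> H"
    using lift[of 1] n by auto
  let ?A = "wperm n (flip n 0) a" and ?B = "wperm n (flip n 1) b"
  have w0: "flip n 0 \<in> weyl n" and w1: "flip n 1 \<in> weyl n" using n by (auto intro: flip_weyl)
  have b_prod: "b 1 * b (bar n 1) = - 1" "b 0 * b (bar n 0) = 1"
    using b(1)[unfolded wperm_Sp_iff[OF w1], rule_format, of 1]
      b(1)[unfolded wperm_Sp_iff[OF w1], rule_format, of 0] n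
    by (simp_all add: eps_def flip_def bar_def)
  have flip2: "flip n 1 (flip n 1 k) = k" if "k < 2 * n" for k
    using that n by (auto simp: flip_def bar_eq_iff)
  \<comment> \<open>the square of the lift lies in \<open>T \<inter> H\<close>\<close>
  have BB: "?B * ?B = wperm n id (\<lambda>k. b k * b (flip n 1 k))"
    unfolding wperm_mult[OF w1 w1] by (rule wperm_cong) (use flip2 in auto)
  have sq: "b 0 * b 0 = - 1"
  proof -
    have BS: "?B * ?B \<in> carrier (Sp n)" by (rule Sp_mult[OF b(1) b(1)])
    have "proj n (?B * ?B) \<in> H"
      using subgroup.m_closed[OF H b(2) b(2)] b(1) by (simp add: PSp_mult[OF n1])
    moreover have "proj n (?B * ?B) \<in> diag_torus n"
      using wperm_id_diag_Sp BS unfolding BB by (auto simp: diag_torus_def)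
    ultimately obtain s where const: "\<And>k. k < 2 * n \<Longrightarrow> b k * b (flip n 1 k) = s"
      using scalar[of "\<lambda>k. b k * b (flip n 1 k)"] BS unfolding BB by blast
    have "s = - 1" using const[of 1] b_prod(1) n by (simp add: flip_def)
    then show ?thesis using const[of 0] n by (simp add: flip_def bar_def)
  qed
  define x where "x k = a k * b (flip n 0 k)" for k
  define y where "y k = b k * a (flip n 1 k)" for k
  have comm: "flip n 1 (flip n 0 k) = flip n 0 (flip n 1 k)" if "k < 2 * n" for k
    using that n by (auto simp: flip_def bar_def)
  have AB: "?A * ?B = wperm n (flip n 1 \<circ> flip n 0) x"
    unfolding wperm_mult[OF w0 w1] x_def ..
  have BA: "?B * ?A = wperm n (flip n 1 \<circ> flip n 0) y"
    unfolding wperm_mult[OF w1 w0] y_def by (rule wperm_cong) (use comm in auto)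
  have nz: "a k \<noteq> 0" "b k \<noteq> 0" if "k < 2 * n" for k
    using wperm_Sp_nonzero[OF w0 a(1) that] wperm_Sp_nonzero[OF w1 b(1) that] .
  have y_nz: "y k \<noteq> 0" if "k < 2 * n" for k
    using nz(2)[OF that] nz(1)[of "flip n 1 k"] weyl_less[OF w1, of k] that by (simp add: y_def)
  have ABS: "?A * ?B \<in> carrier (Sp n)" and BAS: "?B * ?A \<in> carrier (Sp n)"
    by (rule Sp_mult[OF a(1) b(1)], rule Sp_mult[OF b(1) a(1)])
  obtain E where E: "E \<in> carrier (Sp n)" "?B * ?A * E = 1\<^sub>m (2 * n)" "E * (?B * ?A) = 1\<^sub>m (2 * n)"
    using Sp_inverse[OF BAS] .
  \<comment> \<open>the commutator of the two lifts lies in \<open>T \<inter> H\<close>\<close>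
  let ?D = "wperm n id (\<lambda>k. x k / y k)"
  have "?D * (?B * ?A) = ?A * ?B"
    unfolding AB BA
    by (subst wperm_mult) (use y_nz weyl_comp[OF w0 w1] in \<open>auto intro!: wperm_cong\<close>)
  then have "?A * ?B * E = ?D * (?B * ?A) * E" by simp
  also have "\<dots> = ?D * (?B * ?A * E)"
    by (rule assoc_mult_mat) (use Sp_carrier[OF BAS] Sp_carrier[OF E(1)] in auto)
  finally have D: "?A * ?B * E = ?D" unfolding E(2) by simp
  then have DS: "?D \<in> carrier (Sp n)" using Sp_mult[OF ABS E(1)] by simp
  have invE: "inv\<^bsub>?G\<^esub> (proj n (?B * ?A)) = proj n E"
    by (rule PSp_inv[OF n1 BAS E(1,3)])
  have "proj n (?A * ?B) \<in> H" "proj n (?B * ?A) \<in> H"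
    using subgroup.m_closed[OF H a(2) b(2)] subgroup.m_closed[OF H b(2) a(2)] a(1) b(1)
    by (simp_all add: PSp_mult[OF n1])
  then have "proj n (?A * ?B) \<otimes>\<^bsub>?G\<^esub> proj n E \<in> H"
    unfolding invE[symmetric] using H by (simp add: subgroup.m_closed subgroup.m_inv_closed)
  then have "proj n ?D \<in> H" unfolding PSp_mult[OF n1 ABS E(1)] D .
  moreover have "proj n ?D \<in> diag_torus n"
    using wperm_id_diag_Sp[OF DS] by (simp add: diag_torus_def)
  ultimately obtain s where s: "\<And>k. k < 2 * n \<Longrightarrow> x k / y k = s" using scalar[OF DS] by blast
  have "s = 1" using s[of 2] n nz[of 2] by (simp add: x_def y_def flip_def bar_def)
  then have "x 0 = y 0" using s[of 0] y_nz[of 0] n by simp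
  then have "b (bar n 0) = b 0"
    using n nz[of 0] by (simp add: x_def y_def flip_def bar_def)
  then show False using b_prod(2) sq one_ne by simp
qed

section \<open>The conjugates of the diagonal group are tori\<close>

lemma generated_algebra_const: "restrict (\<lambda>x. c) Y \<in> generated_algebra Y S"
  by (rule generated_algebra.const)

lemma generated_algebra_add:
  assumes "restrict f Y \<in> generated_algebra Y S" "restrict g Y \<in> generated_algebra Y S"
  shows "restrict (\<lambda>x. f x + g x) Y \<in> generated_algebra Y S"
proof -
  have "restrict (\<lambda>x. f x + g x) Y = (\<lambda>x\<in>Y. restrict f Y x + restrict g Y x)"
    by (rule restrict_ext) simp
  then show ?thesis using generated_algebra.add[OF assms] by simp
qed

lemma generated_algebra_mult:
  assumes "restrict f Y \<in> generated_algebra Y S" "restrict g Y \<in> generated_algebra Y S"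
  shows "restrict (\<lambda>x. f x * g x) Y \<in> generated_algebra Y S"
proof -
  have "restrict (\<lambda>x. f x * g x) Y = (\<lambda>x\<in>Y. restrict f Y x * restrict g Y x)"
    by (rule restrict_ext) simp
  then show ?thesis using generated_algebra.mult[OF assms] by simp
qed

lemma generated_algebra_sum:
  assumes "finite I" "\<And>i. i \<in> I \<Longrightarrow> restrict (f i) Y \<in> generated_algebra Y S"
  shows "restrict (\<lambda>x. \<Sum>i\<in>I. f i x) Y \<in> generated_algebra Y S"
  using assms
proof (induction I rule: finite_induct)
  case empty
  show ?case using generated_algebra_const[of 0 Y S] by (simp only: sum.empty)
next
  case (insert j I)
  have "restrict (\<lambda>x. f j x + (\<Sum>i\<in>I. f i x)) Y \<in> generated_algebra Y S"
    by (rule generated_algebra_add) (use insert in blast)+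
  then show ?case using insert(1,2) by (simp only: sum.insert not_False_eq_True)
qed

text \<open>
  The coordinate ring of \<open>PSp n\<close>, seen on \<open>Sp n\<close>.
\<close>

definition even_algebra :: "nat \<Rightarrow> ('k::field mat \<Rightarrow> 'k) set" where
  "even_algebra n = generated_algebra (carrier (Sp n))
    {\<lambda>A. A $$ (i, j) * A $$ (k, l) | i j k l. i < 2 * n \<and> j < 2 * n \<and> k < 2 * n \<and> l < 2 * n}"

lemma regular_PSp_iff:
  "f \<in> regular (PSp n :: ('k::field mat set, 'k) alg_group) \<longleftrightarrow>
    f \<in> extensional (carrier (PSp n)) \<and> (\<lambda>A\<in>carrier (Sp n). f (proj n A)) \<in> even_algebra n"
  by (simp add: PSp_def Let_def even_algebra_def proj_def)

lemma even_algebra_entries: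
  assumes "i < 2 * n" "j < 2 * n" "k < 2 * n" "l < 2 * n"
  shows "restrict (\<lambda>A. A $$ (i, j) * A $$ (k, l)) (carrier (Sp n)) \<in> even_algebra n"
  unfolding even_algebra_def by (rule generated_algebra.gen) (use assms in blast)

lemma even_algebra_uminus:
  fixes A :: "'k::field mat"
  assumes "F \<in> even_algebra n" "A \<in> carrier (Sp n)"
  shows "F (- A) = F A"
  using assms(1) unfolding even_algebra_def
proof (induction rule: generated_algebra.induct)
  case (gen f)
  then obtain i j k l where "f = (\<lambda>A. A $$ (i, j) * A $$ (k, l))"
    "i < 2 * n" "j < 2 * n" "k < 2 * n" "l < 2 * n" by blast
  then show ?case using assms(2) Sp_uminus[OF assms(2)] Sp_carrier[OF assms(2)] by simp
qed (use assms(2) Sp_uminus[OF assms(2)] in simp_all)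

lemma triple_product_index:
  fixes A :: "'k::field mat"
  assumes "P \<in> carrier_mat m m" "A \<in> carrier_mat m m" "Q \<in> carrier_mat m m" "i < m" "j < m"
  shows "(P * A * Q) $$ (i, j)
    = (\<Sum>(a, b)\<in>{..<m} \<times> {..<m}. P $$ (i, a) * Q $$ (b, j) * A $$ (a, b))"
proof -
  have "(P * A * Q) $$ (i, j) = (\<Sum>b<m. (\<Sum>a<m. P $$ (i, a) * A $$ (a, b)) * Q $$ (b, j))"
    using assms by (subst mult_index[of _ m m _ m]) (auto simp: mult_index[of _ m m _ m] simp del: index_mult_mat(1))
  also have "\<dots> = (\<Sum>b<m. \<Sum>a<m. P $$ (i, a) * Q $$ (b, j) * A $$ (a, b))"
    unfolding sum_distrib_right by (intro sum.cong refl) (simp only: mult_ac)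
  also have "\<dots> = (\<Sum>a<m. \<Sum>b<m. P $$ (i, a) * Q $$ (b, j) * A $$ (a, b))"
    by (rule sum.swap)
  finally show ?thesis by (simp add: sum.cartesian_product)
qed

text \<open>
  The even functions are stable under \<open>A \<mapsto> P A Q\<close>; this moves coordinates on the diagonal torus to its
  conjugates.
\<close>

lemma even_algebra_conjugate_entries:
  fixes P Q :: "'k::field mat"
  assumes P: "P \<in> carrier_mat (2 * n) (2 * n)" and Q: "Q \<in> carrier_mat (2 * n) (2 * n)"
    and "i < 2 * n" "j < 2 * n" "k < 2 * n" "l < 2 * n"
  shows "restrict (\<lambda>A. (P * A * Q) $$ (i, j) * (P * A * Q) $$ (k, l)) (carrier (Sp n)) \<in> even_algebra n"
proof -
  let ?I = "{..<2 * n} \<times> {..<2 * n}"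
  define w where "w i j p = P $$ (i, fst p) * Q $$ (snd p, j)" for i j and p :: "nat \<times> nat"
  have entry: "(P * A * Q) $$ (i, j) = (\<Sum>p\<in>?I. w i j p * A $$ p)"
    if "A \<in> carrier (Sp n)" "i < 2 * n" "j < 2 * n" for A i j
    using triple_product_index[OF P Sp_carrier[OF that(1)] Q that(2,3)]
    by (simp add: w_def case_prod_beta)
  have "restrict (\<lambda>A. (P * A * Q) $$ (i, j) * (P * A * Q) $$ (k, l)) (carrier (Sp n))
      = restrict (\<lambda>A. \<Sum>p\<in>?I. \<Sum>q\<in>?I. (w i j p * w k l q) * (A $$ p * A $$ q)) (carrier (Sp n))"
    using assms by (intro restrict_ext) (simp add: entry sum_product mult_ac del: index_mult_mat(1))
  also have "\<dots> \<in> even_algebra n"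
    unfolding even_algebra_def
  proof (intro generated_algebra_sum generated_algebra_mult[OF generated_algebra_const])
    fix p q assume "p \<in> ?I" "q \<in> ?I"
    then show "restrict (\<lambda>A. A $$ p * A $$ q) (carrier (Sp n :: 'k mat monoid)) \<in> generated_algebra (carrier (Sp n))
        {\<lambda>A. A $$ (i, j) * A $$ (k, l) | i j k l. i < 2 * n \<and> j < 2 * n \<and> k < 2 * n \<and> l < 2 * n}"
      using even_algebra_entries[of "fst p" n "snd p" "fst q" "snd q", where 'a = 'k]
      by (auto simp: even_algebra_def)
  qed auto
  finally show ?thesis .
qed

context
  fixes n :: nat
  assumes n: "n \<ge> 1"
begin

text \<open>Even polynomial functions are constant on the fibres \<open>{A, - A}\<close> of the projection.\<close>

lemma even_algebra_descends:
  fixes F :: "'k::alg_closed_field mat \<Rightarrow> 'k"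
  assumes F: "F \<in> even_algebra n"
  shows "\<exists>f\<in>regular (PSp n). \<forall>A\<in>carrier (Sp n). f (proj n A) = F A"
proof -
  define f where "f = (\<lambda>C\<in>carrier (PSp n :: ('k mat set, 'k) alg_group). F (SOME A. A \<in> C))"
  have val: "f (proj n A) = F A" if A: "A \<in> carrier (Sp n)" for A
  proof -
    have "(SOME B. B \<in> proj n A) \<in> proj n A"
      by (rule someI[of _ A]) (simp add: proj_eq[OF n A])
    then have "(SOME B. B \<in> proj n A) = A \<or> (SOME B. B \<in> proj n A) = - A"
      by (simp add: proj_eq[OF n A])
    then show ?thesis using even_algebra_uminus[OF F A] A by (auto simp: f_def PSp_simps(1))
  qed
  have "F \<in> extensional (carrier (Sp n))"
    using F unfolding even_algebra_def 
    by (induction rule: generated_algebra.induct) (rule restrict_extensional)+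
  then have "(\<lambda>A\<in>carrier (Sp n). f (proj n A)) = F"
    using val by (auto simp: extensional_def restrict_def fun_eq_iff)
  then have "f \<in> regular (PSp n)" using F by (simp add: regular_PSp_iff f_def)
  with val show ?thesis by blast
qed

definition conj_torus :: "'k::field mat \<Rightarrow> 'k mat \<Rightarrow> 'k mat set set" where
  "conj_torus g h = (\<lambda>d. proj n (g * d * h)) ` diag_Sp n"

text \<open>
  A point \<open>s\<close> of the split torus goes to the class of \<open>diag(t\<^sub>0, \<dots>, t\<^sub>n\<^sub>-\<^sub>1)\<close> with
  \<open>t\<^sub>i / t\<^sub>n\<^sub>-\<^sub>1 = s\<^sub>i\<close> and \<open>t\<^sub>n\<^sub>-\<^sub>1\<^sup>2 = s\<^sub>n\<^sub>-\<^sub>1\<close>: the characters \<open>t\<^sub>i / t\<^sub>n\<^sub>-\<^sub>1\<close> and \<open>t\<^sub>n\<^sub>-\<^sub>1\<^sup>2\<close> are a basis of the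
  characters of even degree.
\<close>

definition split_coord :: "(nat \<Rightarrow> 'k::field) \<Rightarrow> nat \<Rightarrow> 'k" where
  "split_coord s i = (if i = n - 1 then 1 else s i)"

definition split_diag :: "(nat \<Rightarrow> 'k::field) \<Rightarrow> 'k \<Rightarrow> nat \<Rightarrow> 'k" where
  "split_diag s t i =
    (if i < n then split_coord s i * t else inverse (split_coord s (i - n)) * inverse t)"

definition split_root :: "(nat \<Rightarrow> 'k::field) \<Rightarrow> 'k" where
  "split_root s = (SOME t. t * t = s (n - 1))"

lemma split_root: "split_root s * split_root s = (s (n - 1) :: 'k::alg_closed_field)"
  unfolding split_root_def
  by (rule someI_ex) (use nth_root_exists[of 2 "s (n - 1)"] in \<open>simp add: power2_eq_square\<close>)

lemma split_diag_Sp: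
  fixes s :: "nat \<Rightarrow> 'k::alg_closed_field"
  assumes "s \<in> carrier (Gm_power n)" "t \<noteq> 0"
  shows "wperm n id (split_diag s t) \<in> diag_Sp n"
proof (rule wperm_id_diag_Sp, unfold wperm_id_Sp_iff, intro allI impI)
  fix i assume i: "i < 2 * n"
  have nz: "split_coord s j \<noteq> 0" if "j < n" for j
    using assms(1) that by (auto simp: split_coord_def Gm_power_def)
  show "split_diag s t i * split_diag s t (bar n i) = 1"
  proof (cases "i < n")
    case True
    then show ?thesis using nz[of i] assms(2) by (simp add: split_diag_def bar_def field_simps)
  next
    case False
    then have "i - n < n" using i by simp
    then show ?thesis using False nz[of "i - n"] assms(2) by (simp add: split_diag_def bar_def field_simps)
  qed
qed

lemma conj_torus_eq_image:
  fixes g h :: "'k::alg_closed_field mat"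
  assumes g: "g \<in> carrier (Sp n)" "h \<in> carrier (Sp n)" "g * h = 1\<^sub>m (2 * n)" "h * g = 1\<^sub>m (2 * n)"
  shows "conj_torus g h = (\<lambda>x. proj n g \<otimes>\<^bsub>PSp n\<^esub> x \<otimes>\<^bsub>PSp n\<^esub> inv\<^bsub>PSp n\<^esub> proj n g) ` diag_torus n"
  unfolding conj_torus_def diag_torus_def image_image
  by (intro image_cong) (use g in \<open>auto simp: PSp_inv[OF n] PSp_mult[OF n] Sp_mult diag_Sp_def\<close>)

text \<open>
  The torus is cut out by the squares of the off-diagonal entries of \<open>h A g\<close>, which unlike the entries
  are functions on \<open>PSp n\<close>. The isomorphism is that of \<open>split_diag\<close>. A product of two weights
  of \<open>split_diag s t\<close> involves \<open>t\<close> only through powers of \<open>t\<^sup>2\<close> and is therefore regular in \<open>s\<close>.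
  Conversely the coordinates \<open>s\<^sub>i\<close> are products of two diagonal entries of \<open>h A g\<close>.
\<close>

lemma conj_torus_torus:
  fixes g h :: "'k::alg_closed_field mat"
  assumes g: "g \<in> carrier (Sp n)" and h: "h \<in> carrier (Sp n)"
    and gh: "g * h = 1\<^sub>m (2 * n)" and hg: "h * g = 1\<^sub>m (2 * n)"
  shows "torus (PSp n) (conj_torus g h)"
proof -
  let ?G = "PSp n :: ('k mat set, 'k) alg_group"
  let ?T = "conj_torus g h"
  let ?Gm = "Gm_power n :: (nat \<Rightarrow> 'k, 'k) alg_group"
  interpret group ?G by (rule group_PSp[OF n])
  note gC = Sp_carrier[OF g] and hC = Sp_carrier[OF h]
  have assoc: "X1 * X2 * X3 = X1 * (X2 * X3)"
    if "X1 \<in> carrier_mat (2*n) (2*n)" "X2 \<in> carrier_mat (2*n) (2*n)" "X3 \<in> carrier_mat (2*n) (2*n)"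
    for X1 X2 X3 :: "'k mat" using that by (rule assoc_mult_mat)
  have cl: "X1 * X2 \<in> carrier_mat (2*n) (2*n)"
    if "X1 \<in> carrier_mat (2*n) (2*n)" "X2 \<in> carrier_mat (2*n) (2*n)"
    for X1 X2 :: "'k mat" using that by (rule mult_carrier_mat)
  have cancel: "g * (h * B) = B" "h * (g * B) = B" if "B \<in> carrier_mat (2*n) (2*n)" for B
    using that gC hC assoc[OF gC hC that] assoc[OF hC gC that] by (simp_all add: gh hg)
  have unconj: "h * (g * B * h) * g = B" "g * (h * B * g) * h = B"
    if "B \<in> carrier_mat (2*n) (2*n)" for B
    using that gC hC by (simp_all add: assoc cl cancel gh hg)
  have TC: "?T \<subseteq> carrier ?G"
    using g h by (auto simp: conj_torus_def PSp_simps(1) diag_Sp_def Sp_mult)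
  have mem: "proj n A \<in> ?T \<longleftrightarrow> h * A * g \<in> diag_Sp n" if A: "A \<in> carrier (Sp n)" for A
  proof
    assume "proj n A \<in> ?T"
    then obtain d where d: "d \<in> diag_Sp n" "proj n A = proj n (g * d * h)"
      by (auto simp: conj_torus_def)
    have dC: "d \<in> carrier_mat (2*n) (2*n)" using d by (auto simp: diag_Sp_def Sp_carrier)
    have "g * d * h \<in> carrier (Sp n)" using d g h by (simp add: diag_Sp_def Sp_mult)
    with d have "A = g * d * h \<or> A = - (g * d * h)" using proj_eq_iff[OF n A] by blast
    then have "h * A * g = d \<or> h * A * g = - d"
    proof
      assume "A = - (g * d * h)"
      then have "h * A * g = - (h * (g * d * h) * g)"
        using gC hC dC by (simp add: cl uminus_mult_left_mat uminus_mult_right_mat)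
      then show ?thesis using unconj[OF dC] by simp
    qed (use unconj[OF dC] in simp)
    then show "h * A * g \<in> diag_Sp n" using d(1) diag_Sp_uminus by auto
  next
    assume "h * A * g \<in> diag_Sp n"
    then show "proj n A \<in> ?T"
      unfolding conj_torus_def using unconj(2)[OF Sp_carrier[OF A]] by (metis image_eqI)
  qed
  have sub: "subgroup ?T ?G"
    unfolding conj_torus_eq_image[OF g h gh hg]
  proof -
    let ?c = "\<lambda>x. proj n g \<otimes>\<^bsub>?G\<^esub> x \<otimes>\<^bsub>?G\<^esub> inv\<^bsub>?G\<^esub> proj n g"
    have "?c \<in> iso ?G ?G"
      by (rule conjugation_iso[OF group_PSp[OF n]]) (use g in \<open>simp add: PSp_simps(1)\<close>)
    then interpret c: group_hom ?G ?G ?c by unfold_locales (simp add: iso_def)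
    show "subgroup (?c ` diag_torus n) ?G"
      by (rule c.subgroup_img_is_subgroup[OF diag_torus_subgroup[OF n]])
  qed
  have closed: "zariski_closed ?G ?T"
  proof -
    let ?E = "\<lambda>i j. restrict (\<lambda>A. (h * A * g) $$ (i, j) * (h * A * g) $$ (i, j)) (carrier (Sp n))"
    let ?S = "{f \<in> regular ?G. \<exists>i<2*n. \<exists>j<2*n. i \<noteq> j \<and> (\<forall>A\<in>carrier (Sp n). f (proj n A) = ?E i j A)}"
    have "?T = {x \<in> carrier ?G. \<forall>f\<in>?S. f x = 0}"
    proof (intro equalityI subsetI CollectI conjI ballI)
      fix x f assume x: "x \<in> ?T" and f: "f \<in> ?S"
      obtain A where A: "A \<in> carrier (Sp n)" "x = proj n A"
        using x TC by (auto simp: PSp_simps(1))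
      then have "diagonal_mat (h * A * g)" using mem x by (simp add: diag_Sp_def)
      then have "(h * A * g) $$ (i, j) = 0" if "i < 2*n" "j < 2*n" "i \<noteq> j" for i j
        using that gC hC unfolding diagonal_mat_def by simp
      then show "f x = 0" using f A by auto
    next
      fix x assume x: "x \<in> {x \<in> carrier ?G. \<forall>f\<in>?S. f x = 0}"
      then obtain A where A: "A \<in> carrier (Sp n)" "x = proj n A" by (auto simp: PSp_simps(1))
      have "(h * A * g) $$ (i, j) = 0" if ij: "i < 2*n" "j < 2*n" "i \<noteq> j" for i j
      proof -
        obtain f where f: "f \<in> regular ?G" "\<forall>A\<in>carrier (Sp n). f (proj n A) = ?E i j A"
          using even_algebra_descends[OF even_algebra_conjugate_entries[OF hC gC ij(1,2) ij(1,2)]] by blast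
        then have "f \<in> ?S" using ij by blast
        then have "f x = 0" using x by blast
        then show ?thesis using f(2) A by simp
      qed
      then have "diagonal_mat (h * A * g)" using gC hC unfolding diagonal_mat_def by simp
      then have "h * A * g \<in> diag_Sp n" using A g h by (simp add: diag_Sp_def Sp_mult)
      then show "x \<in> ?T" using mem A by simp
    qed (use TC in auto)
    then show ?thesis unfolding zariski_closed_def by (intro exI[of _ ?S]) auto
  qed
  define dm where "dm s t = g * wperm n id (split_diag s t) * h" for s :: "nat \<Rightarrow> 'k" and t
  define \<phi> where "\<phi> s = proj n (dm s (split_root s))" for s
  have GmD: "s i \<noteq> 0" if "s \<in> carrier ?Gm" "i < n" for s i
    using that by (auto simp: Gm_power_def)
  have last: "n - 1 < n" using n by simp
  have root_nz: "t \<noteq> 0" if "s \<in> carrier ?Gm" "t * t = s (n - 1)" for s t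
    using GmD[OF that(1) last] that(2) by auto
  have root_nz': "split_root s \<noteq> 0" if "s \<in> carrier ?Gm" for s
    using root_nz[OF that] split_root[of s] by blast
  have coord_nz: "split_coord s i \<noteq> 0" if "s \<in> carrier ?Gm" "i < n" for s i
    using GmD[OF that] by (simp add: split_coord_def)
  have dmS: "dm s t \<in> carrier (Sp n)" if "s \<in> carrier ?Gm" "t \<noteq> 0" for s t
    using split_diag_Sp[OF that] g h by (simp add: dm_def diag_Sp_def Sp_mult)
  have dmT: "proj n (dm s t) \<in> ?T" if "s \<in> carrier ?Gm" "t \<noteq> 0" for s t
    using split_diag_Sp[OF that] by (simp add: dm_def conj_torus_def)
  have any_root: "proj n (dm s t) = \<phi> s" if s: "s \<in> carrier ?Gm" and t: "t * t = s (n - 1)" for s t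
  proof -
    have "t * t = split_root s * split_root s" using t split_root[of s] by simp
    then have "t = split_root s \<or> t = - split_root s" by (simp add: square_eq_iff)
    moreover have "proj n (dm s (- split_root s)) = proj n (dm s (split_root s))"
    proof -
      have "wperm n id (split_diag s (- split_root s)) = - wperm n id (split_diag s (split_root s))"
        unfolding wperm_uminus by (rule wperm_cong) (auto simp: split_diag_def)
      then have "dm s (- split_root s) = - dm s (split_root s)"
        unfolding dm_def using gC hC by (simp add: cl uminus_mult_left_mat uminus_mult_right_mat)
      then show ?thesis using proj_uminus[OF n dmS[OF s root_nz'[OF s]]] by simp
    qed
    ultimately show ?thesis unfolding \<phi>_def by auto
  qed
  have Gm_mult: "s \<otimes>\<^bsub>?Gm\<^esub> s' \<in> carrier ?Gm" if "s \<in> carrier ?Gm" "s' \<in> carrier ?Gm" for s s'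
    using GmD[OF that(1)] GmD[OF that(2)] by (simp add: Gm_power_def restrict_PiE_iff)
  have mult_val: "(s \<otimes>\<^bsub>?Gm\<^esub> s') i = s i * s' i" if "i < n" for s s' i
    using that by (simp add: Gm_power_def)
  have hom: "\<phi> (s \<otimes>\<^bsub>?Gm\<^esub> s') = \<phi> s \<otimes>\<^bsub>?G\<^esub> \<phi> s'"
    if s: "s \<in> carrier ?Gm" and s': "s' \<in> carrier ?Gm" for s s'
  proof -
    let ?t = "split_root s" and ?t' = "split_root s'"
    have "(?t * ?t') * (?t * ?t') = (s \<otimes>\<^bsub>?Gm\<^esub> s') (n - 1)"
      using split_root[of s] split_root[of s'] mult_val[OF last] by (simp only: mult_ac) (simp flip: mult.assoc)
    then have "\<phi> (s \<otimes>\<^bsub>?Gm\<^esub> s') = proj n (dm (s \<otimes>\<^bsub>?Gm\<^esub> s') (?t * ?t'))"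
      using any_root[OF Gm_mult[OF s s']] by simp
    also have "dm (s \<otimes>\<^bsub>?Gm\<^esub> s') (?t * ?t') = dm s ?t * dm s' ?t'"
    proof -
      have coord: "split_coord (s \<otimes>\<^bsub>?Gm\<^esub> s') i = split_coord s i * split_coord s' i" if "i < n" for i
        using mult_val[OF that] by (simp add: split_coord_def)
      have "wperm n id (split_diag (s \<otimes>\<^bsub>?Gm\<^esub> s') (?t * ?t'))
          = wperm n id (split_diag s ?t) * wperm n id (split_diag s' ?t')" (is "?D = ?D1 * ?D2")
        unfolding wperm_mult[OF weyl_id weyl_id]
        by (rule wperm_cong) (auto simp: split_diag_def coord)
      moreover have "dm s ?t * dm s' ?t' = g * (?D1 * ?D2) * h"
        unfolding dm_def using gC hC by (simp add: assoc cl cancel)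
      ultimately show ?thesis by (simp add: dm_def)
    qed
    also have "proj n (dm s ?t * dm s' ?t') = \<phi> s \<otimes>\<^bsub>?G\<^esub> \<phi> s'"
      unfolding \<phi>_def by (rule PSp_mult[OF n, symmetric]) (simp_all add: dmS root_nz' s s')
    finally show ?thesis .
  qed
  have diag_entry: "(h * dm s t * g) $$ (i, i) = split_diag s t i" if "i < 2 * n" for s t i
    unfolding dm_def using unconj(1)[of "wperm n id (split_diag s t)"] that by simp
  \<comment> \<open>every regular function on the split torus is the restriction of an even function\<close>
  have pull: "\<exists>F\<in>even_algebra n. \<forall>s\<in>carrier ?Gm. F (dm s (split_root s)) = p s"
    if "p \<in> regular ?Gm" for p
  proof -
    have "p \<in> generated_algebra (carrier ?Gm)
        ((\<lambda>i t. t i) ` {..<n} \<union> (\<lambda>i t. inverse (t i)) ` {..<n})"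
      using that by (simp add: Gm_power_def)
    then show ?thesis
    proof (induction rule: generated_algebra.induct)
      case (const c)
      have "(\<lambda>A\<in>carrier (Sp n). c) \<in> even_algebra n"
        unfolding even_algebra_def by (rule generated_algebra.const)
      then show ?case by (rule bexI[rotated]) (simp add: dmS root_nz')
    next
      case (gen f)
      define E where "E i j = restrict (\<lambda>A. (h * A * g) $$ (i, i) * (h * A * g) $$ (j, j)) (carrier (Sp n))" for i j
      have E: "E i j \<in> even_algebra n" if "i < 2 * n" "j < 2 * n" for i j
        unfolding E_def by (rule even_algebra_conjugate_entries[OF hC gC that(1,1,2,2)])
      have val: "E i j (dm s (split_root s)) = split_diag s (split_root s) i * split_diag s (split_root s) j"
        if "s \<in> carrier ?Gm" "i < 2 * n" "j < 2 * n" for s i j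
        using dmS[OF that(1) root_nz'[OF that(1)]] diag_entry that by (simp add: E_def del: index_mult_mat(1))
      consider i where "i < n" "f = (\<lambda>t. t i)" | i where "i < n" "f = (\<lambda>t. inverse (t i))"
        using gen by auto
      then show ?case
      proof cases
        case 1
        show ?thesis
        proof (cases "i = n - 1")
          case True
          show ?thesis
            by (rule bexI[OF _ E[of i i]])
              (use 1 True split_root in \<open>auto simp: val split_diag_def split_coord_def\<close>)
        next
          case False
          show ?thesis
            by (rule bexI[OF _ E[of i "2 * n - 1"]])
              (use 1 False n root_nz' in \<open>auto simp: val split_diag_def split_coord_def\<close>)
        qed
      next
        case 2
        show ?thesis
        proof (cases "i = n - 1")
          case True
          have "inverse (split_root s) * inverse (split_root s) = inverse (s (n - 1))" for s :: "nat \<Rightarrow> 'k"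
            unfolding split_root[of s, symmetric] by simp
          then show ?thesis
            by (intro bexI[OF _ E[of "i + n" "i + n"]])
              (use 2 True in \<open>auto simp: val split_diag_def split_coord_def\<close>)
        next
          case False
          show ?thesis
            by (rule bexI[OF _ E[of "i + n" "n - 1"]])
              (use 2 False n root_nz' in \<open>auto simp: val split_diag_def split_coord_def\<close>)
        qed
      qed
    next
      case (add p q)
      then obtain F1 F2 where F: "F1 \<in> even_algebra n" "F2 \<in> even_algebra n"
        "\<forall>s\<in>carrier ?Gm. F1 (dm s (split_root s)) = p s" "\<forall>s\<in>carrier ?Gm. F2 (dm s (split_root s)) = q s"
        by blast
      have "(\<lambda>A\<in>carrier (Sp n). F1 A + F2 A) \<in> even_algebra n"
        using F(1,2) unfolding even_algebra_def by (rule generated_algebra.add)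
      then show ?case by (rule bexI[rotated]) (use F in \<open>simp add: dmS root_nz'\<close>)
    next
      case (mult p q)
      then obtain F1 F2 where F: "F1 \<in> even_algebra n" "F2 \<in> even_algebra n"
        "\<forall>s\<in>carrier ?Gm. F1 (dm s (split_root s)) = p s" "\<forall>s\<in>carrier ?Gm. F2 (dm s (split_root s)) = q s"
        by blast
      have "(\<lambda>A\<in>carrier (Sp n). F1 A * F2 A) \<in> even_algebra n"
        using F(1,2) unfolding even_algebra_def by (rule generated_algebra.mult)
      then show ?case by (rule bexI[rotated]) (use F in \<open>simp add: dmS root_nz'\<close>)
    qed
  qed
  have pull': "\<exists>f\<in>regular ?G. \<forall>s\<in>carrier ?Gm. f (\<phi> s) = p s" if p: "p \<in> regular ?Gm" for p
  proof -
    obtain F where F: "F \<in> even_algebra n" "\<forall>s\<in>carrier ?Gm. F (dm s (split_root s)) = p s"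
      using pull[OF p] by blast
    obtain f where "f \<in> regular ?G" "\<forall>A\<in>carrier (Sp n). f (proj n A) = F A"
      using even_algebra_descends[OF F(1)] by blast
    then show ?thesis using F(2) by (intro bexI[of _ f]) (simp_all add: \<phi>_def dmS root_nz')
  qed
  have inj: "inj_on \<phi> (carrier ?Gm)"
  proof (rule inj_onI)
    fix s s' assume s: "s \<in> carrier ?Gm" "s' \<in> carrier ?Gm" "\<phi> s = \<phi> s'"
    have "s i = s' i" if i: "i < n" for i
    proof -
      have "restrict (\<lambda>t. t i) (carrier ?Gm) \<in> regular ?Gm"
        unfolding Gm_power_def using i by (simp add: generated_algebra.gen)
      from pull'[OF this] obtain f where
        "\<forall>s\<in>carrier ?Gm. f (\<phi> s) = restrict (\<lambda>t. t i) (carrier ?Gm) s" by blast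
      then have "f (\<phi> s) = s i" "f (\<phi> s') = s' i" using s(1,2) by simp_all
      then show ?thesis using s(3) by simp
    qed
    then show "s = s'" using s(1,2) unfolding Gm_power_def by (auto intro: PiE_ext)
  qed
  have img: "\<phi> ` carrier ?Gm = ?T"
  proof (intro equalityI subsetI)
    fix x assume "x \<in> ?T"
    then obtain d where d: "d \<in> diag_Sp n" "x = proj n (g * d * h)" by (auto simp: conj_torus_def)
    define c where "c i = d $$ (i, i)" for i
    have c: "c i * c (i + n) = 1" if "i < n" for i
      using diag_Sp_entries[OF d(1), of i] that by (simp add: c_def bar_def)
    define l where "l = n - 1"
    have l: "l < n" using last by (simp add: l_def)
    define s where "s = (\<lambda>i\<in>{..<n}. if i = l then c l * c l else c i * c (l + n))"
    have nz: "c i \<noteq> 0" "c (i + n) \<noteq> 0" if "i < n" for i using c[OF that] by auto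
    have s: "s \<in> carrier ?Gm"
      using nz nz[OF l] by (simp add: s_def Gm_power_def restrict_PiE_iff)
    have cinv: "inverse (c i) = c (i + n)" if "i < n" for i
      using c[OF that] by (rule inverse_unique)
    have sc: "split_coord s j = (if j = l then 1 else s j)" for j
      by (simp add: split_coord_def l_def)
    have split: "split_diag s (c l) i = c i" if i: "i < 2 * n" for i
    proof -
      have co: "split_coord s j * c l = c j" if "j < n" for j
      proof (cases "j = l")
        case False
        have "s j = c j * c (l + n)" using False that by (simp add: s_def)
        then have "split_coord s j * c l = c j * (c l * c (l + n))"
          using False by (simp add: sc mult_ac)
        then show ?thesis using c[OF l] by simp
      qed (simp add: sc)
      show ?thesis
      proof (cases "i < n")
        case False
        then have i': "i - n < n" using i by simp
        have "split_diag s (c l) i = inverse (split_coord s (i - n) * c l)"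
          using False by (simp add: split_diag_def)
        also have "\<dots> = c i" unfolding co[OF i'] cinv[OF i'] using False by simp
        finally show ?thesis .
      next
        case True
        then show ?thesis using co by (simp add: split_diag_def)
      qed
    qed
    have "d = wperm n id (split_diag s (c l))"
      by (subst diag_Sp_wperm[OF d(1)], rule wperm_cong) (auto simp: split, auto simp: c_def)
    then have "x = proj n (dm s (c l))" using d(2) by (simp add: dm_def)
    also have "\<dots> = \<phi> s" by (rule any_root[OF s], unfold l_def[symmetric], simp add: s_def l)
    finally show "x \<in> \<phi> ` carrier ?Gm" using s by blast
  qed (auto simp: \<phi>_def dmT root_nz')
  have bij: "bij_betw \<phi> (carrier ?Gm) ?T" using inj img by (simp add: bij_betw_def)
  have inv_phi: "inv_into (carrier ?Gm) \<phi> (\<phi> s) = s" if "s \<in> carrier ?Gm" for s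
    by (rule inv_into_f_f[OF inj that])
  let ?R = "generated_algebra (carrier ?Gm)
      ((\<lambda>i t. t i) ` {..<n} \<union> (\<lambda>i t. inverse (t i)) ` {..<n})"
  have Rreg: "regular ?Gm = ?R" by (simp add: Gm_power_def)
  have entry_reg: "restrict (\<lambda>s. split_diag s (split_root s) a * split_diag s (split_root s) b) (carrier ?Gm) \<in> ?R"
    if ab: "a < 2 * n" "b < 2 * n" for a b
  proof -
    have co: "restrict (\<lambda>s. split_coord s i) (carrier ?Gm) \<in> ?R" if "i < n" for i
    proof (cases "i = n - 1")
      case True
      then have "restrict (\<lambda>s. split_coord s i) (carrier ?Gm) = restrict (\<lambda>s. 1) (carrier ?Gm)"
        by (intro restrict_ext) (simp add: split_coord_def)
      then show ?thesis using generated_algebra_const[of 1] by (simp only:)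
    next
      case False
      then have "restrict (\<lambda>s. split_coord s i) (carrier ?Gm) = restrict (\<lambda>s. s i) (carrier ?Gm)"
        by (intro restrict_ext) (simp add: split_coord_def)
      moreover have "restrict (\<lambda>s. s i) (carrier ?Gm) \<in> ?R"
        by (rule generated_algebra.gen) (use that in blast)
      ultimately show ?thesis by (simp only:)
    qed
    have coi: "restrict (\<lambda>s. inverse (split_coord s i)) (carrier ?Gm) \<in> ?R" if "i < n" for i
    proof (cases "i = n - 1")
      case True
      then have "restrict (\<lambda>s. inverse (split_coord s i)) (carrier ?Gm) = restrict (\<lambda>s. 1) (carrier ?Gm)"
        by (intro restrict_ext) (simp add: split_coord_def)
      then show ?thesis using generated_algebra_const[of 1] by (simp only:)
    next
      case False
      then have "restrict (\<lambda>s. inverse (split_coord s i)) (carrier ?Gm) = restrict (\<lambda>s. inverse (s i)) (carrier ?Gm)"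
        by (intro restrict_ext) (simp add: split_coord_def)
      moreover have "restrict (\<lambda>s. inverse (s i)) (carrier ?Gm) \<in> ?R"
        by (rule generated_algebra.gen) (use that in blast)
      ultimately show ?thesis by (simp only:)
    qed
    have rt: "restrict (\<lambda>s. s (n - 1)) (carrier ?Gm) \<in> ?R" "restrict (\<lambda>s. inverse (s (n - 1))) (carrier ?Gm) \<in> ?R"
      using last by (auto intro!: generated_algebra.gen simp del: restrict_apply)
    have conv: "restrict (\<lambda>s. split_diag s (split_root s) a * split_diag s (split_root s) b) (carrier ?Gm) \<in> ?R"
      if "\<And>s. s \<in> carrier ?Gm \<Longrightarrow> split_diag s (split_root s) a * split_diag s (split_root s) b = q s"
        "restrict q (carrier ?Gm) \<in> ?R" for q
      using that restrict_ext[of "carrier ?Gm" "\<lambda>s. split_diag s (split_root s) a * split_diag s (split_root s) b" q]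
      by (simp only:)
    have irt: "inverse (split_root s) * inverse (split_root s) = inverse (s (n - 1))" for s :: "nat \<Rightarrow> 'k"
      unfolding split_root[of s, symmetric] by simp
    consider "a < n" "b < n" | "a < n" "\<not> b < n" | "\<not> a < n" "b < n" | "\<not> a < n" "\<not> b < n" by blast
    then show ?thesis
    proof cases
      case 1
      show ?thesis
      proof (rule conv)
        show "restrict (\<lambda>s. split_coord s a * split_coord s b * s (n - 1)) (carrier ?Gm) \<in> ?R"
          by (intro generated_algebra_mult co rt 1)
        show "split_diag s (split_root s) a * split_diag s (split_root s) b
            = split_coord s a * split_coord s b * s (n - 1)" for s :: "nat \<Rightarrow> 'k"
          using 1 split_root[of s, symmetric] by (simp add: split_diag_def mult_ac)
      qed
    next
      case 2
      then have b: "b - n < n" using ab by simp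
      show ?thesis
      proof (rule conv)
        show "restrict (\<lambda>s. split_coord s a * inverse (split_coord s (b - n))) (carrier ?Gm) \<in> ?R"
          by (intro generated_algebra_mult co coi 2 b)
        show "split_diag s (split_root s) a * split_diag s (split_root s) b
            = split_coord s a * inverse (split_coord s (b - n))" if "s \<in> carrier ?Gm" for s
          using 2 root_nz'[OF that] by (simp add: split_diag_def)
      qed
    next
      case 3
      then have a: "a - n < n" using ab by simp
      show ?thesis
      proof (rule conv)
        show "restrict (\<lambda>s. inverse (split_coord s (a - n)) * split_coord s b) (carrier ?Gm) \<in> ?R"
          by (intro generated_algebra_mult co coi 3 a)
        show "split_diag s (split_root s) a * split_diag s (split_root s) b
            = inverse (split_coord s (a - n)) * split_coord s b" if "s \<in> carrier ?Gm" for s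
          using 3 root_nz'[OF that] by (simp add: split_diag_def)
      qed
    next
      case 4
      then have a: "a - n < n" and b: "b - n < n" using ab by simp_all
      show ?thesis
      proof (rule conv)
        show "restrict (\<lambda>s. inverse (split_coord s (a - n)) * inverse (split_coord s (b - n)) * inverse (s (n - 1)))
            (carrier ?Gm) \<in> ?R"
          by (intro generated_algebra_mult coi rt a b)
        show "split_diag s (split_root s) a * split_diag s (split_root s) b
            = inverse (split_coord s (a - n)) * inverse (split_coord s (b - n)) * inverse (s (n - 1))" for s :: "nat \<Rightarrow> 'k"
          using 4 irt[of s, symmetric] by (simp only: split_diag_def if_False) (simp only: mult_ac)
      qed
    qed
  qed
  have push: "restrict (\<lambda>s. F (dm s (split_root s))) (carrier ?Gm) \<in> ?R" if "F \<in> even_algebra n" for F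
    using that unfolding even_algebra_def
  proof (induction rule: generated_algebra.induct)
    case (const c)
    have "restrict (\<lambda>s. restrict (\<lambda>A. c) (carrier (Sp n)) (dm s (split_root s))) (carrier ?Gm)
        = restrict (\<lambda>s. c) (carrier ?Gm)"
      by (rule restrict_ext) (simp add: dmS root_nz')
    then show ?case using generated_algebra_const[of c] by (simp only:)
  next
    case (gen f)
    then obtain i j k l where f: "f = (\<lambda>A. A $$ (i, j) * A $$ (k, l))"
      and ijkl: "i < 2 * n" "j < 2 * n" "k < 2 * n" "l < 2 * n" by blast
    have ent: "dm s t $$ (i, j) = (\<Sum>a<2 * n. g $$ (i, a) * h $$ (a, j) * split_diag s t a)"
      if "i < 2 * n" "j < 2 * n" for s t i j
    proof -
      have "dm s t $$ (i, j) = (\<Sum>a<2 * n. (g * wperm n id (split_diag s t)) $$ (i, a) * h $$ (a, j))"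
        unfolding dm_def by (rule mult_index[OF cl[OF gC wperm_carrier] hC that])
      also have "\<dots> = (\<Sum>a<2 * n. g $$ (i, a) * h $$ (a, j) * split_diag s t a)"
        by (intro sum.cong refl) (simp add: mult_wperm_id_index[OF gC that(1)] mult_ac del: index_mult_mat(1))
      finally show ?thesis .
    qed
    have "restrict (\<lambda>s. restrict f (carrier (Sp n)) (dm s (split_root s))) (carrier ?Gm)
        = restrict (\<lambda>s. \<Sum>a<2 * n. \<Sum>b<2 * n. (g $$ (i, a) * h $$ (a, j)) * (g $$ (k, b) * h $$ (b, l)) *
            (split_diag s (split_root s) a * split_diag s (split_root s) b)) (carrier ?Gm)"
    proof (rule restrict_ext)
      fix s assume s: "s \<in> carrier ?Gm"
      have "restrict f (carrier (Sp n)) (dm s (split_root s))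
          = dm s (split_root s) $$ (i, j) * dm s (split_root s) $$ (k, l)"
        using dmS[OF s root_nz'[OF s]] by (simp add: f)
      then show "restrict f (carrier (Sp n)) (dm s (split_root s))
          = (\<Sum>a<2 * n. \<Sum>b<2 * n. (g $$ (i, a) * h $$ (a, j)) * (g $$ (k, b) * h $$ (b, l)) *
            (split_diag s (split_root s) a * split_diag s (split_root s) b))"
        unfolding ent[OF ijkl(1,2)] ent[OF ijkl(3,4)] sum_product by (simp only: mult_ac)
    qed
    moreover have "\<dots> \<in> ?R"
      by (intro generated_algebra_sum generated_algebra_mult[OF generated_algebra_const] entry_reg) auto
    ultimately show ?case by (simp only:)
  next
    case (add p q)
    have "restrict (\<lambda>s. restrict (\<lambda>A. p A + q A) (carrier (Sp n)) (dm s (split_root s))) (carrier ?Gm)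
        = restrict (\<lambda>s. p (dm s (split_root s)) + q (dm s (split_root s))) (carrier ?Gm)"
      by (rule restrict_ext) (simp add: dmS root_nz')
    then show ?case using generated_algebra_add[OF add(3,4)] by (simp only:)
  next
    case (mult p q)
    have "restrict (\<lambda>s. restrict (\<lambda>A. p A * q A) (carrier (Sp n)) (dm s (split_root s))) (carrier ?Gm)
        = restrict (\<lambda>s. p (dm s (split_root s)) * q (dm s (split_root s))) (carrier ?Gm)"
      by (rule restrict_ext) (simp add: dmS root_nz')
    then show ?case using generated_algebra_mult[OF mult(3,4)] by (simp only:)
  qed
  let ?U = "alg_subgroup ?G ?T"
  have U: "carrier ?U = ?T" "regular ?U = (\<lambda>f. restrict f ?T) ` regular ?G"
    "\<And>x y. x \<otimes>\<^bsub>?U\<^esub> y = x \<otimes>\<^bsub>?G\<^esub> y"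
    by (simp_all add: alg_subgroup_def)
  have in_T: "\<phi> s \<in> ?T" if "s \<in> carrier ?Gm" for s using img that by blast
  have "\<phi> \<in> alg_hom ?Gm ?U"
    unfolding alg_hom_def
  proof (intro CollectI conjI ballI)
    show "\<phi> \<in> hom ?Gm ?U" by (rule homI) (simp_all add: U in_T hom)
    fix f assume "f \<in> regular ?U"
    then obtain f1 where f1: "f1 \<in> regular ?G" "f = restrict f1 ?T" unfolding U(2) by blast
    have "restrict (f \<circ> \<phi>) (carrier ?Gm)
        = restrict (\<lambda>s. (\<lambda>A\<in>carrier (Sp n). f1 (proj n A)) (dm s (split_root s))) (carrier ?Gm)"
      by (rule restrict_ext) (simp add: f1(2) in_T dmS root_nz', simp add: \<phi>_def)
    then show "restrict (f \<circ> \<phi>) (carrier ?Gm) \<in> regular ?Gm"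
      using push f1(1) unfolding regular_PSp_iff Rreg by (simp only:)
  qed
  moreover have "inv_into (carrier ?Gm) \<phi> \<in> alg_hom ?U ?Gm"
    unfolding alg_hom_def
  proof (intro CollectI conjI ballI)
    show "inv_into (carrier ?Gm) \<phi> \<in> hom ?U ?Gm"
    proof (rule homI)
      fix x assume "x \<in> carrier ?U"
      then obtain s where s: "s \<in> carrier ?Gm" "x = \<phi> s" using img unfolding U by blast
      then show "inv_into (carrier ?Gm) \<phi> x \<in> carrier ?Gm" using inv_phi by simp
      fix y assume "y \<in> carrier ?U"
      then obtain s' where s': "s' \<in> carrier ?Gm" "y = \<phi> s'" using img unfolding U by blast
      have "x \<otimes>\<^bsub>?U\<^esub> y = \<phi> (s \<otimes>\<^bsub>?Gm\<^esub> s')" using s s' hom U by simp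
      then show "inv_into (carrier ?Gm) \<phi> (x \<otimes>\<^bsub>?U\<^esub> y)
          = inv_into (carrier ?Gm) \<phi> x \<otimes>\<^bsub>?Gm\<^esub> inv_into (carrier ?Gm) \<phi> y"
        using s s' inv_phi Gm_mult by simp
    qed
    fix p assume "p \<in> regular ?Gm"
    then obtain f where f: "f \<in> regular ?G" "\<forall>s\<in>carrier ?Gm. f (\<phi> s) = p s" using pull' by blast
    have "restrict (p \<circ> inv_into (carrier ?Gm) \<phi>) (carrier ?U) = restrict f ?T"
      unfolding U
    proof (rule restrict_ext)
      fix x assume "x \<in> ?T"
      then obtain s where s: "s \<in> carrier ?Gm" "x = \<phi> s" using img by blast
      then show "(p \<circ> inv_into (carrier ?Gm) \<phi>) x = f x" using f inv_phi by simp
    qed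
    then show "restrict (p \<circ> inv_into (carrier ?Gm) \<phi>) (carrier ?U) \<in> regular ?U"
      unfolding U using f(1) by blast
  qed
  ultimately have "\<phi> \<in> alg_iso ?Gm ?U" using bij by (simp add: alg_iso_def U)
  with sub closed show ?thesis unfolding torus_def by blast
qed

end

section \<open>Simultaneous diagonalisation in a symplectic basis\<close>

no_notation fps_nth (infixl \<open>$\<close> 75)

definition vec_subspace :: "nat \<Rightarrow> 'k::field vec set \<Rightarrow> bool" where
  "vec_subspace N W \<longleftrightarrow> W \<subseteq> carrier_vec N \<and> 0\<^sub>v N \<in> W \<and>
    (\<forall>u\<in>W. \<forall>w\<in>W. u + w \<in> W) \<and> (\<forall>c. \<forall>w\<in>W. c \<cdot>\<^sub>v w \<in> W)"

text \<open>The pivots of an echelon basis of \<open>W\<close>; their number is the dimension of \<open>W\<close>.\<close>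

definition pivots :: "nat \<Rightarrow> 'k::field vec set \<Rightarrow> nat set" where
  "pivots N W = {i. i < N \<and> (\<exists>w\<in>W. w $ i \<noteq> 0 \<and> (\<forall>j<i. w $ j = 0))}"

lemma vec_subspaceD:
  assumes "vec_subspace N W"
  shows "w \<in> W \<Longrightarrow> w \<in> carrier_vec N" "0\<^sub>v N \<in> W"
    "u \<in> W \<Longrightarrow> w \<in> W \<Longrightarrow> u + w \<in> W" "w \<in> W \<Longrightarrow> c \<cdot>\<^sub>v w \<in> W"
  using assms by (auto simp: vec_subspace_def)

text \<open>
  If both have the same pivots, a vector of the larger space is cleared by vectors of the smaller
  one, from the first coordinate on.
\<close>

lemma pivots_less:
  assumes W1: "vec_subspace N W1" and W2: "vec_subspace N W2" and sub: "W1 \<subset> W2"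
  shows "card (pivots N W1) < card (pivots N W2)"
proof -
  have mono: "pivots N W1 \<subseteq> pivots N W2" using sub by (auto simp: pivots_def)
  have "pivots N W1 \<noteq> pivots N W2"
  proof
    assume eq: "pivots N W1 = pivots N W2"
    have "\<forall>w\<in>W2. (\<forall>j<N - k. w $ j = 0) \<longrightarrow> w \<in> W1" if "k \<le> N" for k
      using that
    proof (induction k)
      case 0
      show ?case
      proof (intro ballI impI)
        fix w assume w: "w \<in> W2" "\<forall>j<N - 0. w $ j = 0"
        then have "w = 0\<^sub>v N" using vec_subspaceD(1)[OF W2 w(1)] by (intro eq_vecI) auto
        then show "w \<in> W1" using vec_subspaceD(2)[OF W1] by simp
      qed
    next
      case (Suc k)
      define i where "i = N - Suc k"
      have i: "i < N" "N - k = Suc i" using Suc.prems by (auto simp: i_def)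
      show ?case
      proof (intro ballI impI)
        fix w assume w: "w \<in> W2" "\<forall>j<N - Suc k. w $ j = 0"
        have wC: "w \<in> carrier_vec N" by (rule vec_subspaceD(1)[OF W2 w(1)])
        have IH: "u \<in> W1" if "u \<in> W2" "\<forall>j<Suc i. u $ j = 0" for u
          using Suc.IH Suc.prems that i by auto
        show "w \<in> W1"
        proof (cases "w $ i = 0")
          case True
          then show ?thesis using IH[OF w(1)] w(2) by (auto simp: i_def less_Suc_eq)
        next
          case False
          then have "i \<in> pivots N W1" unfolding eq using w i by (auto simp: pivots_def i_def)
          then obtain u where u: "u \<in> W1" "u $ i \<noteq> 0" "\<forall>j<i. u $ j = 0" by (auto simp: pivots_def)
          have uC: "u \<in> carrier_vec N" by (rule vec_subspaceD(1)[OF W1 u(1)])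
          define c where "c = w $ i / u $ i"
          have cu: "c \<cdot>\<^sub>v u \<in> W1" "(- c) \<cdot>\<^sub>v u \<in> W1" by (rule vec_subspaceD(4)[OF W1 u(1)])+
          have "w + (- c) \<cdot>\<^sub>v u \<in> W1"
          proof (rule IH)
            show "w + (- c) \<cdot>\<^sub>v u \<in> W2" using cu sub by (intro vec_subspaceD(3)[OF W2 w(1)]) auto
            show "\<forall>j<Suc i. (w + (- c) \<cdot>\<^sub>v u) $ j = 0"
            proof (intro allI impI)
              fix j assume j: "j < Suc i"
              then have "j < N" using i by simp
              then have "(w + (- c) \<cdot>\<^sub>v u) $ j = w $ j - c * u $ j" using wC uC by simp
              also have "\<dots> = 0"
                using j u w(2) by (cases "j = i") (auto simp: c_def i_def)
              finally show "(w + (- c) \<cdot>\<^sub>v u) $ j = 0" .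
            qed
          qed
          from vec_subspaceD(3)[OF W1 this cu(1)] have "w + (- c) \<cdot>\<^sub>v u + c \<cdot>\<^sub>v u \<in> W1" .
          also have "w + (- c) \<cdot>\<^sub>v u + c \<cdot>\<^sub>v u = w" using wC uC by (intro eq_vecI) auto
          finally show ?thesis .
        qed
      qed
    qed
    from this[of N] have "W2 \<subseteq> W1" by auto
    with sub show False by blast
  qed
  with mono have "pivots N W1 \<subset> pivots N W2" by blast
  moreover have "finite (pivots N W2)" by (rule finite_subset[of _ "{..<N}"]) (auto simp: pivots_def)
  ultimately show ?thesis by (rule psubset_card_mono[rotated])
qed

subsection \<open>Eigenvectors of matrices of finite order\<close>

lemma degree_prod_linear: "degree (\<Prod>z\<leftarrow>zs. [:-z, 1 :: 'k::field:]) = length zs"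
proof (induction zs)
  case (Cons a zs)
  let ?P = "\<Prod>z\<leftarrow>zs. [:-z, 1 :: 'k:]"
  have "?P \<noteq> 0" by (auto simp: prod_list_zero_iff)
  then have "degree ([:-a, 1:] * ?P) = degree [:-a, 1:] + degree ?P"
    by (intro degree_mult_eq) auto
  then show ?case using Cons by (simp only: list.map prod_list.Cons) simp
qed simp

text \<open>
  The value at \<open>w\<close> of the polynomial \<open>\<Prod>(x - z)\<close> in the matrix \<open>A\<close>.
\<close>

fun shift_product :: "'k::field mat \<Rightarrow> 'k list \<Rightarrow> 'k vec \<Rightarrow> 'k vec" where
  "shift_product A [] w = w"
| "shift_product A (z # zs) w = A *\<^sub>v shift_product A zs w + (- z) \<cdot>\<^sub>v shift_product A zs w"

context
  fixes A :: "'k::field mat" and N :: nat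
  assumes A: "A \<in> carrier_mat N N"
begin

lemma mult_mat_vec_closed: "w \<in> carrier_vec N \<Longrightarrow> A *\<^sub>v w \<in> carrier_vec N"
  using A by simp

lemma shift_product_closed: "w \<in> carrier_vec N \<Longrightarrow> shift_product A zs w \<in> carrier_vec N"
  by (induction zs) (auto simp: mult_mat_vec_closed)

lemma shift_product_linear:
  assumes "u \<in> carrier_vec N" "w \<in> carrier_vec N"
  shows "shift_product A zs (w + c \<cdot>\<^sub>v u) = shift_product A zs w + c \<cdot>\<^sub>v shift_product A zs u"
proof (induction zs)
  case (Cons z zs)
  define p q where "p = shift_product A zs w" and "q = shift_product A zs u"
  have C: "p \<in> carrier_vec N" "q \<in> carrier_vec N" "A *\<^sub>v p \<in> carrier_vec N" "A *\<^sub>v q \<in> carrier_vec N"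
    using assms by (auto simp: p_def q_def shift_product_closed mult_mat_vec_closed)
  have "A *\<^sub>v (p + c \<cdot>\<^sub>v q) = A *\<^sub>v p + c \<cdot>\<^sub>v (A *\<^sub>v q)"
    using A C by (simp add: mult_add_distrib_mat_vec[of _ N N] mult_mat_vec[of _ N N])
  then show ?case
    unfolding shift_product.simps Cons p_def[symmetric] q_def[symmetric]
    using C carrier_matD[OF A] by (intro eq_vecI) (auto simp: algebra_simps)
qed simp

lemma shift_product_eigenvector:
  assumes "u \<in> carrier_vec N" "A *\<^sub>v u = z \<cdot>\<^sub>v u"
  shows "shift_product A zs u = (\<Prod>y\<leftarrow>zs. z - y) \<cdot>\<^sub>v u"
proof (induction zs)
  case (Cons y zs)
  let ?c = "\<Prod>y\<leftarrow>zs. z - y"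
  have "A *\<^sub>v (?c \<cdot>\<^sub>v u) = ?c \<cdot>\<^sub>v (z \<cdot>\<^sub>v u)" using A assms by (simp add: mult_mat_vec[of _ N N])
  then show ?case
    unfolding shift_product.simps Cons using assms(1) by (intro eq_vecI) (auto simp: algebra_simps)
qed (use assms in simp)

lemma shift_product_expand:
  assumes w: "w \<in> carrier_vec N" and i: "i < N"
  shows "shift_product A zs w $ i =
    (\<Sum>k\<le>length zs. coeff (\<Prod>z\<leftarrow>zs. [:-z, 1:]) k * (((*\<^sub>v) A ^^ k) w) $ i)"
  using i
proof (induction zs arbitrary: i)
  case (Cons z zs)
  define f where "f = (\<Prod>z\<leftarrow>zs. [:-z, 1:])"
  define a where "a k = ((*\<^sub>v) A ^^ k) w" for k
  have aC: "a k \<in> carrier_vec N" for k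
    unfolding a_def by (induction k) (auto simp: w mult_mat_vec_closed)
  have "degree f = length zs"
    unfolding f_def by (rule degree_prod_linear)
  then have top: "coeff f (Suc (length zs)) = 0" by (simp add: coeff_eq_0)
  have IH: "shift_product A zs w $ j = (\<Sum>k\<le>length zs. coeff f k * a k $ j)" if "j < N" for j
    using Cons.IH[OF that] by (simp add: f_def a_def)
  have C: "shift_product A zs w \<in> carrier_vec N" by (rule shift_product_closed[OF w])
  have "(A *\<^sub>v shift_product A zs w) $ i = (\<Sum>j<N. A $$ (i, j) * shift_product A zs w $ j)"
    using A C Cons.prems by (auto simp: scalar_prod_def atLeast0LessThan intro!: sum.cong)
  also have "\<dots> = (\<Sum>j<N. \<Sum>k\<le>length zs. coeff f k * (A $$ (i, j) * a k $ j))"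
    by (intro sum.cong refl) (simp add: IH sum_distrib_left mult_ac)
  also have "\<dots> = (\<Sum>k\<le>length zs. coeff f k * (\<Sum>j<N. A $$ (i, j) * a k $ j))"
    by (subst sum.swap) (simp add: sum_distrib_left)
  also have "\<dots> = (\<Sum>k\<le>length zs. coeff f k * a (Suc k) $ i)"
  proof (intro sum.cong refl)
    fix k
    have "(A *\<^sub>v a k) $ i = (\<Sum>j<N. A $$ (i, j) * a k $ j)"
      using A aC[of k] Cons.prems by (auto simp: scalar_prod_def atLeast0LessThan intro!: sum.cong)
    then show "coeff f k * (\<Sum>j<N. A $$ (i, j) * a k $ j) = coeff f k * a (Suc k) $ i"
      by (simp add: a_def)
  qed
  finally have 1: "(A *\<^sub>v shift_product A zs w) $ i = (\<Sum>k\<le>length zs. coeff f k * a (Suc k) $ i)" .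
  have "shift_product A (z # zs) w $ i
      = (A *\<^sub>v shift_product A zs w) $ i + (- z) * shift_product A zs w $ i"
    using C A Cons.prems by simp
  also have "\<dots> = (\<Sum>k\<le>length zs. coeff f k * a (Suc k) $ i) - z * (\<Sum>k\<le>length zs. coeff f k * a k $ i)"
    unfolding 1 IH[OF Cons.prems] by simp
  also have "(\<Sum>k\<le>length zs. coeff f k * a (Suc k) $ i)
      = (\<Sum>k\<le>Suc (length zs). coeff (pCons 0 f) k * a k $ i)"
    by (subst sum.atMost_Suc_shift) simp
  also have "(\<Sum>k\<le>length zs. coeff f k * a k $ i) = (\<Sum>k\<le>Suc (length zs). coeff f k * a k $ i)"
    using top by simp
  also have "(\<Sum>k\<le>Suc (length zs). coeff (pCons 0 f) k * a k $ i)
        - z * (\<Sum>k\<le>Suc (length zs). coeff f k * a k $ i)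
      = (\<Sum>k\<le>Suc (length zs). coeff ([:-z, 1:] * f) k * a k $ i)"
  proof -
    have "coeff ([:-z, 1:] * f) k = coeff (pCons 0 f) k - z * coeff f k" for k by simp
    then show ?thesis
      by (simp only: sum_distrib_left sum_subtractf[symmetric]) (simp only: left_diff_distrib mult.assoc)
  qed
  finally show ?case by (simp add: f_def a_def)
qed simp

text \<open>
  A vector that is killed by \<open>\<Prod>(A - z)\<close> with distinct \<open>z\<close> is a sum of eigenvectors in the same
  invariant subspace, and \<open>l\<close> cannot vanish on all of them. The components are split off one by
  one: with \<open>c = \<Prod>(z - y)\<close> over the other roots \<open>y\<close>, the vector \<open>u / c\<close> is the component of \<open>w\<close> of
  weight \<open>z\<close>.
\<close>

lemma weight_component:
  fixes l :: "'k vec \<Rightarrow> 'k"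
  assumes W: "vec_subspace N W" and inv: "\<And>w. w \<in> W \<Longrightarrow> A *\<^sub>v w \<in> W"
    and ladd: "\<And>u w. u \<in> W \<Longrightarrow> w \<in> W \<Longrightarrow> l (u + w) = l u + l w"
    and lsmult: "\<And>c w. w \<in> W \<Longrightarrow> l (c \<cdot>\<^sub>v w) = c * l w"
    and "distinct zs" "w \<in> W" "shift_product A zs w = 0\<^sub>v N" "l w \<noteq> 0"
  shows "\<exists>z. \<exists>u\<in>W. A *\<^sub>v u = z \<cdot>\<^sub>v u \<and> l u \<noteq> 0"
  using assms(5-)
proof (induction zs arbitrary: w)
  case Nil
  have "l (0\<^sub>v N) = 0 * l (0\<^sub>v N)"
  proof -
    have "(0 :: 'k) \<cdot>\<^sub>v 0\<^sub>v N = 0\<^sub>v N" by (intro eq_vecI) auto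
    then show ?thesis using lsmult[OF vec_subspaceD(2)[OF W], of 0] by simp
  qed
  then show ?case using Nil by simp
next
  case (Cons z zs)
  let ?u = "shift_product A zs w"
  have closed: "shift_product A ys w \<in> W" for ys
  proof (induction ys)
    case (Cons y ys)
    then show ?case using inv vec_subspaceD(3,4)[OF W] by simp
  qed (use Cons.prems in simp)
  have wC: "w \<in> carrier_vec N" by (rule vec_subspaceD(1)[OF W Cons.prems(2)])
  have uC: "?u \<in> carrier_vec N" by (rule shift_product_closed[OF wC])
  have AuC: "A *\<^sub>v ?u \<in> carrier_vec N" by (rule mult_mat_vec_closed[OF uC])
  have Au: "A *\<^sub>v ?u = z \<cdot>\<^sub>v ?u"
  proof (rule eq_vecI)
    fix i assume "i < dim_vec (z \<cdot>\<^sub>v ?u)"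
    then have i: "i < N" using uC by simp
    have "(A *\<^sub>v ?u + (- z) \<cdot>\<^sub>v ?u) $ i = 0"
      using Cons.prems(3) i by simp
    then show "(A *\<^sub>v ?u) $ i = (z \<cdot>\<^sub>v ?u) $ i" using uC AuC i by simp
  qed (use uC carrier_matD[OF A] in simp)
  show ?case
  proof (cases "l ?u = 0")
    case False
    then show ?thesis using Au closed by blast
  next
    case True
    define c where "c = (\<Prod>y\<leftarrow>zs. z - y)"
    have "c \<noteq> 0" using Cons.prems(1) by (auto simp: c_def prod_list_zero_iff)
    let ?w = "w + (- inverse c) \<cdot>\<^sub>v ?u"
    have uW: "(- inverse c) \<cdot>\<^sub>v ?u \<in> W" by (rule vec_subspaceD(4)[OF W closed])
    have "shift_product A zs ?w = ?u + (- inverse c) \<cdot>\<^sub>v (c \<cdot>\<^sub>v ?u)"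
      using shift_product_linear[OF uC wC] shift_product_eigenvector[OF uC Au] by (simp add: c_def)
    also have "\<dots> = 0\<^sub>v N" using uC \<open>c \<noteq> 0\<close> by (intro eq_vecI) auto
    finally have 0: "shift_product A zs ?w = 0\<^sub>v N" .
    have "l ?w = l w" using ladd[OF Cons.prems(2) uW] lsmult[OF closed] True by simp
    then show ?thesis
      using Cons.IH[OF _ vec_subspaceD(3)[OF W Cons.prems(2) uW] 0] Cons.prems by simp
  qed
qed

end

lemma finite_order_shift_product:
  fixes A :: "'k::alg_closed_field mat"
  assumes A: "A \<in> carrier_mat N N" and m: "A ^\<^sub>m m = 1\<^sub>m N" "(of_nat m :: 'k) \<noteq> 0"
  shows "\<exists>zs. distinct zs \<and> (\<forall>w\<in>carrier_vec N. shift_product A zs w = 0\<^sub>v N)"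
proof -
  obtain zs :: "'k list" where zs: "distinct zs" "(\<Prod>z\<leftarrow>zs. [:-z, 1:]) = monom 1 m - 1"
    using roots_of_unity_split[OF m(2)] by blast
  have m0: "m > 0" using m(2) by (cases m) auto
  have "degree (\<Prod>z\<leftarrow>zs. [:-z, 1:]) = length zs" by (rule degree_prod_linear)
  moreover have "degree (monom 1 m - 1 :: 'k poly) = m"
  proof -
    have "degree (monom 1 m + (- 1) :: 'k poly) = degree (monom (1 :: 'k) m)"
      using m0 by (intro degree_add_eq_left) (simp add: degree_monom_eq)
    then show ?thesis by (simp add: degree_monom_eq)
  qed
  ultimately have len: "length zs = m" using zs(2) by simp
  have "shift_product A zs w = 0\<^sub>v N" if w: "w \<in> carrier_vec N" for w
  proof (rule eq_vecI)
    fix i assume "i < dim_vec (0\<^sub>v N :: 'k vec)"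
    then have i: "i < N" by simp
    let ?a = "\<lambda>k. (((*\<^sub>v) A ^^ k) w) $ i"
    have pow: "((*\<^sub>v) A ^^ k) u = A ^\<^sub>m k *\<^sub>v u" if "u \<in> carrier_vec N" for k u
      using that
    proof (induction k arbitrary: u)
      case (Suc k)
      have "((*\<^sub>v) A ^^ Suc k) u = ((*\<^sub>v) A ^^ k) (A *\<^sub>v u)" by (simp add: funpow_swap1)
      also have "\<dots> = A ^\<^sub>m k *\<^sub>v (A *\<^sub>v u)"
        by (rule Suc.IH[OF mult_mat_vec_closed[OF A Suc.prems]])
      also have "\<dots> = A ^\<^sub>m Suc k *\<^sub>v u"
        using assoc_mult_mat_vec[OF pow_carrier_mat[OF A] A Suc.prems, of k] by simp
      finally show ?case .
    qed (use A in simp)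
    have "shift_product A zs w $ i = (\<Sum>k\<le>m. coeff (monom 1 m - 1) k * ?a k)"
      using shift_product_expand[OF A w i, of zs] zs(2) len by simp
    also have "\<dots> = (\<Sum>k\<le>m. (if k = m then ?a k else 0)) - (\<Sum>k\<le>m. (if k = 0 then ?a k else 0))"
      unfolding sum_subtractf[symmetric] by (intro sum.cong refl) (use m0 in \<open>auto simp: coeff_monom\<close>)
    also have "\<dots> = ?a m - ?a 0" by simp
    also have "\<dots> = 0" unfolding pow[OF w, of m] m(1) using w by simp
    finally show "shift_product A zs w $ i = 0\<^sub>v N $ i" using i by simp
  qed (use shift_product_closed[OF A w] in simp)
  with zs(1) show ?thesis by blast
qed

text \<open>
  Among the invariant subspaces on which \<open>l\<close> does not vanish take one of least dimension. A matrix
  in \<open>S\<close> has an eigenspace in it on which \<open>l\<close> does not vanish, and this eigenspace is again invariant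
  under \<open>S\<close>, so it is everything: all matrices in \<open>S\<close> act as scalars.
\<close>

lemma common_eigenvector:
  fixes S :: "'k::alg_closed_field mat set" and l :: "'k vec \<Rightarrow> 'k"
  assumes SC: "\<And>A. A \<in> S \<Longrightarrow> A \<in> carrier_mat N N"
    and comm: "\<And>A B. A \<in> S \<Longrightarrow> B \<in> S \<Longrightarrow> A * B = B * A"
    and tors: "\<And>A. A \<in> S \<Longrightarrow> \<exists>m. A ^\<^sub>m m = 1\<^sub>m N \<and> (of_nat m :: 'k) \<noteq> 0"
    and W: "vec_subspace N W" and inv: "\<And>A w. A \<in> S \<Longrightarrow> w \<in> W \<Longrightarrow> A *\<^sub>v w \<in> W"
    and ladd: "\<And>u w. u \<in> carrier_vec N \<Longrightarrow> w \<in> carrier_vec N \<Longrightarrow> l (u + w) = l u + l w"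
    and lsmult: "\<And>c w. w \<in> carrier_vec N \<Longrightarrow> l (c \<cdot>\<^sub>v w) = c * l w"
    and w: "w \<in> W" "l w \<noteq> 0"
  shows "\<exists>u\<in>W. l u \<noteq> 0 \<and> (\<forall>A\<in>S. \<exists>z. A *\<^sub>v u = z \<cdot>\<^sub>v u)"
proof -
  let ?P = "\<lambda>U. vec_subspace N U \<and> U \<subseteq> W \<and> (\<forall>A\<in>S. \<forall>u\<in>U. A *\<^sub>v u \<in> U) \<and> (\<exists>u\<in>U. l u \<noteq> 0)"
  have "?P W" using W inv w by blast
  from ex_has_least_nat[of ?P W "\<lambda>U. card (pivots N U)", OF this]
  obtain U where U: "vec_subspace N U" "U \<subseteq> W" "\<And>A u. A \<in> S \<Longrightarrow> u \<in> U \<Longrightarrow> A *\<^sub>v u \<in> U"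
    "\<exists>u\<in>U. l u \<noteq> 0" and least: "\<And>U'. ?P U' \<Longrightarrow> card (pivots N U) \<le> card (pivots N U')"
    by blast
  note UD = vec_subspaceD[OF U(1)]
  obtain u where u: "u \<in> U" "l u \<noteq> 0" using U(4) by blast
  have "\<exists>z. A *\<^sub>v u = z \<cdot>\<^sub>v u" if AS: "A \<in> S" for A
  proof -
    note AC = SC[OF AS]
    obtain m where "A ^\<^sub>m m = 1\<^sub>m N" "(of_nat m :: 'k) \<noteq> 0" using tors[OF AS] by blast
    then obtain zs where zs: "distinct zs" "\<forall>w\<in>carrier_vec N. shift_product A zs w = 0\<^sub>v N"
      using finite_order_shift_product[OF AC] by blast
    have "\<exists>z. \<exists>u\<in>U. A *\<^sub>v u = z \<cdot>\<^sub>v u \<and> l u \<noteq> 0"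
    proof (rule weight_component[where l = l and w = u and zs = zs, OF AC U(1)])
      show "shift_product A zs u = 0\<^sub>v N" using zs(2) UD(1)[OF u(1)] by blast
      show "l (a + b) = l a + l b" if "a \<in> U" "b \<in> U" for a b
        by (rule ladd[OF UD(1)[OF that(1)] UD(1)[OF that(2)]])
      show "l (c \<cdot>\<^sub>v a) = c * l a" if "a \<in> U" for c a
        by (rule lsmult[OF UD(1)[OF that]])
    qed (fact U(3)[OF AS] zs(1) u)+
    then obtain z v where v: "v \<in> U" "A *\<^sub>v v = z \<cdot>\<^sub>v v" "l v \<noteq> 0" by blast
    let ?U = "{x \<in> U. A *\<^sub>v x = z \<cdot>\<^sub>v x}"
    have sub: "vec_subspace N ?U"
      unfolding vec_subspace_def
    proof (intro conjI ballI allI)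
      show "?U \<subseteq> carrier_vec N" using UD(1) by blast
      have "A *\<^sub>v 0\<^sub>v N = z \<cdot>\<^sub>v 0\<^sub>v N" using AC by (intro eq_vecI) auto
      then show "0\<^sub>v N \<in> ?U" using UD(2) by simp
      fix x assume x: "x \<in> ?U"
      then have xC: "x \<in> carrier_vec N" using UD(1) by blast
      have "A *\<^sub>v (c \<cdot>\<^sub>v x) = z \<cdot>\<^sub>v (c \<cdot>\<^sub>v x)" for c
        using x mult_mat_vec[OF AC xC] by (simp add: smult_smult_assoc mult.commute)
      then show "c \<cdot>\<^sub>v x \<in> ?U" for c using x UD(4) by simp
      fix y assume y: "y \<in> ?U"
      then have yC: "y \<in> carrier_vec N" using UD(1) by blast
      have "A *\<^sub>v (x + y) = z \<cdot>\<^sub>v (x + y)"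
        using x y mult_add_distrib_mat_vec[OF AC xC yC] smult_add_distrib_vec[OF xC yC] by simp
      then show "x + y \<in> ?U" using x y UD(3) by simp
    qed
    have inv': "B *\<^sub>v x \<in> ?U" if B: "B \<in> S" and x: "x \<in> ?U" for B x
    proof -
      note BC = SC[OF B]
      have xC: "x \<in> carrier_vec N" using x UD(1) by blast
      have "A *\<^sub>v (B *\<^sub>v x) = (B * A) *\<^sub>v x"
        using assoc_mult_mat_vec[OF AC BC xC] comm[OF AS B] by simp
      also have "\<dots> = B *\<^sub>v (z \<cdot>\<^sub>v x)" using assoc_mult_mat_vec[OF BC AC xC] x by simp
      also have "\<dots> = z \<cdot>\<^sub>v (B *\<^sub>v x)" by (rule mult_mat_vec[OF BC xC])
      finally show ?thesis using x U(3)[OF B] by simp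
    qed
    have "?P ?U" using sub inv' U(2) v by blast
    then have "card (pivots N U) \<le> card (pivots N ?U)" by (rule least)
    then have "\<not> ?U \<subset> U" using pivots_less[OF sub U(1)] by linarith
    then have "?U = U" by blast
    then show ?thesis using u(1) by blast
  qed
  then show ?thesis using u U(2) by blast
qed

subsection \<open>The symplectic form on vectors\<close>

definition omega :: "nat \<Rightarrow> 'k::field vec \<Rightarrow> 'k vec \<Rightarrow> 'k" where
  "omega n u v = (\<Sum>i<2 * n. eps n i * u $ i * v $ bar n i)"

lemma omega_add_right:
  "u \<in> carrier_vec (2 * n) \<Longrightarrow> v \<in> carrier_vec (2 * n) \<Longrightarrow> w \<in> carrier_vec (2 * n) \<Longrightarrow>
    omega n u (v + w) = omega n u v + omega n u w"
  unfolding omega_def sum.distrib[symmetric] by (intro sum.cong refl) (simp add: distrib_left)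

lemma omega_smult_right:
  "u \<in> carrier_vec (2 * n) \<Longrightarrow> v \<in> carrier_vec (2 * n) \<Longrightarrow>
    omega n u (c \<cdot>\<^sub>v v) = c * omega n u v"
  unfolding omega_def sum_distrib_left by (intro sum.cong refl) simp

lemma sum_bar: "(\<Sum>i<2 * n. f (bar n i)) = (\<Sum>i<2 * n. f i)"
  by (rule sum.reindex_bij_witness[of _ "bar n" "bar n"]) auto

lemma omega_swap: "omega n v u = - omega n u v"
proof -
  have "omega n v u = (\<Sum>i<2 * n. eps n (bar n i) * v $ bar n i * u $ bar n (bar n i))"
    unfolding omega_def by (rule sum_bar[symmetric])
  also have "\<dots> = (\<Sum>i<2 * n. - (eps n i * u $ i * v $ bar n i))"
    by (intro sum.cong refl) (simp add: mult_ac)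
  finally show ?thesis by (simp add: omega_def sum_negf)
qed

text \<open>
  This does not follow from \<open>omega_swap\<close> in characteristic 2.
\<close>

lemma omega_self: "omega n u u = 0"
proof -
  have "{..<2 * n} = {..<n} \<union> {n..<2 * n}" by auto
  then have "omega n u u = (\<Sum>i<n. eps n i * u $ i * u $ bar n i) + (\<Sum>i\<in>{n..<2 * n}. eps n i * u $ i * u $ bar n i)"
    unfolding omega_def by (simp add: sum.union_disjoint ivl_disj_int)
  also have "(\<Sum>i\<in>{n..<2 * n}. eps n i * u $ i * u $ bar n i) = (\<Sum>i<n. - (u $ i * u $ (i + n)))"
    by (rule sum.reindex_bij_witness[of _ "\<lambda>i. i + n" "\<lambda>i. i - n"]) (auto simp: eps_def bar_def mult.commute)
  also have "(\<Sum>i<n. eps n i * u $ i * u $ bar n i) = (\<Sum>i<n. u $ i * u $ (i + n))"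
    by (intro sum.cong refl) (simp add: eps_def bar_def)
  finally show ?thesis by (simp add: sum_negf)
qed

lemma omega_smult_left:
  assumes "u \<in> carrier_vec (2 * n)" "v \<in> carrier_vec (2 * n)"
  shows "omega n (c \<cdot>\<^sub>v u) v = c * omega n u v"
  using omega_smult_right[OF assms(2,1), of c] omega_swap[of n v] by simp

lemma omega_invariant:
  assumes A: "A \<in> carrier (Sp n)" and u: "u \<in> carrier_vec (2 * n)" and v: "v \<in> carrier_vec (2 * n)"
  shows "omega n (A *\<^sub>v u) (A *\<^sub>v v) = omega n u v"
proof -
  note AC = Sp_carrier[OF A]
  have entry: "(A *\<^sub>v w) $ i = (\<Sum>j<2 * n. A $$ (i, j) * w $ j)"
    if "i < 2 * n" "w \<in> carrier_vec (2 * n)" for i w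
    using AC that by (auto simp: scalar_prod_def atLeast0LessThan intro!: sum.cong)
  have "omega n (A *\<^sub>v u) (A *\<^sub>v v)
      = (\<Sum>i<2 * n. \<Sum>j<2 * n. \<Sum>l<2 * n. u $ j * v $ l * (eps n i * A $$ (i, j) * A $$ (bar n i, l)))"
    unfolding omega_def
  proof (intro sum.cong refl)
    fix i assume "i \<in> {..<2 * n}"
    then have i: "i < 2 * n" by simp
    have "eps n i * (A *\<^sub>v u) $ i * (A *\<^sub>v v) $ bar n i
        = eps n i * ((\<Sum>j<2 * n. A $$ (i, j) * u $ j) * (\<Sum>l<2 * n. A $$ (bar n i, l) * v $ l))"
      using entry[OF i u] entry[of "bar n i" v] i v by (simp add: mult.assoc)
    also have "\<dots> = (\<Sum>j<2 * n. \<Sum>l<2 * n. u $ j * v $ l * (eps n i * A $$ (i, j) * A $$ (bar n i, l)))"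
      unfolding sum_product unfolding sum_distrib_left
      by (intro sum.cong refl) (simp only: mult_ac)
    finally show "eps n i * (A *\<^sub>v u) $ i * (A *\<^sub>v v) $ bar n i
        = (\<Sum>j<2 * n. \<Sum>l<2 * n. u $ j * v $ l * (eps n i * A $$ (i, j) * A $$ (bar n i, l)))" .
  qed
  also have "\<dots> = (\<Sum>j<2 * n. \<Sum>i<2 * n. \<Sum>l<2 * n. u $ j * v $ l * (eps n i * A $$ (i, j) * A $$ (bar n i, l)))"
    by (rule sum.swap)
  also have "\<dots> = (\<Sum>j<2 * n. \<Sum>l<2 * n. \<Sum>i<2 * n. u $ j * v $ l * (eps n i * A $$ (i, j) * A $$ (bar n i, l)))"
    by (intro sum.cong refl sum.swap)
  also have "\<dots> = (\<Sum>j<2 * n. \<Sum>l<2 * n. if l = bar n j then eps n j * u $ j * v $ l else 0)"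
    using A unfolding sum_distrib_left[symmetric] Sp_iff by (intro sum.cong refl) auto
  also have "\<dots> = omega n u v" unfolding omega_def by (intro sum.cong refl) simp
  finally show ?thesis .
qed

lemma omega_nondegenerate:
  assumes v: "v \<in> carrier_vec (2 * n)" "v \<noteq> 0\<^sub>v (2 * n)"
  shows "\<exists>u\<in>carrier_vec (2 * n). omega n v u \<noteq> 0"
proof -
  have "\<exists>i<2 * n. v $ i \<noteq> 0"
  proof (rule ccontr)
    assume "\<not> ?thesis"
    then have "v = 0\<^sub>v (2 * n)" using v(1) by (intro eq_vecI) auto
    with v(2) show False by simp
  qed
  then obtain i where i: "i < 2 * n" "v $ i \<noteq> 0" by blast
  let ?u = "unit_vec (2 * n) (bar n i)"
  have "omega n v ?u = (\<Sum>k<2 * n. if k = i then eps n i * v $ i else 0)"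
    unfolding omega_def by (intro sum.cong refl) (use i in \<open>auto simp: bar_eq_iff\<close>)
  also have "\<dots> \<noteq> 0" using i by (auto simp: eps_def)
  finally show ?thesis by (intro bexI[of _ ?u]) auto
qed

text \<open>Fewer than \<open>2 n\<close> linear conditions have a common non-zero solution.\<close>

lemma exists_orthogonal_vector:
  fixes e f :: "nat \<Rightarrow> 'k::field vec"
  assumes k: "k < n"
    and e: "\<And>i. i < k \<Longrightarrow> e i \<in> carrier_vec (2 * n)" and f: "\<And>i. i < k \<Longrightarrow> f i \<in> carrier_vec (2 * n)"
  shows "\<exists>w\<in>carrier_vec (2 * n). w \<noteq> 0\<^sub>v (2 * n) \<and> (\<forall>i<k. omega n (e i) w = 0 \<and> omega n (f i) w = 0)"
proof -
  define row where "row x = vec (2 * n) (\<lambda>j. - (eps n j * x $ bar n j))" for x :: "'k vec"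
  have row: "row x \<bullet> w = omega n x w" if "w \<in> carrier_vec (2 * n)" for x w
  proof -
    have "row x \<bullet> w = (\<Sum>j<2 * n. - (eps n j * x $ bar n j) * w $ j)"
      using that by (auto simp: scalar_prod_def row_def atLeast0LessThan)
    also have "\<dots> = (\<Sum>j<2 * n. eps n (bar n j) * x $ bar n j * w $ bar n (bar n j))"
      by (intro sum.cong refl) simp
    also have "\<dots> = omega n x w"
      unfolding omega_def by (rule sum_bar[where n = n and f = "\<lambda>i. eps n i * x $ i * w $ bar n i"])
    finally show ?thesis .
  qed
  define c where "c i = (if i < k then row (e i) else if i < 2 * k then row (f (i - k)) else 0\<^sub>v (2 * n))" for i
  have cC: "c \<in> {0..<2 * n} \<rightarrow> carrier_vec (2 * n)" by (auto simp: c_def row_def)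
  \<comment> \<open>the conditions leave the last row of a square matrix empty, so its determinant vanishes\<close>
  define z where "z = 2 * n - 1"
  have z: "z < 2 * n" "\<not> z < 2 * k" using k by (auto simp: z_def)
  let ?M = "mat\<^sub>r (2 * n) (2 * n) (\<lambda>i. if i = z then 0\<^sub>v (2 * n) else c i)"
  have MC: "?M \<in> carrier_mat (2 * n) (2 * n)" by simp
  have "det ?M = 0" by (rule det_row_0[OF z(1) cC])
  then obtain w where w: "w \<in> carrier_vec (2 * n)" "w \<noteq> 0\<^sub>v (2 * n)" "?M *\<^sub>v w = 0\<^sub>v (2 * n)"
    using det_0_iff_vec_prod_zero[OF MC] by blast
  have orth: "c i \<bullet> w = 0" if i: "i < 2 * k" for i
  proof -
    have i': "i < 2 * n" "i \<noteq> z" using i z k by auto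
    have "(?M *\<^sub>v w) $ i = c i \<bullet> w"
      using i' cC by (simp add: row_mat_of_row_fun Pi_iff)
    then show ?thesis using w(3) i' by simp
  qed
  have "omega n (e i) w = 0 \<and> omega n (f i) w = 0" if "i < k" for i
    using orth[of i] orth[of "i + k"] that row[OF w(1)] by (simp add: c_def)
  with w show ?thesis by blast
qed

subsection \<open>A symplectic basis of common eigenvectors\<close>

text \<open>
  The first \<open>k\<close> pairs of a symplectic basis.
\<close>

definition hyperbolic :: "nat \<Rightarrow> nat \<Rightarrow> (nat \<Rightarrow> 'k::field vec) \<Rightarrow> (nat \<Rightarrow> 'k vec) \<Rightarrow> bool" where
  "hyperbolic n k e f \<longleftrightarrow>
    (\<forall>i<k. e i \<in> carrier_vec (2 * n) \<and> f i \<in> carrier_vec (2 * n)) \<and>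
    (\<forall>i<k. \<forall>j<k. omega n (e i) (f j) = (if i = j then 1 else 0) \<and>
      omega n (e i) (e j) = 0 \<and> omega n (f i) (f j) = 0)"

lemma hyperbolic_Suc:
  assumes H: "hyperbolic n k e f" and v: "v \<in> carrier_vec (2 * n)" and w: "w \<in> carrier_vec (2 * n)"
    and vo: "\<forall>i<k. omega n (e i) v = 0 \<and> omega n (f i) v = 0"
    and wo: "\<forall>i<k. omega n (e i) w = 0 \<and> omega n (f i) w = 0" and vw: "omega n v w = 1"
  shows "hyperbolic n (Suc k) (e(k := v)) (f(k := w))"
proof -
  have "omega n v (e i) = 0" "omega n v (f i) = 0" "omega n w (e i) = 0" "omega n w (f i) = 0" if "i < k" for i
    using vo wo that omega_swap[of n v] omega_swap[of n w] by simp_all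
  then show ?thesis
    using assms unfolding hyperbolic_def by (auto simp: less_Suc_eq omega_self)
qed

text \<open>
  Project \<open>u\<close> to the orthogonal complement of the given pairs; the correction terms are orthogonal to
  \<open>v\<close>.
\<close>

lemma hyperbolic_project:
  assumes H: "hyperbolic n k e f" and u: "u \<in> carrier_vec (2 * n)" and v: "v \<in> carrier_vec (2 * n)"
    and vo: "\<forall>i<k. omega n (e i) v = 0 \<and> omega n (f i) v = 0" and j: "j \<le> k"
  shows "\<exists>w\<in>carrier_vec (2 * n). omega n v w = omega n v u \<and>
    (\<forall>i<j. omega n (e i) w = 0 \<and> omega n (f i) w = 0)"
  using j
proof (induction j)
  case (Suc j)
  then obtain w where w: "w \<in> carrier_vec (2 * n)" "omega n v w = omega n v u"
    "\<forall>i<j. omega n (e i) w = 0 \<and> omega n (f i) w = 0" by auto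
  have jk: "j < k" using Suc.prems by simp
  have C: "e i \<in> carrier_vec (2 * n)" "f i \<in> carrier_vec (2 * n)" if "i < k" for i
    using H that by (auto simp: hyperbolic_def)
  have rel: "omega n (e i) (f l) = (if i = l then 1 else 0)" "omega n (e i) (e l) = 0" "omega n (f i) (f l) = 0"
    "omega n (f i) (e l) = (if i = l then - 1 else 0)" if "i < k" "l < k" for i l
    using H that omega_swap[of n "f i" "e l"] by (auto simp: hyperbolic_def)
  let ?a = "(- omega n (e j) w) \<cdot>\<^sub>v f j" and ?b = "omega n (f j) w \<cdot>\<^sub>v e j"
  have ab: "?a \<in> carrier_vec (2 * n)" "?b \<in> carrier_vec (2 * n)" using C[OF jk] by auto
  have expand: "omega n x (w + ?a + ?b)
      = omega n x w - omega n (e j) w * omega n x (f j) + omega n (f j) w * omega n x (e j)"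
    if "x \<in> carrier_vec (2 * n)" for x
    using that w(1) ab C[OF jk] by (simp add: omega_add_right omega_smult_right)
  have "omega n v (e j) = 0" "omega n v (f j) = 0"
    using vo jk omega_swap[of n v] by simp_all
  then have "omega n v (w + ?a + ?b) = omega n v u" using expand[OF v] w(2) by simp
  moreover have "omega n (e i) (w + ?a + ?b) = 0 \<and> omega n (f i) (w + ?a + ?b) = 0" if i: "i < Suc j" for i
  proof -
    have ik: "i < k" using i jk by simp
    show ?thesis
      unfolding expand[OF C(1)[OF ik]] expand[OF C(2)[OF ik]] using rel[OF ik jk] w(3) i
      by (cases "i = j") auto
  qed
  moreover have "w + ?a + ?b \<in> carrier_vec (2 * n)" using w(1) ab by simp
  ultimately show ?case by blast
qed (use u in auto)

text \<open>
  The induction adds a hyperbolic pair of common eigenvectors in the orthogonal complement \<open>W\<close> of the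
  pairs found so far. The first vector \<open>v\<close> comes from \<open>common_eigenvector\<close> with a coordinate as
  functional, the second one with the functional \<open>omega n v\<close>, which does not vanish on \<open>W\<close> because the
  form is non-degenerate.
\<close>

lemma symplectic_diagonalization:
  fixes S :: "'k::alg_closed_field mat set"
  assumes S: "S \<subseteq> carrier (Sp n)"
    and comm: "\<And>A B. A \<in> S \<Longrightarrow> B \<in> S \<Longrightarrow> A * B = B * A"
    and tors: "\<And>A. A \<in> S \<Longrightarrow> \<exists>m. A ^\<^sub>m m = 1\<^sub>m (2 * n) \<and> (of_nat m :: 'k) \<noteq> 0"
  shows "\<exists>g\<in>carrier (Sp n). \<forall>A\<in>S. \<exists>c. A * g = g * wperm n id c"
proof -
  let ?V = "carrier_vec (2 * n) :: 'k vec set"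
  have SC: "A \<in> carrier_mat (2 * n) (2 * n)" if "A \<in> S" for A using S Sp_carrier that by blast
  have ASp: "A \<in> carrier (Sp n)" if "A \<in> S" for A using S that by blast
  define eig where "eig u \<longleftrightarrow> (\<forall>A\<in>S. \<exists>z. A *\<^sub>v u = z \<cdot>\<^sub>v u)" for u :: "'k vec"
  have "\<exists>e f. hyperbolic n k e f \<and> (\<forall>i<k. eig (e i) \<and> eig (f i))" if "k \<le> n" for k
    using that
  proof (induction k)
    case (Suc k)
    then obtain e f where H: "hyperbolic n k e f" and ef: "\<And>i. i < k \<Longrightarrow> eig (e i)" "\<And>i. i < k \<Longrightarrow> eig (f i)"
      by auto
    have C: "e i \<in> ?V" "f i \<in> ?V" if "i < k" for i
      using H that by (auto simp: hyperbolic_def)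
    define W where "W = {w \<in> ?V. \<forall>i<k. omega n (e i) w = 0 \<and> omega n (f i) w = 0}"
    have W: "vec_subspace (2 * n) W"
      unfolding vec_subspace_def
    proof (intro conjI ballI allI)
      show "0\<^sub>v (2 * n) \<in> W" unfolding W_def omega_def by simp
      show "u + w \<in> W" if "u \<in> W" "w \<in> W" for u w
        using that C by (simp add: W_def omega_add_right)
      show "c \<cdot>\<^sub>v w \<in> W" if "w \<in> W" for c w
        using that C by (simp add: W_def omega_smult_right)
    qed (simp add: W_def)
    \<comment> \<open>the orthogonal complement of eigenvectors is invariant\<close>
    have perp: "omega n x (A *\<^sub>v w) = 0"
      if A: "A \<in> S" and x: "x \<in> ?V" "eig x" and w: "w \<in> ?V" "omega n x w = 0"
        and y: "y \<in> ?V" "omega n x y \<noteq> 0" for A x w y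
    proof -
      obtain z where z: "A *\<^sub>v x = z \<cdot>\<^sub>v x" using x(2) A by (auto simp: eig_def)
      have scale: "omega n x b = z * omega n x (A *\<^sub>v b)" if "b \<in> ?V" for b
      proof -
        have "A *\<^sub>v b \<in> ?V" using SC[OF A] that by simp
        then have "omega n (A *\<^sub>v x) (A *\<^sub>v b) = z * omega n x (A *\<^sub>v b)"
          unfolding z by (rule omega_smult_left[OF x(1)])
        then show ?thesis using omega_invariant[OF ASp[OF A] x(1) that] by simp
      qed
      have "z \<noteq> 0" using scale[OF y(1)] y(2) by auto
      then show ?thesis using scale[OF w(1)] w(2) by simp
    qed
    have inv: "A *\<^sub>v w \<in> W" if A: "A \<in> S" and w: "w \<in> W" for A w
    proof -
      have "omega n (e i) (A *\<^sub>v w) = 0 \<and> omega n (f i) (A *\<^sub>v w) = 0" if i: "i < k" for i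
      proof
        have one: "omega n (e i) (f i) = 1" using H i by (auto simp: hyperbolic_def)
        show "omega n (e i) (A *\<^sub>v w) = 0"
          using w i one by (intro perp[OF A C(1)[OF i] ef(1)[OF i] _ _ C(2)[OF i]]) (auto simp: W_def)
        show "omega n (f i) (A *\<^sub>v w) = 0"
          using w i one omega_swap[of n "f i" "e i"]
          by (intro perp[OF A C(2)[OF i] ef(2)[OF i] _ _ C(1)[OF i]]) (auto simp: W_def)
      qed
      then show ?thesis using w SC[OF A] by (simp add: W_def)
    qed
    obtain w0 where w0: "w0 \<in> W" "w0 \<noteq> 0\<^sub>v (2 * n)"
      using exists_orthogonal_vector[of k n e f] Suc.prems C by (auto simp: W_def)
    have "\<exists>i<2 * n. w0 $ i \<noteq> 0"
    proof (rule ccontr)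
      assume "\<not> ?thesis"
      then have "w0 = 0\<^sub>v (2 * n)" using w0(1) by (intro eq_vecI) (auto simp: W_def)
      with w0(2) show False by simp
    qed
    then obtain i where i: "i < 2 * n" "w0 $ i \<noteq> 0" by blast
    have "\<exists>u\<in>W. u $ i \<noteq> 0 \<and> (\<forall>A\<in>S. \<exists>z. A *\<^sub>v u = z \<cdot>\<^sub>v u)"
      by (rule common_eigenvector[where l = "\<lambda>u. u $ i" and w = w0, OF SC comm tors W inv])
        (use i w0 in auto)
    then obtain v where v: "v \<in> W" "v $ i \<noteq> 0" "eig v" unfolding eig_def by blast
    have vC: "v \<in> ?V" and vo: "\<forall>i<k. omega n (e i) v = 0 \<and> omega n (f i) v = 0"
      using v(1) by (auto simp: W_def)
    have "v \<noteq> 0\<^sub>v (2 * n)" using v(2) i(1) by auto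
    then obtain u where u: "u \<in> ?V" "omega n v u \<noteq> 0" using omega_nondegenerate[OF vC] by blast
    obtain w1 where w1: "w1 \<in> W" "omega n v w1 \<noteq> 0"
      using hyperbolic_project[OF H u(1) vC vo le_refl] u(2) by (auto simp: W_def)
    have "\<exists>u\<in>W. omega n v u \<noteq> 0 \<and> (\<forall>A\<in>S. \<exists>z. A *\<^sub>v u = z \<cdot>\<^sub>v u)"
      by (rule common_eigenvector[where l = "omega n v" and w = w1, OF SC comm tors W inv])
        (use vC w1 in \<open>auto simp: omega_add_right omega_smult_right\<close>)
    then obtain w where w: "w \<in> W" "omega n v w \<noteq> 0" "eig w" unfolding eig_def by blast
    define w' where "w' = inverse (omega n v w) \<cdot>\<^sub>v w"
    have wC: "w \<in> ?V" using w(1) by (simp add: W_def)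
    have w'W: "w' \<in> W" unfolding w'_def by (rule vec_subspaceD(4)[OF W w(1)])
    have w'C: "w' \<in> ?V" and w'o: "\<forall>i<k. omega n (e i) w' = 0 \<and> omega n (f i) w' = 0"
      using w'W by (auto simp: W_def)
    have "omega n v w' = 1" unfolding w'_def using omega_smult_right[OF vC wC] w(2) by simp
    then have "hyperbolic n (Suc k) (e(k := v)) (f(k := w'))"
      by (rule hyperbolic_Suc[OF H vC w'C vo w'o])
    moreover have "eig w'"
      unfolding eig_def
    proof
      fix A assume A: "A \<in> S"
      then obtain z where "A *\<^sub>v w = z \<cdot>\<^sub>v w" using w(3) by (auto simp: eig_def)
      then have "A *\<^sub>v w' = z \<cdot>\<^sub>v w'"
        unfolding w'_def using mult_mat_vec[OF SC[OF A] wC] by (simp add: smult_smult_assoc mult.commute)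
      then show "\<exists>z. A *\<^sub>v w' = z \<cdot>\<^sub>v w'" by blast
    qed
    then have "\<forall>i<Suc k. eig ((e(k := v)) i) \<and> eig ((f(k := w')) i)"
      using ef v(3) by (auto simp: less_Suc_eq)
    ultimately show ?case by blast
  qed (simp add: hyperbolic_def)
  from this[of n] obtain e f where H: "hyperbolic n n e f"
    and ef: "\<And>i. i < n \<Longrightarrow> eig (e i)" "\<And>i. i < n \<Longrightarrow> eig (f i)" by auto
  define b where "b i = (if i < n then e i else f (i - n))" for i
  define g where "g = mat (2 * n) (2 * n) (\<lambda>(i, j). b j $ i)"
  have gC: "g \<in> carrier_mat (2 * n) (2 * n)" by (simp add: g_def)
  have bC: "b j \<in> ?V" if "j < 2 * n" for j
    using H that by (auto simp: hyperbolic_def b_def)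
  have beig: "eig (b j)" if "j < 2 * n" for j using ef that by (auto simp: b_def)
  have "omega n (b j) (b l) = (if l = bar n j then eps n j else 0)" if jl: "j < 2 * n" "l < 2 * n" for j l
  proof -
    have swap: "omega n (f i) (e m) = - omega n (e m) (f i)" for i m by (rule omega_swap)
    show ?thesis
      using H jl unfolding hyperbolic_def b_def bar_def eps_def by (auto simp: swap)
  qed
  moreover have "(\<Sum>i<2 * n. eps n i * g $$ (i, j) * g $$ (bar n i, l)) = omega n (b j) (b l)"
    if "j < 2 * n" "l < 2 * n" for j l
    unfolding omega_def by (intro sum.cong refl) (use that in \<open>simp add: g_def\<close>)
  ultimately have "g \<in> carrier (Sp n)" unfolding Sp_iff using gC by simp
  moreover have "\<exists>c. A * g = g * wperm n id c" if A: "A \<in> S" for A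
  proof -
    have "\<forall>j<2 * n. \<exists>z. A *\<^sub>v b j = z \<cdot>\<^sub>v b j" using beig A by (auto simp: eig_def)
    then obtain c where c: "\<And>j. j < 2 * n \<Longrightarrow> A *\<^sub>v b j = c j \<cdot>\<^sub>v b j" by metis
    have "A * g = g * wperm n id c"
    proof (rule eq_matI)
      fix i j assume "i < dim_row (g * wperm n id c)" "j < dim_col (g * wperm n id c)"
      then have ij: "i < 2 * n" "j < 2 * n" using gC by auto
      have "(A * g) $$ (i, j) = (\<Sum>k<2 * n. A $$ (i, k) * b j $ k)"
        unfolding mult_index[OF SC[OF A] gC ij] by (intro sum.cong refl) (simp add: g_def ij)
      also have "\<dots> = (A *\<^sub>v b j) $ i"
        using SC[OF A] bC[OF ij(2)] ij by (auto simp: scalar_prod_def atLeast0LessThan intro!: sum.cong)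
      also have "\<dots> = g $$ (i, j) * c j"
        unfolding c[OF ij(2)] using bC[OF ij(2)] ij by (simp add: g_def mult.commute)
      finally show "(A * g) $$ (i, j) = (g * wperm n id c) $$ (i, j)"
        unfolding mult_wperm_id_index[OF gC ij] .
    qed (use SC[OF A] gC in auto)
    then show ?thesis by blast
  qed
  ultimately show ?thesis by blast
qed

section \<open>Every maximal torus is conjugate to the diagonal one\<close>

lemma Gm_power_square_root:
  assumes "s \<in> carrier (Gm_power r :: (nat \<Rightarrow> 'k::alg_closed_field, 'k) alg_group)"
  shows "\<exists>t\<in>carrier (Gm_power r). s = t \<otimes>\<^bsub>Gm_power r\<^esub> t"
proof -
  define t where "t = (\<lambda>i\<in>{..<r}. SOME y. y ^ 2 = s i)"
  have root: "t i * t i = s i" if "i < r" for i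
    using someI_ex[OF nth_root_exists[of 2 "s i"]] that by (simp add: t_def power2_eq_square)
  have nz: "s i \<noteq> 0" if "i < r" for i using assms that by (auto simp: Gm_power_def)
  have "t \<in> carrier (Gm_power r)"
  proof -
    have "t i \<noteq> 0" if "i < r" for i using root[OF that] nz[OF that] by auto
    then show ?thesis unfolding Gm_power_def by (auto simp: PiE_iff) (auto simp: t_def)
  qed
  moreover have "s = t \<otimes>\<^bsub>Gm_power r\<^esub> t"
    using assms root by (auto simp: Gm_power_def intro!: PiE_ext[of s "{..<r}"])
  ultimately show ?thesis by blast
qed

lemma Gm_power_nonzero: "s \<in> carrier (Gm_power r) \<Longrightarrow> i < r \<Longrightarrow> s i \<noteq> (0 :: 'k::field)"
  by (auto simp: Gm_power_def)

lemma Gm_power_mult_index: "i < r \<Longrightarrow> (s \<otimes>\<^bsub>Gm_power r\<^esub> t) i = (s i * t i :: 'k::field)"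
  by (simp add: Gm_power_def)

lemma Gm_power_pow_index:
  "i < r \<Longrightarrow> (s [^]\<^bsub>Gm_power r\<^esub> (m :: nat)) i = (s i ^ m :: 'k::field)"
proof (induction m)
  case 0
  then show ?case by (simp add: nat_pow_def Gm_power_def)
next
  case (Suc m)
  have "s [^]\<^bsub>Gm_power r\<^esub> Suc m = s [^]\<^bsub>Gm_power r\<^esub> m \<otimes>\<^bsub>Gm_power r\<^esub> s" by (simp add: nat_pow_def)
  then show ?case using Suc by (simp add: Gm_power_mult_index)
qed

lemma Gm_power_torsion:
  fixes s :: "nat \<Rightarrow> 'q::prime_card mod_ring alg_closure"
  assumes "s \<in> carrier (Gm_power r)"
  shows "\<exists>m. (of_nat m :: 'q mod_ring alg_closure) \<noteq> 0 \<and> (\<forall>i<r. s i ^ m = 1)"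
proof -
  have "\<exists>m. (of_nat m :: 'q mod_ring alg_closure) \<noteq> 0 \<and> (\<forall>i<k. s i ^ m = 1)" if "k \<le> r" for k
    using that
  proof (induction k)
    case (Suc k)
    then obtain m where m: "(of_nat m :: 'q mod_ring alg_closure) \<noteq> 0" "\<forall>i<k. s i ^ m = 1" by auto
    have "s k \<noteq> 0" using Gm_power_nonzero[OF assms, of k] Suc.prems by simp
    then obtain l where l: "s k ^ l = 1" "(of_nat l :: 'q mod_ring alg_closure) \<noteq> 0"
      using alg_closure_torsion by blast
    have "s i ^ (m * l) = 1" if "i < Suc k" for i
    proof (cases "i = k")
      case True
      then show ?thesis using l by (simp add: mult.commute[of m] power_mult)
    next
      case False
      then show ?thesis using m(2) that by (simp add: power_mult)
    qed
    then show ?case using m l by (intro exI[of _ "m * l"]) simp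
  qed (auto intro: exI[of _ 1])
  then show ?thesis by blast
qed

context
  fixes n :: nat
  assumes n: "n \<ge> 1"
begin

lemma torus_square_root:
  fixes T :: "'k::alg_closed_field mat set set"
  assumes T: "torus (PSp n) T" and x: "x \<in> T"
  shows "\<exists>y\<in>T. x = y \<otimes>\<^bsub>PSp n\<^esub> y"
proof -
  obtain r \<phi> where "\<phi> \<in> alg_iso (Gm_power r) (alg_subgroup (PSp n) T)"
    using T by (auto simp: torus_def)
  then have hom: "\<phi> \<in> hom (Gm_power r) (alg_subgroup (PSp n) T)" and img: "\<phi> ` carrier (Gm_power r) = T"
    by (auto simp: alg_iso_def alg_hom_def alg_subgroup_def bij_betw_def)
  obtain s where s: "s \<in> carrier (Gm_power r)" "x = \<phi> s" using x img by blast
  obtain t where t: "t \<in> carrier (Gm_power r)" "s = t \<otimes>\<^bsub>Gm_power r\<^esub> t"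
    using Gm_power_square_root[OF s(1)] by blast
  have "x = \<phi> t \<otimes>\<^bsub>PSp n\<^esub> \<phi> t"
    using hom_mult[OF hom t(1) t(1)] s t by (simp add: alg_subgroup_def)
  moreover have "\<phi> t \<in> T" using img t by blast
  ultimately show ?thesis by blast
qed

lemma proj_pow:
  fixes A :: "'k::alg_closed_field mat"
  assumes A: "A \<in> carrier (Sp n)"
  shows "A ^\<^sub>m m \<in> carrier (Sp n)" "proj n A [^]\<^bsub>PSp n\<^esub> m = proj n (A ^\<^sub>m m)"
proof -
  interpret group "PSp n :: ('k mat set, 'k) alg_group" by (rule group_PSp[OF n])
  have one: "1\<^sub>m (2 * n) \<in> carrier (Sp n :: 'k mat monoid)" by (rule one_Sp)
  have "A ^\<^sub>m m \<in> carrier (Sp n) \<and> proj n A [^]\<^bsub>PSp n\<^esub> m = proj n (A ^\<^sub>m m)"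
  proof (induction m)
    case 0
    show ?case using one Sp_carrier[OF A] by (simp add: PSp_one[OF n])
  next
    case (Suc m)
    then show ?case using A by (simp add: Sp_mult PSp_mult[OF n])
  qed
  then show "A ^\<^sub>m m \<in> carrier (Sp n)" "proj n A [^]\<^bsub>PSp n\<^esub> m = proj n (A ^\<^sub>m m)" by auto
qed

text \<open>
  A point of the torus has some order \<open>m\<close> prime to \<open>p\<close>, so that \<open>A\<^sup>m = \<plusminus>1\<close>. For odd \<open>p\<close> the exponent
  \<open>2 m\<close> is still prime to \<open>p\<close>; for \<open>p = 2\<close> there is no sign.
\<close>

lemma torus_lift_torsion:
  fixes T :: "'q::prime_card mod_ring alg_closure mat set set"
  assumes T: "torus (PSp n) T" and A: "A \<in> carrier (Sp n)" "proj n A \<in> T"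
  shows "\<exists>m. A ^\<^sub>m m = 1\<^sub>m (2 * n) \<and> (of_nat m :: 'q mod_ring alg_closure) \<noteq> 0"
proof -
  let ?G = "PSp n :: ('q mod_ring alg_closure mat set, 'q mod_ring alg_closure) alg_group"
  interpret group ?G by (rule group_PSp[OF n])
  obtain r \<phi> where "\<phi> \<in> alg_iso (Gm_power r) (alg_subgroup ?G T)"
    using T by (auto simp: torus_def)
  then have hom: "\<phi> \<in> hom (Gm_power r) (alg_subgroup ?G T)"
    and img: "\<phi> ` carrier (Gm_power r) = T"
    by (auto simp: alg_iso_def alg_hom_def alg_subgroup_def bij_betw_def)
  have TC: "T \<subseteq> carrier ?G" using T subgroup.subset by (auto simp: torus_def)
  obtain s where s: "s \<in> carrier (Gm_power r)" "proj n A = \<phi> s" using A(2) img by blast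
  have mult: "\<phi> (u \<otimes>\<^bsub>Gm_power r\<^esub> v) = \<phi> u \<otimes>\<^bsub>?G\<^esub> \<phi> v"
    if "u \<in> carrier (Gm_power r)" "v \<in> carrier (Gm_power r)" for u v
    using hom_mult[OF hom that] by (simp add: alg_subgroup_def)
  have in_G: "\<phi> u \<in> carrier ?G" if "u \<in> carrier (Gm_power r)" for u using img TC that by blast
  let ?o = "\<one>\<^bsub>Gm_power r\<^esub> :: nat \<Rightarrow> 'q mod_ring alg_closure"
  have o: "?o \<in> carrier (Gm_power r)" "?o \<otimes>\<^bsub>Gm_power r\<^esub> ?o = ?o"
    by (auto simp: Gm_power_def)
  have "\<phi> ?o \<otimes>\<^bsub>?G\<^esub> \<phi> ?o = \<phi> ?o" using mult[OF o(1,1)] o(2) by simp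
  then have \<phi>_one: "\<phi> ?o = \<one>\<^bsub>?G\<^esub>" using in_G[OF o(1)] by (simp add: l_cancel_one)
  have pow: "s [^]\<^bsub>Gm_power r\<^esub> k \<in> carrier (Gm_power r) \<and> \<phi> (s [^]\<^bsub>Gm_power r\<^esub> k) = proj n A [^]\<^bsub>?G\<^esub> k" for k :: nat
  proof (induction k)
    case 0
    show ?case using o(1) \<phi>_one by (simp add: nat_pow_def)
  next
    case (Suc k)
    have "s [^]\<^bsub>Gm_power r\<^esub> Suc k = s [^]\<^bsub>Gm_power r\<^esub> k \<otimes>\<^bsub>Gm_power r\<^esub> s" by (simp add: nat_pow_def)
    moreover have "s [^]\<^bsub>Gm_power r\<^esub> k \<otimes>\<^bsub>Gm_power r\<^esub> s \<in> carrier (Gm_power r)"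
      using Suc s(1) by (auto simp: Gm_power_def PiE_iff)
    ultimately show ?case using Suc s mult by simp
  qed
  obtain m where m: "(of_nat m :: 'q mod_ring alg_closure) \<noteq> 0" "\<forall>i<r. s i ^ m = 1" using Gm_power_torsion[OF s(1)] by blast
  have "s [^]\<^bsub>Gm_power r\<^esub> m = ?o"
  proof (rule PiE_ext)
    show "s [^]\<^bsub>Gm_power r\<^esub> m \<in> {..<r} \<rightarrow>\<^sub>E (UNIV - {0})" using pow[of m] by (simp add: Gm_power_def)
    show "?o \<in> {..<r} \<rightarrow>\<^sub>E (UNIV - {0})" using o(1) by (simp add: Gm_power_def)
    show "(s [^]\<^bsub>Gm_power r\<^esub> m) i = ?o i" if "i \<in> {..<r}" for i
      using that m(2) Gm_power_pow_index[of i r s m] by (simp add: Gm_power_def)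
  qed
  then have "proj n (A ^\<^sub>m m) = proj n (1\<^sub>m (2 * n))"
    using pow[of m] \<phi>_one proj_pow[OF A(1), of m] by (simp add: PSp_one[OF n])
  moreover have "1\<^sub>m (2 * n) \<in> carrier (Sp n :: 'q mod_ring alg_closure mat monoid)" by (rule one_Sp)
  ultimately have cases: "A ^\<^sub>m m = 1\<^sub>m (2 * n) \<or> A ^\<^sub>m m = - 1\<^sub>m (2 * n)"
    using proj_eq_iff[OF n proj_pow(1)[OF A(1), of m]] by blast
  show ?thesis
  proof (cases "(2 :: 'q mod_ring alg_closure) = 0")
    case True
    then have "1 + 1 = (0 :: 'q mod_ring alg_closure)" by simp
    then have minus_1: "- 1 = (1 :: 'q mod_ring alg_closure)" using minus_unique by blast
    have "- 1\<^sub>m (2 * n) = (1\<^sub>m (2 * n) :: 'q mod_ring alg_closure mat)" 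
      unfolding wperm_one wperm_uminus minus_1 ..
    then show ?thesis using cases m(1) by auto
  next
    case False
    have AC: "A \<in> carrier_mat (2 * n) (2 * n)" by (rule Sp_carrier[OF A(1)])
    have "A ^\<^sub>m (m + k) = A ^\<^sub>m m * A ^\<^sub>m k" for k
    proof (induction k)
      case (Suc k)
      have "A ^\<^sub>m (m + Suc k) = A ^\<^sub>m m * A ^\<^sub>m k * A" using Suc by simp
      also have "\<dots> = A ^\<^sub>m m * (A ^\<^sub>m k * A)"
        by (rule assoc_mult_mat) (use AC pow_carrier_mat in auto)
      finally show ?case by simp
    qed (use AC in simp)
    then have "A ^\<^sub>m (m + m) = A ^\<^sub>m m * A ^\<^sub>m m" .
    also have "\<dots> = 1\<^sub>m (2 * n)" using cases by auto
    finally have "A ^\<^sub>m (m + m) = 1\<^sub>m (2 * n)" .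
    moreover have "(of_nat (m + m) :: 'q mod_ring alg_closure) \<noteq> 0"
      using False m(1) by (simp flip: mult_2)
    ultimately show ?thesis by blast
  qed
qed

text \<open>
  The commutator of lifts is \<open>\<plusminus>1\<close>, hence trivial if one of the arguments is a square.
\<close>

lemma torus_lift_commute:
  fixes T :: "'k::alg_closed_field mat set set"
  assumes T: "torus (PSp n) T" and A: "A \<in> carrier (Sp n)" "proj n A \<in> T"
    and B: "B \<in> carrier (Sp n)" "proj n B \<in> T"
  shows "A * B = B * A"
proof -
  let ?G = "PSp n :: ('k mat set, 'k) alg_group"
  have TC: "T \<subseteq> carrier ?G" using T subgroup.subset by (auto simp: torus_def)
  obtain r \<phi> where "\<phi> \<in> alg_iso (Gm_power r) (alg_subgroup ?G T)"
    using T by (auto simp: torus_def)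
  then have hom: "\<phi> \<in> hom (Gm_power r) (alg_subgroup ?G T)" and img: "\<phi> ` carrier (Gm_power r) = T"
    by (auto simp: alg_iso_def alg_hom_def alg_subgroup_def bij_betw_def)
  have commT: "x \<otimes>\<^bsub>?G\<^esub> y = y \<otimes>\<^bsub>?G\<^esub> x" if xy: "x \<in> T" "y \<in> T" for x y
  proof -
    obtain s t where st: "s \<in> carrier (Gm_power r)" "x = \<phi> s" "t \<in> carrier (Gm_power r)" "y = \<phi> t"
      using xy img by blast
    have "s \<otimes>\<^bsub>Gm_power r\<^esub> t = t \<otimes>\<^bsub>Gm_power r\<^esub> s" by (simp add: Gm_power_def mult.commute)
    then show ?thesis
      using hom_mult[OF hom st(1,3)] hom_mult[OF hom st(3,1)] st by (simp add: alg_subgroup_def)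
  qed
  obtain y where y: "y \<in> T" "proj n A = y \<otimes>\<^bsub>?G\<^esub> y" using torus_square_root[OF T A(2)] by blast
  then have "y \<in> carrier ?G" using TC by blast
  then obtain C where C: "C \<in> carrier (Sp n)" "y = proj n C" by (auto simp: PSp_simps(1))
  note AC = Sp_carrier[OF A(1)] and BC = Sp_carrier[OF B(1)] and CC = Sp_carrier[OF C(1)]
  have "A = C * C \<or> A = - (C * C)"
    using y C proj_eq_iff[OF n A(1) Sp_mult[OF C(1) C(1)]] by (simp add: PSp_mult[OF n])
  moreover have "C * C * B = B * (C * C)"
  proof -
    have "proj n (C * B) = proj n (B * C)"
      using commT[OF y(1) B(2)] C B by (simp add: PSp_mult[OF n])
    then have "C * B = B * C \<or> C * B = - (B * C)"
      using proj_eq_iff[OF n Sp_mult[OF C(1) B(1)] Sp_mult[OF B(1) C(1)]] by blast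
    then show ?thesis
    proof
      assume eq: "C * B = B * C"
      have "C * C * B = C * (B * C)" using CC BC by (simp add: eq)
      also have "\<dots> = C * B * C" using CC BC by simp
      also have "\<dots> = B * (C * C)" unfolding eq using CC BC by simp
      finally show ?thesis .
    next
      assume eq: "C * B = - (B * C)"
      have "C * C * B = C * (C * B)" using CC BC by simp
      also have "\<dots> = - (C * (B * C))" unfolding eq using CC BC by simp
      also have "C * (B * C) = C * B * C" using CC BC by simp
      also have "\<dots> = - (B * (C * C))" unfolding eq using CC BC by simp
      finally show ?thesis by simp
    qed
  qed
  ultimately show ?thesis using BC CC by (elim disjE) simp_all
qed

lemma maximal_torus_conjugate:
  fixes T :: "'q::prime_card mod_ring alg_closure mat set set"
  assumes T: "maximal_torus (PSp n) T"
  shows "\<exists>g\<in>carrier (PSp n). T = (\<lambda>x. g \<otimes>\<^bsub>PSp n\<^esub> x \<otimes>\<^bsub>PSp n\<^esub> inv\<^bsub>PSp n\<^esub> g) ` diag_torus n"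
proof -
  have torus: "torus (PSp n) T" using T by (simp add: maximal_torus_def)
  have TC: "T \<subseteq> carrier (PSp n)" using torus subgroup.subset by (auto simp: torus_def)
  let ?S = "{A \<in> carrier (Sp n). proj n A \<in> T}"
  have "\<exists>g\<in>carrier (Sp n). \<forall>A\<in>?S. \<exists>c. A * g = g * wperm n id c"
    by (rule symplectic_diagonalization)
      (use torus_lift_commute[OF torus] torus_lift_torsion[OF torus] in auto)
  then obtain g where g: "g \<in> carrier (Sp n)" "\<forall>A\<in>?S. \<exists>c. A * g = g * wperm n id c" by blast
  obtain h where h: "h \<in> carrier (Sp n)" "g * h = 1\<^sub>m (2 * n)" "h * g = 1\<^sub>m (2 * n)"
    using Sp_inverse[OF g(1)] .
  note gC = Sp_carrier[OF g(1)] and hC = Sp_carrier[OF h(1)]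
  have "T \<subseteq> conj_torus n g h"
  proof
    fix x assume x: "x \<in> T"
    then obtain A where A: "A \<in> carrier (Sp n)" "x = proj n A" using TC by (auto simp: PSp_simps(1))
    note AC = Sp_carrier[OF A(1)]
    obtain c where c: "A * g = g * wperm n id c" using g(2) A x by auto
    have "h * (A * g) = h * g * wperm n id c"
      unfolding c by (rule assoc_mult_mat[symmetric]) (use gC hC in auto)
    then have "h * (A * g) = wperm n id c" unfolding h(3) by simp
    then have cS: "wperm n id c \<in> carrier (Sp n)" using Sp_mult[OF h(1) Sp_mult[OF A(1) g(1)]] by simp
    have "g * wperm n id c * h = A * g * h" unfolding c ..
    also have "\<dots> = A * (g * h)" by (rule assoc_mult_mat) (use AC gC hC in auto)
    finally have "g * wperm n id c * h = A" using AC by (simp add: h(2))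
    then have "x = proj n (g * wperm n id c * h)" using A(2) by simp
    then show "x \<in> conj_torus n g h"
      unfolding conj_torus_def[OF n] by (rule image_eqI[OF _ wperm_id_diag_Sp[OF cS]])
  qed
  moreover have "torus (PSp n) (conj_torus n g h)"
    by (rule conj_torus_torus[OF n g(1) h])
  ultimately have "T = conj_torus n g h" using T by (auto simp: maximal_torus_def)
  then show ?thesis
    using conj_torus_eq_image[OF n g(1) h] g(1) by (auto simp: PSp_simps(1))
qed

end

theorem mainTheorem1:
  fixes p n :: nat
    and G :: "('q::prime_card mod_ring alg_closure mat set, 'q mod_ring alg_closure) alg_group"
    and \<sigma> :: "'q mod_ring alg_closure mat set \<Rightarrow> 'q mod_ring alg_closure mat set"
    and T N :: "'q mod_ring alg_closure mat set set"
  assumes "p = CARD('q)"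
    and "n \<ge> 1"
    and "G = PSp n"
    and "steinberg_endomorphism G \<sigma>"
    and "maximal_torus G T"
    and "\<sigma> ` T \<subseteq> T"
    and "N = normalizer G T"
  shows "has_complement G T N \<longleftrightarrow> p = 2 \<or> n \<le> 2"
proof -
  let ?G = "PSp n :: ('q mod_ring alg_closure mat set, 'q mod_ring alg_closure) alg_group"
  note n = \<open>n \<ge> 1\<close>
  obtain g where g: "g \<in> carrier ?G" and T: "T = (\<lambda>x. g \<otimes>\<^bsub>?G\<^esub> x \<otimes>\<^bsub>?G\<^esub> inv\<^bsub>?G\<^esub> g) ` diag_torus n"
    using maximal_torus_conjugate[OF n] assms(3,5) by blast
  have reduce: "has_complement G T N \<longleftrightarrow> has_complement ?G (diag_torus n) (normalizer ?G (diag_torus n))"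
    unfolding assms(7) T \<open>G = PSp n\<close>
    by (rule has_complement_iso_iff[OF group_PSp[OF n] conjugation_iso[OF group_PSp[OF n] g]
          subgroup.subset[OF diag_torus_subgroup[OF n]]])
  have char: "(2 :: 'q mod_ring alg_closure) = 0 \<longleftrightarrow> p = 2"
  proof -
    have "(of_nat 2 :: 'q mod_ring alg_closure) = 0 \<longleftrightarrow> CHAR('q mod_ring alg_closure) dvd 2" by (rule of_nat_eq_0_iff_char_dvd)
    also have "\<dots> \<longleftrightarrow> p dvd 2" by (simp add: assms(1))
    also have "\<dots> \<longleftrightarrow> p = 2"
      using prime_card[where 'a = 'q] primes_dvd_imp_eq[of p 2] two_is_prime_nat assms(1) by auto
    finally show ?thesis by simp
  qed
  show ?thesis
  proof
    assume "has_complement G T N"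
    then show "p = 2 \<or> n \<le> 2"
      using diag_torus_no_complement[of n, where 'k = "'q mod_ring alg_closure"] char reduce by fastforce
  next
    assume "p = 2 \<or> n \<le> 2"
    then consider "p = 2" | "n = 1" | "n = 2" using n by linarith
    then show "has_complement G T N"
    proof cases
      case 1
      then show ?thesis using diag_torus_complement_char_two[OF n] char reduce by blast
    next
      case 2
      then show ?thesis using diag_torus_complement_rank_one reduce by blast
    next
      case 3
      then show ?thesis using diag_torus_complement_rank_two reduce by blast
    qed
  qed
qed

end
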